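(* Let $p\ge 2$ and $X_{t_0}\in L^{2p}(\Omega)$. Let $a\in C^{1,2}(\mathcal I\times\mathbb R^d,\mathbb R^d)$ and $b^k\in C^2(\mathcal I,\mathbb R^d)$ for $k=1,\dots,m$, and suppose there is a constant $c>0$ such that for all $t\in\mathcal I$, $x,y\in\mathbb R^d$, $k\in\{1,\dots,m\}$ and $q,r\in\{1,\dots,d\}$: (1) $\|a(t,x)\|\le c(1+\|x\|)$ and $\|b^k(t)\|\le c$; (2) $\|a(t,x)-a(t,y)\|\le c\|x-y\|$; (3) $\|\frac{\partial}{\partial x_q}a(t,x)\|\le c$ and $\|\frac{\partial^2}{\partial x_q\partial x_r}a(t,x)\|\le c$; (4) $\|\frac{\partial}{\partial t}a(t,x)\|\le c(1+\|x\|)$, $\|\frac{\mathrm d}{\mathrm dt}b^k(t)\|\le c$ and $\|\frac{\mathrm d^2}{\mathrm dt^2}b^k(t)\|\le c$. Let $(X_t)_{t\in\mathcal I}$ denote the solution of the SDE with additive noise $$X_t=X_{t_0}+\int_{t_0}^t a(s,X_s)\,\mathrm ds+\sum_{k=1}^m\int_{t_0}^t b^k(s)\,\mathrm dW^k_s,\quad t\in\mathcal I,$$ and for $N\in\mathbb N$ let $(Y_n^h)_{0\le n\le N}$ denote the approximations calculated by the SRK method for additive noise (defined in the context) on a grid $\mathcal I_h^N=\{t_0,\dots,t_N\}$ with maximum step size $h$. Let $e=(1,\dots,1)^T\in\mathbb R^s$. If the coefficients of the method fulfill $$\alpha^Te=1,\qquad {\beta^{(1)}}^Te=1,$$ then there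 exist $h_0>0$ and a constant $C>0$ such that $$\Big(\mathrm E\Big(\sup_{0\le n\le N}\|X_{t_n}-Y_n^h\|^p\Big)\Big)^{1/p}\le C\,h$$ on any discretization $\mathcal I_h^N$ for all $0<h\le h_0$.
   Context: Let $(\Omega,\mathcal F,\mathrm P)$ be a complete probability space with a filtration $(\mathcal F_t)_{t\ge 0}$ fulfilling the usual conditions, $0\le t_0<T$, $\mathcal I=[t_0,T]$, $d,m\in\mathbb N$. $W^1,\dots,W^m$ are independent scalar Wiener processes with respect to $(\mathcal F_t)$, and $X_{t_0}$ is an $\mathcal F_{t_0}$-measurable $\mathbb R^d$-valued random variable. $\|\cdot\|$ is the Euclidean norm and $\mathrm E$ the expectation. $C^{j,l}(\mathcal I\times\mathbb R^d,\mathbb R^d)$ denotes functions $j$ times continuously differentiable in $t$ and $l$ times in $x$. A grid (discretization) $\mathcal I_h^N=\{t_0,\dots,t_N\}$ satisfies $t_0<t_1<\dots<t_N=T$, with step sizes $h_n=t_{n+1}-t_n$ and maximum step size $h=\max_{0\le n<N}h_n$. Put $I_{(k),n}=W^k_{t_{n+1}}-W^k_{t_n}$. The SRK method for additive noise with $s$ stages ($s\in\mathbb N$) has coefficients $\alpha,\beta^{(1)},c^{(0)},c^{(1)}\in\mathbb R^s$, $A^{(0)}\in\mathbb R^{s\times s}$ and is defined by $Y_0=X_{t_0}$ and, for $n=0,\dots,N-1$, $$Y_{n+1}=Y_n+\sum_{i=1}^s\alpha_i\,a(t_n+c_i^{(0)}h_n,H_{i,n}^{(0)})\,h_n+\sum_{i=1}^s\sum_{k=1}^m\beta_i^{(1)}I_{(k),n}\,b^k(t_n+c_i^{(1)}h_n),$$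 $$H_{i,n}^{(0)}=Y_n+\sum_{j=1}^sA_{i,j}^{(0)}\,a(t_n+c_j^{(0)}h_n,H_{j,n}^{(0)})\,h_n,\quad i=1,\dots,s.$$ $Y_n^h$ denotes $Y_n$ computed on a grid with maximum step size $h$. The stage equations may be implicit; they are uniquely solvable for sufficiently small step sizes. All evaluation times $t_n+c_i^{(q)}h_n$ are understood to lie in $\mathcal I$ (e.g. $c_i^{(0)},c_i^{(1)}\in[0,1]$). *)

theory Defs
  imports "HOL-Probability.Probability"
begin

text \<open>Filtrations and processes are indexed by \<open>real\<close>; only their values at times \<open>t \<ge> 0\<close> matter.\<close>

definition usual_filtration :: "'a measure \<Rightarrow> (real \<Rightarrow> 'a measure) \<Rightarrow> bool" where
  "usual_filtration M F \<longleftrightarrow>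
     (\<forall>t\<ge>0. subalgebra M (F t)) \<and>
     (\<forall>s t. 0 \<le> s \<longrightarrow> s \<le> t \<longrightarrow> sets (F s) \<subseteq> sets (F t)) \<and>
     (\<forall>t\<ge>0. sets (F t) = (\<Inter>s\<in>{t<..}. sets (F s))) \<and>
     null_sets M \<subseteq> sets (F 0)"

definition wiener_process ::
    "'a measure \<Rightarrow> (real \<Rightarrow> 'a measure) \<Rightarrow> (real \<Rightarrow> 'a \<Rightarrow> real) \<Rightarrow> bool" where
  "wiener_process M F W \<longleftrightarrow>
     (\<forall>t\<ge>0. W t \<in> borel_measurable (F t)) \<and>
     (AE \<omega> in M. W 0 \<omega> = 0) \<and>
     (AE \<omega> in M. continuous_on {0..} (\<lambda>t. W t \<omega>)) \<and>
     (\<forall>s t. 0 \<le> s \<longrightarrow> s < t \<longrightarrow>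
        distributed M lborel (\<lambda>\<omega>. W t \<omega> - W s \<omega>)
          (\<lambda>x. ennreal (normal_density 0 (sqrt (t - s)) x)) \<and>
        prob_space.indep_set M (sets (F s))
          (sets (vimage_algebra (space M) (\<lambda>\<omega>. W t \<omega> - W s \<omega>) borel)))"

text \<open>Independence of the whole processes, seen as random elements of \<open>\<real>\<^bsup>[0,\<infinity>)\<^esup>\<close>
  with the product \<open>\<sigma>\<close>-algebra.\<close>

definition independent_processes :: "'a measure \<Rightarrow> ('k \<Rightarrow> real \<Rightarrow> 'a \<Rightarrow> real) \<Rightarrow> bool" where
  "independent_processes M W \<longleftrightarrow>
     prob_space.indep_vars M (\<lambda>_. PiM {0..} (\<lambda>_. borel))
       (\<lambda>k \<omega>. \<lambda>t\<in>{0..}. W k t \<omega>) UNIV"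

definition grid :: "real \<Rightarrow> real \<Rightarrow> nat \<Rightarrow> (nat \<Rightarrow> real) \<Rightarrow> bool" where
  "grid u v N \<tau> \<longleftrightarrow> \<tau> 0 = u \<and> \<tau> N = v \<and> (\<forall>n<N. \<tau> n < \<tau> (Suc n))"

definition max_step :: "nat \<Rightarrow> (nat \<Rightarrow> real) \<Rightarrow> real" where
  "max_step N \<tau> = Max ((\<lambda>n. \<tau> (Suc n) - \<tau> n) ` {..<N})"

text \<open>\<open>\<xi> i\<close> is the value of the elementary process on \<open>(\<tau> i, \<tau> (Suc i)]\<close>.\<close>

definition elementary_coeffs ::
    "'a measure \<Rightarrow> (real \<Rightarrow> 'a measure) \<Rightarrow> nat \<Rightarrow> (nat \<Rightarrow> real) \<Rightarrow>
     (nat \<Rightarrow> 'a \<Rightarrow> 'b::euclidean_space) \<Rightarrow> bool" where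
  "elementary_coeffs M F N \<tau> \<xi> \<longleftrightarrow>
     (\<forall>i<N. \<xi> i \<in> borel_measurable (F (\<tau> i)) \<and> bounded (\<xi> i ` space M))"

definition elementary_process ::
    "nat \<Rightarrow> (nat \<Rightarrow> real) \<Rightarrow> (nat \<Rightarrow> 'a \<Rightarrow> 'b::euclidean_space) \<Rightarrow> real \<Rightarrow> 'a \<Rightarrow> 'b" where
  "elementary_process N \<tau> \<xi> s \<omega> = (\<Sum>i<N. indicator {\<tau> i<..\<tau> (Suc i)} s *\<^sub>R \<xi> i \<omega>)"

definition elementary_integral ::
    "(real \<Rightarrow> 'a \<Rightarrow> real) \<Rightarrow> nat \<Rightarrow> (nat \<Rightarrow> real) \<Rightarrow> (nat \<Rightarrow> 'a \<Rightarrow> 'b::euclidean_space) \<Rightarrow> 'a \<Rightarrow> 'b" where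
  "elementary_integral W N \<tau> \<xi> \<omega> = (\<Sum>i<N. (W (\<tau> (Suc i)) \<omega> - W (\<tau> i) \<omega>) *\<^sub>R \<xi> i \<omega>)"

text \<open>\<open>J\<close> is (a version of) \<open>\<integral>\<^sub>u\<^sup>v f(s) dW(s)\<close>: the mean-square limit of the integrals of
  elementary processes that approximate \<open>f\<close> in \<open>L\<^sup>2([u,v] \<times> \<Omega>)\<close>. As usual, \<open>J\<close> is determined only up to
  null sets. Each approximating elementary process has its own partition of \<open>[u,v]\<close>.\<close>

definition has_ito_integral ::
    "'a measure \<Rightarrow> (real \<Rightarrow> 'a measure) \<Rightarrow> (real \<Rightarrow> 'a \<Rightarrow> real) \<Rightarrow>
     (real \<Rightarrow> 'a \<Rightarrow> 'b::euclidean_space) \<Rightarrow> real \<Rightarrow> real \<Rightarrow> ('a \<Rightarrow> 'b) \<Rightarrow> bool" where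
  "has_ito_integral M F W f u v J \<longleftrightarrow>
     (\<lambda>(s, \<omega>). indicator {u..v} s *\<^sub>R f s \<omega>) \<in> borel_measurable (lborel \<Otimes>\<^sub>M M) \<and>
     (\<forall>s\<in>{u..v}. f s \<in> borel_measurable (F s)) \<and>
     (\<integral>\<^sup>+\<omega>. (\<integral>\<^sup>+s\<in>{u..v}. ennreal ((norm (f s \<omega>))\<^sup>2) \<partial>lborel) \<partial>M) < \<infinity> \<and>
     J \<in> borel_measurable M \<and>
     (\<exists>(N :: nat \<Rightarrow> nat) (\<tau> :: nat \<Rightarrow> nat \<Rightarrow> real) (\<xi> :: nat \<Rightarrow> nat \<Rightarrow> 'a \<Rightarrow> 'b).
        (\<forall>j. grid u v (N j) (\<tau> j) \<and> elementary_coeffs M F (N j) (\<tau> j) (\<xi> j)) \<and>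
        (\<lambda>j. \<integral>\<^sup>+\<omega>. (\<integral>\<^sup>+s\<in>{u..v}.
           ennreal ((norm (f s \<omega> - elementary_process (N j) (\<tau> j) (\<xi> j) s \<omega>))\<^sup>2) \<partial>lborel) \<partial>M)
          \<longlonglongrightarrow> 0 \<and>
        (\<lambda>j. \<integral>\<^sup>+\<omega>. ennreal ((norm (J \<omega> - elementary_integral W (N j) (\<tau> j) (\<xi> j) \<omega>))\<^sup>2) \<partial>M)
          \<longlonglongrightarrow> 0)"

definition sde_additive_solution ::
    "'a measure \<Rightarrow> (real \<Rightarrow> 'a measure) \<Rightarrow> ('m::finite \<Rightarrow> real \<Rightarrow> 'a \<Rightarrow> real) \<Rightarrow> real \<Rightarrow> real \<Rightarrow>
     (real \<Rightarrow> real^'d \<Rightarrow> real^'d) \<Rightarrow> ('m \<Rightarrow> real \<Rightarrow> real^'d) \<Rightarrow> ('a \<Rightarrow> real^'d) \<Rightarrow>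
     (real \<Rightarrow> 'a \<Rightarrow> real^'d) \<Rightarrow> bool" where
  "sde_additive_solution M F W t0 T a b X0 X \<longleftrightarrow>
     (\<forall>t\<in>{t0..T}. X t \<in> borel_measurable (F t)) \<and>
     (AE \<omega> in M. continuous_on {t0..T} (\<lambda>t. X t \<omega>)) \<and>
     (\<forall>t\<in>{t0..T}. \<exists>J :: 'm \<Rightarrow> 'a \<Rightarrow> real^'d.
        (\<forall>k. has_ito_integral M F (W k) (\<lambda>s \<omega>. b k s) t0 t (J k)) \<and>
        (AE \<omega> in M. X t \<omega> =
           X0 \<omega> + (LBINT s:{t0..t}. a s (X s \<omega>)) + (\<Sum>k\<in>UNIV. J k \<omega>)))"

definition time_deriv :: "real set \<Rightarrow> (real \<Rightarrow> 'b::real_normed_vector) \<Rightarrow> real \<Rightarrow> 'b" where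
  "time_deriv I f t = vector_derivative f (at t within I)"

definition space_deriv ::
    "'d::finite \<Rightarrow> (real \<Rightarrow> real^'d \<Rightarrow> real^'d) \<Rightarrow> real \<Rightarrow> real^'d \<Rightarrow> real^'d" where
  "space_deriv q a t x = vector_derivative (\<lambda>u. a t (x + u *\<^sub>R axis q 1)) (at 0)"

definition C2_on :: "real set \<Rightarrow> (real \<Rightarrow> 'b::real_normed_vector) \<Rightarrow> bool" where
  "C2_on I f \<longleftrightarrow>
     f differentiable_on I \<and> time_deriv I f differentiable_on I \<and>
     continuous_on I (time_deriv I (time_deriv I f))"

text \<open>\<open>C\<^bsup>1,2\<^esup>(I \<times> \<real>\<^sup>d, \<real>\<^sup>d)\<close>: \<open>a\<close>, \<open>\<partial>a/\<partial>t\<close>, \<open>\<partial>a/\<partial>x\<^sub>q\<close> and \<open>\<partial>\<^sup>2a/\<partial>x\<^sub>q\<partial>x\<^sub>r\<close> exist and are jointly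
  continuous on \<open>I \<times> \<real>\<^sup>d\<close>; at the end points of \<open>I\<close> the time derivative is one-sided.\<close>

definition C12_on :: "real set \<Rightarrow> (real \<Rightarrow> real^'d \<Rightarrow> real^'d) \<Rightarrow> bool" where
  "C12_on I a \<longleftrightarrow>
     continuous_on (I \<times> UNIV) (\<lambda>(t, x). a t x) \<and>
     (\<forall>x. (\<lambda>t. a t x) differentiable_on I) \<and>
     continuous_on (I \<times> UNIV) (\<lambda>(t, x). time_deriv I (\<lambda>s. a s x) t) \<and>
     (\<forall>q. \<forall>t\<in>I. \<forall>x. (\<lambda>u. a t (x + u *\<^sub>R axis q 1)) differentiable (at 0)) \<and>
     (\<forall>q. continuous_on (I \<times> UNIV) (\<lambda>(t, x). space_deriv q a t x)) \<and>
     (\<forall>q r. \<forall>t\<in>I. \<forall>x.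
        (\<lambda>u. space_deriv r a t (x + u *\<^sub>R axis q 1)) differentiable (at 0)) \<and>
     (\<forall>q r. continuous_on (I \<times> UNIV) (\<lambda>(t, x). space_deriv q (space_deriv r a) t x))"

text \<open>The stage values \<open>H\<^sub>1, \<dots>, H\<^sub>s\<close> of a step of size \<open>h\<close> from \<open>y\<close> at time \<open>t\<close>. The method may be
  implicit; the stages are meaningful when the equations are uniquely solvable, as is the case for
  Lipschitz \<open>a\<close> and sufficiently small \<open>h\<close>.\<close>

definition srk_stages ::
    "(real \<Rightarrow> real^'d \<Rightarrow> real^'d) \<Rightarrow> real^'s^'s \<Rightarrow> real^'s \<Rightarrow> real \<Rightarrow> real \<Rightarrow> real^'d \<Rightarrow>
     (real^'d)^'s" where
  "srk_stages a A0 c0 t h y =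
     (THE H. \<forall>i. H $ i = y + (\<Sum>j\<in>UNIV. (A0 $ i $ j * h) *\<^sub>R a (t + c0 $ j * h) (H $ j)))"

definition srk_step ::
    "(real \<Rightarrow> real^'d \<Rightarrow> real^'d) \<Rightarrow> ('m::finite \<Rightarrow> real \<Rightarrow> real^'d) \<Rightarrow>
     real^'s \<Rightarrow> real^'s \<Rightarrow> real^'s^'s \<Rightarrow> real^'s \<Rightarrow> real^'s \<Rightarrow>
     real \<Rightarrow> real \<Rightarrow> ('m \<Rightarrow> real) \<Rightarrow> real^'d \<Rightarrow> real^'d" where
  "srk_step a b \<alpha> \<beta> A0 c0 c1 t h dW y =
     y + (\<Sum>i\<in>UNIV. (\<alpha> $ i * h) *\<^sub>R a (t + c0 $ i * h) (srk_stages a A0 c0 t h y $ i))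
       + (\<Sum>i\<in>UNIV. \<Sum>k\<in>UNIV. (\<beta> $ i * dW k) *\<^sub>R b k (t + c1 $ i * h))"

primrec srk_additive ::
    "(real \<Rightarrow> real^'d \<Rightarrow> real^'d) \<Rightarrow> ('m::finite \<Rightarrow> real \<Rightarrow> real^'d) \<Rightarrow>
     real^'s \<Rightarrow> real^'s \<Rightarrow> real^'s^'s \<Rightarrow> real^'s \<Rightarrow> real^'s \<Rightarrow>
     ('m \<Rightarrow> real \<Rightarrow> 'a \<Rightarrow> real) \<Rightarrow> ('a \<Rightarrow> real^'d) \<Rightarrow> (nat \<Rightarrow> real) \<Rightarrow> nat \<Rightarrow> 'a \<Rightarrow> real^'d" where
  "srk_additive a b \<alpha> \<beta> A0 c0 c1 W X0 \<tau> 0 \<omega> = X0 \<omega>"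
| "srk_additive a b \<alpha> \<beta> A0 c0 c1 W X0 \<tau> (Suc n) \<omega> =
     srk_step a b \<alpha> \<beta> A0 c0 c1 (\<tau> n) (\<tau> (Suc n) - \<tau> n)
       (\<lambda>k. W k (\<tau> (Suc n)) \<omega> - W k (\<tau> n) \<omega>)
       (srk_additive a b \<alpha> \<beta> A0 c0 c1 W X0 \<tau> n \<omega>)"

end

theory Submission
  imports Defs
begin

text \<open>Let \<open>Z\<close> be the solution minus its drift integral, so that the increments of \<open>Z\<close> are sums of
  stochastic integrals of deterministic functions. Comparing the drift along \<open>X\<close> with its Taylor
  expansion around \<open>X\<^bsub>t\<^sub>n\<^esub>\<close>, and the stages with \<open>Y\<^sub>n\<close>, the one-step error is
  \<open>h\<^sub>n (a(t\<^sub>n,X\<^bsub>t\<^sub>n\<^esub>) - a(t\<^sub>n,Y\<^sub>n))\<close>, plus a pathwise remainder of order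
  \<open>h\<^sub>n\<^sup>2 (1 + sup \<bar>X\<bar>) + h\<^sub>n sup \<bar>Z - Z\<^bsub>t\<^sub>n\<^esub>\<bar>\<^sup>2\<close>, plus a conditionally centred term \<open>D\<^sub>n\<close> which is
  linear in the increments of the Wiener processes after \<open>t\<^sub>n\<close> and of size \<open>h\<^sub>n\<^bsup>3/2\<^esup>\<close>. By Gronwall the
  error is bounded pathwise by the accumulated remainders and \<open>max \<bar>D\<^sub>0 + \<dots> + D\<^sub>n\<bar>\<close>.

  All moments come from one device: conditionally on the past, stochastic integrals have Gaussian
  exponential moments, a property stable under sums (by convexity of \<open>exp\<close>), bounded past-measurable
  factors and limits. A maximal inequality for the exponential supermartingale then bounds both
  \<open>max \<bar>D\<^sub>0 + \<dots> + D\<^sub>n\<bar>\<close> in terms of \<open>(\<Sum>h\<^sub>n\<^sup>3)\<^bsup>1/2\<^esup>\<close>, which is of order \<open>h\<close>, and \<open>sup \<bar>Z - Z\<^bsub>t\<^sub>n\<^esub>\<bar>\<close>.\<close>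

section \<open>Conditionally sub-Gaussian random variables\<close>

text \<open>Adding one-step errors of size \<open>h^(3/2)\<close> in norm would leave order 1/2; the
  missing half order has to come from cancellation among the centred terms. Therefore the drift is
  expanded along the increment of \<open>Z\<close>, not of \<open>X\<close>: the gradient is known
  at the start of the step and multiplies an increment that is centred given the past, while the
  drift part of the increment of \<open>X\<close> has size \<open>h\<close> and can go into the
  remainder. The condition on \<alpha> leaves a drift error of size \<open>h^2\<close>; the
  condition on \<beta> makes the noise weights differ from \<open>b\<close> by a multiple of
  \<open>h\<close>, hence the power 3/2. The squared suprema have size \<open>h\<close>, and so has
  their sum weighted by the steps. The obstacle is that the integral is given as a mean-square limit
  only, whereas moments of order \<open>p\<close> of maxima are needed. Exponential bounds are
  therefore tested against every \<open>F u\<close>-measurable \<open>U\<close> with values in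
  \<open>ennreal\<close>: no conditional expectation and no integrability occurs, and Fatou's lemma
  carries the bounds to limits.\<close>

locale filtered_space = prob_space M for M :: "'a measure" +
  fixes F :: "real \<Rightarrow> 'a measure"
  assumes complete_M: "complete_measure M" and filt: "usual_filtration M F"
begin

lemma subalgebra_F: "0 \<le> t \<Longrightarrow> subalgebra M (F t)"
  using filt[unfolded usual_filtration_def, THEN conjunct1] by blast

lemma space_F: "0 \<le> t \<Longrightarrow> space (F t) = space M"
  using subalgebra_F[of t] by (simp add: subalgebra_def)

lemma sets_F_M: "0 \<le> t \<Longrightarrow> sets (F t) \<subseteq> sets M"
  using subalgebra_F[of t] by (simp add: subalgebra_def)

lemma sets_F_mono: "0 \<le> s \<Longrightarrow> s \<le> t \<Longrightarrow> sets (F s) \<subseteq> sets (F t)"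
  using filt[unfolded usual_filtration_def, THEN conjunct2, THEN conjunct1] by blast

lemma null_sets_F: "0 \<le> t \<Longrightarrow> null_sets M \<subseteq> sets (F t)"
  using filt[unfolded usual_filtration_def, THEN conjunct2, THEN conjunct2, THEN conjunct2]
    sets_F_mono[of 0 t] by simp

lemma measurable_F_mono:
  assumes "0 \<le> s" "s \<le> t" and f: "f \<in> measurable (F s) N"
  shows "f \<in> measurable (F t) N"
proof (rule measurableI)
  have sp: "space (F t) = space (F s)" using assms(1,2) by (simp add: space_F[of s] space_F[of t])
  show "f x \<in> space N" if "x \<in> space (F t)" for x
    using measurable_space[OF f] that sp by blast
  show "f -` B \<inter> space (F t) \<in> sets (F t)" if "B \<in> sets N" for B
    using measurable_sets[OF f that] sets_F_mono[OF assms(1,2)] sp by (metis subsetD)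
qed

lemma measurable_F_M:
  assumes "0 \<le> s" and f: "f \<in> measurable (F s) N"
  shows "f \<in> measurable M N"
proof (rule measurableI)
  have sp: "space M = space (F s)" using assms(1) space_F[of s] by simp
  show "f x \<in> space N" if "x \<in> space M" for x
    using measurable_space[OF f] that sp by blast
  show "f -` B \<inter> space M \<in> sets M" if "B \<in> sets N" for B
    using measurable_sets[OF f that] sets_F_M[OF assms(1)] sp by (metis subsetD)
qed

text \<open>Since \<open>F t\<close> contains all null sets and \<open>M\<close> is complete, a
  change on a null set does not affect \<open>F t\<close>-measurability. This keeps almost sure
  limits adapted, in particular integrals that are known only up to null sets.\<close>

lemma measurable_F_AE_eq:
  assumes "0 \<le> t" "g \<in> borel_measurable (F t)" "AE \<omega> in M. f \<omega> = g \<omega>"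
  shows "f \<in> borel_measurable (F t)"
proof (rule measurableI)
  fix B :: "'b set" assume B: "B \<in> sets borel"
  define Nl where "Nl = {\<omega>\<in>space M. f \<omega> \<noteq> g \<omega>}"
  have Nl: "Nl \<in> null_sets M"
    using assms(3) unfolding Nl_def complete_measure.AE_iff_null_sets[OF complete_M] .
  have 1: "Nl \<inter> f -` B \<in> null_sets M"
    by (rule complete_measure.complete2[OF complete_M _ Nl]) (rule Int_lower1)
  have "f -` B \<inter> space (F t) = (g -` B \<inter> space (F t) - Nl) \<union> (Nl \<inter> f -` B)"
    using assms(1) by (auto simp: space_F Nl_def)
  moreover have "g -` B \<inter> space (F t) \<in> sets (F t)" using assms(2) B by (rule measurable_sets)
  ultimately show "f -` B \<inter> space (F t) \<in> sets (F t)"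
    using 1 Nl null_sets_F[OF assms(1)] by (metis sets.Diff sets.Un subsetD)
qed simp

lemma measurable_F_AE_LIMSEQ:
  fixes f :: "'a \<Rightarrow> real"
  assumes "0 \<le> t" "\<And>n. G n \<in> borel_measurable (F t)" "AE \<omega> in M. (\<lambda>n. G n \<omega>) \<longlonglongrightarrow> f \<omega>"
  shows "f \<in> borel_measurable (F t)"
proof -
  have "(\<lambda>\<omega>. lim (\<lambda>n. G n \<omega>)) \<in> borel_measurable (F t)"
    using assms(2) by (rule borel_measurable_lim_metric)
  moreover have "AE \<omega> in M. f \<omega> = lim (\<lambda>n. G n \<omega>)"
    using assms(3) by eventually_elim (simp add: limI)
  ultimately show ?thesis by (rule measurable_F_AE_eq[OF assms(1)])
qed

text \<open>The conditional Laplace transform of \<open>G\<close> given \<open>F u\<close> is dominated by that of a centred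
  Gaussian of standard deviation \<open>\<sigma>\<close>.\<close>

definition subg :: "real \<Rightarrow> real \<Rightarrow> real \<Rightarrow> ('a \<Rightarrow> real) \<Rightarrow> bool" where
  "subg u v \<sigma> G \<longleftrightarrow> 0 \<le> u \<and> u \<le> v \<and> 0 < \<sigma> \<and> G \<in> borel_measurable (F v) \<and>
     (\<forall>U\<in>borel_measurable (F u). \<forall>\<theta>.
        (\<integral>\<^sup>+\<omega>. U \<omega> * ennreal (exp (\<theta> * G \<omega>)) \<partial>M)
          \<le> ennreal (exp (\<theta>\<^sup>2 * \<sigma>\<^sup>2 / 2)) * (\<integral>\<^sup>+\<omega>. U \<omega> \<partial>M))"

lemma subgD:
  assumes "subg u v \<sigma> G"
  shows "0 \<le> u" "u \<le> v" "0 \<le> v" "0 < \<sigma>" "G \<in> borel_measurable (F v)" "G \<in> borel_measurable M"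
proof -
  show 1: "0 \<le> u" "u \<le> v" "0 < \<sigma>" "G \<in> borel_measurable (F v)"
    by (rule assms[unfolded subg_def, THEN conjunct1]
        assms[unfolded subg_def, THEN conjunct2, THEN conjunct1]
        assms[unfolded subg_def, THEN conjunct2, THEN conjunct2, THEN conjunct1]
        assms[unfolded subg_def, THEN conjunct2, THEN conjunct2, THEN conjunct2, THEN conjunct1])+
  from 1 show "0 \<le> v" by linarith
  then show "G \<in> borel_measurable M" using 1(4) by (rule measurable_F_M)
qed

lemma subg_exp:
  assumes "subg u v \<sigma> G" "U \<in> borel_measurable (F u)"
  shows "(\<integral>\<^sup>+\<omega>. U \<omega> * ennreal (exp (\<theta> * G \<omega>)) \<partial>M)
          \<le> ennreal (exp (\<theta>\<^sup>2 * \<sigma>\<^sup>2 / 2)) * (\<integral>\<^sup>+\<omega>. U \<omega> \<partial>M)"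
  using assms unfolding subg_def by blast

section \<open>Closure properties of conditional exponential bounds\<close>

lemma subg_mono:
  assumes "subg u v \<sigma> G" "\<sigma> \<le> \<sigma>'" "v \<le> v'"
  shows "subg u v' \<sigma>' G"
  unfolding subg_def
proof (intro conjI ballI allI)
  note D = subgD[OF assms(1)]
  show "G \<in> borel_measurable (F v')" using D(3,5) assms(3) by (rule_tac measurable_F_mono)
  fix U :: "'a \<Rightarrow> ennreal" and \<theta> :: real assume U: "U \<in> borel_measurable (F u)"
  have "exp (\<theta>\<^sup>2 * \<sigma>\<^sup>2 / 2) \<le> exp (\<theta>\<^sup>2 * \<sigma>'\<^sup>2 / 2)"
    using D assms by (auto intro!: mult_left_mono power_mono divide_right_mono)
  then have "ennreal (exp (\<theta>\<^sup>2 * \<sigma>\<^sup>2 / 2)) * (\<integral>\<^sup>+\<omega>. U \<omega> \<partial>M)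
      \<le> ennreal (exp (\<theta>\<^sup>2 * \<sigma>'\<^sup>2 / 2)) * (\<integral>\<^sup>+\<omega>. U \<omega> \<partial>M)"
    by (intro mult_right_mono ennreal_leI) auto
  with subg_exp[OF assms(1) U, of \<theta>] show "(\<integral>\<^sup>+\<omega>. U \<omega> * ennreal (exp (\<theta> * G \<omega>)) \<partial>M)
      \<le> ennreal (exp (\<theta>\<^sup>2 * \<sigma>'\<^sup>2 / 2)) * (\<integral>\<^sup>+\<omega>. U \<omega> \<partial>M)" by (rule order_trans)
qed (use subgD(1,2,4)[OF assms(1)] assms(2,3) in auto)

lemma subg_scale:
  assumes "subg u v \<sigma> G" "\<kappa> \<noteq> 0"
  shows "subg u v (abs \<kappa> * \<sigma>) (\<lambda>\<omega>. \<kappa> * G \<omega>)"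
  unfolding subg_def
proof (intro conjI ballI allI)
  note D = subgD[OF assms(1)]
  show "(\<lambda>\<omega>. \<kappa> * G \<omega>) \<in> borel_measurable (F v)" using D(5) by measurable
  fix U :: "'a \<Rightarrow> ennreal" and \<theta> :: real assume U: "U \<in> borel_measurable (F u)"
  show "(\<integral>\<^sup>+\<omega>. U \<omega> * ennreal (exp (\<theta> * (\<kappa> * G \<omega>))) \<partial>M)
      \<le> ennreal (exp (\<theta>\<^sup>2 * (abs \<kappa> * \<sigma>)\<^sup>2 / 2)) * (\<integral>\<^sup>+\<omega>. U \<omega> \<partial>M)"
    using subg_exp[OF assms(1) U, of "\<theta> * \<kappa>"] by (simp add: mult.assoc power_mult_distrib)
qed (use subgD(1,2,4)[OF assms(1)] assms(2) in auto)

text \<open>The summands may be arbitrarily dependent, so deviations are added and not variances.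
  This costs constants only, since sums run over dimensions or carry small weights as in a Riemann
  sum.\<close>

lemma subg_add:
  assumes 1: "subg u v \<sigma>1 G1" and 2: "subg u v \<sigma>2 G2"
  shows "subg u v (\<sigma>1 + \<sigma>2) (\<lambda>\<omega>. G1 \<omega> + G2 \<omega>)"
  unfolding subg_def
proof (intro conjI ballI allI)
  note D1 = subgD[OF 1] and D2 = subgD[OF 2]
  show "(\<lambda>\<omega>. G1 \<omega> + G2 \<omega>) \<in> borel_measurable (F v)" using D1(5) D2(5) by measurable
  fix U :: "'a \<Rightarrow> ennreal" and \<theta> :: real assume U: "U \<in> borel_measurable (F u)"
  have [measurable]: "U \<in> borel_measurable M" "G1 \<in> borel_measurable M" "G2 \<in> borel_measurable M"
    using U D1 D2 measurable_F_M by blast+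
  \<comment> \<open>Weights proportional to the deviations: then \<open>\<sigma>1 / w1\<close> and
    \<open>\<sigma>2 / w2\<close> both equal \<open>\<sigma>1 + \<sigma>2\<close>, so the rescaled
    parameters \<open>\<theta> / w1\<close> and \<open>\<theta> / w2\<close> lead to the same
    Gaussian bound.\<close>
  define w1 w2 where "w1 = \<sigma>1 / (\<sigma>1 + \<sigma>2)" and "w2 = \<sigma>2 / (\<sigma>1 + \<sigma>2)"
  have w: "0 < w1" "0 < w2" "w1 + w2 = 1"
    using D1 D2 by (auto simp: w1_def w2_def add_divide_distrib[symmetric])
  have wa: "\<sigma>1 / w1 = \<sigma>1 + \<sigma>2" "\<sigma>2 / w2 = \<sigma>1 + \<sigma>2" using D1 D2 by (auto simp: w1_def w2_def)
  let ?c = "ennreal (exp (\<theta>\<^sup>2 * (\<sigma>1 + \<sigma>2)\<^sup>2 / 2))"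
  have pw: "exp (\<theta> * (x + y)) \<le> w1 * exp ((\<theta> / w1) * x) + w2 * exp ((\<theta> / w2) * y)" for x y
  proof -
    have "exp (w1 *\<^sub>R ((\<theta> / w1) * x) + w2 *\<^sub>R ((\<theta> / w2) * y))
        \<le> w1 * exp ((\<theta> / w1) * x) + w2 * exp ((\<theta> / w2) * y)"
      using convex_onD[OF exp_convex, of w2 "(\<theta> / w1) * x" "(\<theta> / w2) * y"] w
      by (simp add: eq_diff_eq[symmetric])
    then show ?thesis using w by (simp add: algebra_simps)
  qed
  have "(\<integral>\<^sup>+\<omega>. U \<omega> * ennreal (exp (\<theta> * (G1 \<omega> + G2 \<omega>))) \<partial>M)
      \<le> (\<integral>\<^sup>+\<omega>. ennreal w1 * (U \<omega> * ennreal (exp ((\<theta> / w1) * G1 \<omega>)))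
            + ennreal w2 * (U \<omega> * ennreal (exp ((\<theta> / w2) * G2 \<omega>))) \<partial>M)"
  proof (rule nn_integral_mono)
    fix \<omega>
    have "ennreal (exp (\<theta> * (G1 \<omega> + G2 \<omega>)))
        \<le> ennreal w1 * ennreal (exp ((\<theta> / w1) * G1 \<omega>)) + ennreal w2 * ennreal (exp ((\<theta> / w2) * G2 \<omega>))"
      using pw[of "G1 \<omega>" "G2 \<omega>"] w by (simp add: ennreal_mult[symmetric] ennreal_plus[symmetric] del: ennreal_plus)
    then have "U \<omega> * ennreal (exp (\<theta> * (G1 \<omega> + G2 \<omega>)))
        \<le> U \<omega> * (ennreal w1 * ennreal (exp ((\<theta> / w1) * G1 \<omega>)) + ennreal w2 * ennreal (exp ((\<theta> / w2) * G2 \<omega>)))"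
      by (rule mult_left_mono) simp
    then show "U \<omega> * ennreal (exp (\<theta> * (G1 \<omega> + G2 \<omega>)))
        \<le> ennreal w1 * (U \<omega> * ennreal (exp ((\<theta> / w1) * G1 \<omega>)))
            + ennreal w2 * (U \<omega> * ennreal (exp ((\<theta> / w2) * G2 \<omega>)))"
      by (simp add: distrib_left mult.left_commute)
  qed
  also have "\<dots> = ennreal w1 * (\<integral>\<^sup>+\<omega>. U \<omega> * ennreal (exp ((\<theta> / w1) * G1 \<omega>)) \<partial>M)
       + ennreal w2 * (\<integral>\<^sup>+\<omega>. U \<omega> * ennreal (exp ((\<theta> / w2) * G2 \<omega>)) \<partial>M)"
    by (simp add: nn_integral_add nn_integral_cmult)
  also have "\<dots> \<le> ennreal w1 * (?c * (\<integral>\<^sup>+\<omega>. U \<omega> \<partial>M)) + ennreal w2 * (?c * (\<integral>\<^sup>+\<omega>. U \<omega> \<partial>M))"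
  proof (intro add_mono mult_left_mono)
    have e: "(\<theta> / w1)\<^sup>2 * \<sigma>1\<^sup>2 = \<theta>\<^sup>2 * (\<sigma>1 + \<sigma>2)\<^sup>2" "(\<theta> / w2)\<^sup>2 * \<sigma>2\<^sup>2 = \<theta>\<^sup>2 * (\<sigma>1 + \<sigma>2)\<^sup>2"
      using wa by (metis (no_types) power_mult_distrib times_divide_eq_left times_divide_eq_right)+
    show "(\<integral>\<^sup>+\<omega>. U \<omega> * ennreal (exp ((\<theta> / w1) * G1 \<omega>)) \<partial>M) \<le> ?c * (\<integral>\<^sup>+\<omega>. U \<omega> \<partial>M)"
      using subg_exp[OF 1 U, of "\<theta> / w1"] unfolding e .
    show "(\<integral>\<^sup>+\<omega>. U \<omega> * ennreal (exp ((\<theta> / w2) * G2 \<omega>)) \<partial>M) \<le> ?c * (\<integral>\<^sup>+\<omega>. U \<omega> \<partial>M)"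
      using subg_exp[OF 2 U, of "\<theta> / w2"] unfolding e .
  qed auto
  also have "\<dots> = (ennreal w1 + ennreal w2) * (?c * (\<integral>\<^sup>+\<omega>. U \<omega> \<partial>M))"
    by (simp add: distrib_right)
  also have "ennreal w1 + ennreal w2 = 1" using w by (simp add: ennreal_plus[symmetric] del: ennreal_plus)
  finally show "(\<integral>\<^sup>+\<omega>. U \<omega> * ennreal (exp (\<theta> * (G1 \<omega> + G2 \<omega>))) \<partial>M) \<le> ?c * (\<integral>\<^sup>+\<omega>. U \<omega> \<partial>M)" by simp
qed (use subgD(1,2,4)[OF 1] subgD(4)[OF 2] in auto)

lemma subg_sum:
  assumes "finite I" "I \<noteq> {}" "\<And>i. i \<in> I \<Longrightarrow> subg u v (\<sigma> i) (G i)"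
  shows "subg u v (\<Sum>i\<in>I. \<sigma> i) (\<lambda>\<omega>. \<Sum>i\<in>I. G i \<omega>)"
  using assms by (induction rule: finite_ne_induct) (auto intro: subg_add)

text \<open>Fatou's lemma under an almost sure limit. Applied to a constant sequence it also
  transfers the property along an almost sure equality.\<close>

lemma subg_limit:
  assumes G: "\<And>n. subg u v (\<sigma> n) (G n)" and lim: "AE \<omega> in M. (\<lambda>n. G n \<omega>) \<longlonglongrightarrow> G' \<omega>"
    and s: "\<sigma> \<longlonglongrightarrow> \<sigma>'" "0 < \<sigma>'"
  shows "subg u v \<sigma>' G'"
  unfolding subg_def
proof (intro conjI ballI allI)
  note D = subgD[OF G]
  show "G' \<in> borel_measurable (F v)" using D(3) D(5) lim by (rule measurable_F_AE_LIMSEQ)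
  then have [measurable]: "G' \<in> borel_measurable M" using D(3) measurable_F_M by blast
  fix U :: "'a \<Rightarrow> ennreal" and \<theta> :: real assume U: "U \<in> borel_measurable (F u)"
  have [measurable]: "U \<in> borel_measurable M" "\<And>n. G n \<in> borel_measurable M"
    using U D measurable_F_M by blast+
  show "(\<integral>\<^sup>+\<omega>. U \<omega> * ennreal (exp (\<theta> * G' \<omega>)) \<partial>M)
          \<le> ennreal (exp (\<theta>\<^sup>2 * \<sigma>'\<^sup>2 / 2)) * (\<integral>\<^sup>+\<omega>. U \<omega> \<partial>M)"
  \<comment> \<open>If \<open>U\<close> has infinite integral, the right-hand side is infinite;
    finiteness is used below to keep that factor outside a limit in \<open>ennreal\<close>.\<close>
  proof (cases "(\<integral>\<^sup>+\<omega>. U \<omega> \<partial>M) = \<top>")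
    case True then show ?thesis by (simp add: ennreal_mult_top)
  next
    case False
    have "(\<integral>\<^sup>+\<omega>. U \<omega> * ennreal (exp (\<theta> * G' \<omega>)) \<partial>M)
        \<le> (\<integral>\<^sup>+\<omega>. liminf (\<lambda>n. U \<omega> * ennreal (exp (\<theta> * G n \<omega>))) \<partial>M)"
    proof (rule nn_integral_mono_AE)
      show "AE \<omega> in M. U \<omega> * ennreal (exp (\<theta> * G' \<omega>)) \<le> liminf (\<lambda>n. U \<omega> * ennreal (exp (\<theta> * G n \<omega>)))"
        using lim
      proof eventually_elim
        case (elim \<omega>)
        have e: "(\<lambda>n. ennreal (exp (\<theta> * G n \<omega>))) \<longlonglongrightarrow> ennreal (exp (\<theta> * G' \<omega>))"
          using elim by (intro tendsto_intros)
        show ?case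
        proof (cases "U \<omega> = \<top>")
          case True then show ?thesis by (simp add: ennreal_top_mult Liminf_const)
        next
          case False
          then have "(\<lambda>n. U \<omega> * ennreal (exp (\<theta> * G n \<omega>))) \<longlonglongrightarrow> U \<omega> * ennreal (exp (\<theta> * G' \<omega>))"
            using e by (intro ennreal_tendsto_cmult) (auto simp: less_top)
          then show ?thesis by (simp add: lim_imp_Liminf)
        qed
      qed
    qed
    also have "\<dots> \<le> liminf (\<lambda>n. \<integral>\<^sup>+\<omega>. U \<omega> * ennreal (exp (\<theta> * G n \<omega>)) \<partial>M)"
      by (rule nn_integral_liminf) measurable
    also have "\<dots> \<le> liminf (\<lambda>n. (\<integral>\<^sup>+\<omega>. U \<omega> \<partial>M) * ennreal (exp (\<theta>\<^sup>2 * (\<sigma> n)\<^sup>2 / 2)))"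
      by (intro Liminf_mono always_eventually allI) (use subg_exp[OF G U] in \<open>simp add: mult.commute\<close>)
    also have "\<dots> = (\<integral>\<^sup>+\<omega>. U \<omega> \<partial>M) * ennreal (exp (\<theta>\<^sup>2 * \<sigma>'\<^sup>2 / 2))"
      using False s(1) by (intro lim_imp_Liminf ennreal_tendsto_cmult tendsto_intros) (auto simp: less_top)
    finally show ?thesis by (simp add: mult.commute)
  qed
qed (use subgD(1,2)[OF G] s(2) in auto)

text \<open>Given the past, \<open>A\<close> could be absorbed into \<theta>, but \<theta> has to be
  a number. So \<open>A\<close> is rounded down to multiples of \<open>1 / Suc n\<close>; on each of
  the finitely many level sets, which belong to \<open>F u\<close>, it is a number, and the
  indicator of the level set moves into the test function \<open>U\<close>. Refining the rounding
  gives the claim in the limit.\<close>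

lemma subg_mult_bounded:
  assumes G: "subg u v \<sigma> G" and A: "A \<in> borel_measurable (F u)" and b: "\<And>\<omega>. \<bar>A \<omega>\<bar> \<le> K" and K: "0 < K"
  shows "subg u v (K * \<sigma>) (\<lambda>\<omega>. A \<omega> * G \<omega>)"
proof -
  note D = subgD[OF G]
  define B where "B n \<omega> = real_of_int \<lfloor>real (Suc n) * A \<omega>\<rfloor> / real (Suc n)" for n \<omega>
  have Bmeas: "B n \<in> borel_measurable (F u)" for n using A unfolding B_def by measurable
  have BA: "\<bar>B n \<omega> - A \<omega>\<bar> \<le> 1 / real (Suc n)" for n \<omega>
  proof -
    have "\<bar>real_of_int \<lfloor>real (Suc n) * A \<omega>\<rfloor> - real (Suc n) * A \<omega>\<bar> \<le> 1" by linarith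
    moreover have "B n \<omega> - A \<omega> = (real_of_int \<lfloor>real (Suc n) * A \<omega>\<rfloor> - real (Suc n) * A \<omega>) / real (Suc n)"
      unfolding B_def by (simp add: diff_divide_distrib del: of_nat_Suc)
    ultimately show ?thesis by (simp add: abs_divide divide_right_mono del: of_nat_Suc)
  qed
  have Bb: "\<bar>B n \<omega>\<bar> \<le> K + 1 / real (Suc n)" for n \<omega> using BA[of n \<omega>] b[of \<omega>] by linarith
  have "subg u v ((K + 1 / real (Suc n)) * \<sigma>) (\<lambda>\<omega>. B n \<omega> * G \<omega>)" for n
    unfolding subg_def
  proof (intro conjI ballI allI)
    show "(\<lambda>\<omega>. B n \<omega> * G \<omega>) \<in> borel_measurable (F v)"
      using measurable_F_mono[OF D(1,2) Bmeas] D(5) by measurable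
    fix U :: "'a \<Rightarrow> ennreal" and \<theta> :: real assume U: "U \<in> borel_measurable (F u)"
    let ?c = "ennreal (exp (\<theta>\<^sup>2 * ((K + 1 / real (Suc n)) * \<sigma>)\<^sup>2 / 2))"
    define Z where "Z = (\<lambda>\<omega>. \<lfloor>real (Suc n) * A \<omega>\<rfloor>)"
    \<comment> \<open>A finite set of levels that contains every value of \<open>Z\<close>; the
      extra 1 accounts for the floor.\<close>
    define S where "S = {- \<lceil>K * real (Suc n) + 1\<rceil> .. \<lceil>K * real (Suc n) + 1\<rceil>}"
    have fS: "finite S" by (simp add: S_def)
    have ZS: "Z \<omega> \<in> S" for \<omega>
    proof -
      have "\<bar>real (Suc n) * A \<omega>\<bar> \<le> K * real (Suc n)" using b[of \<omega>] by (simp add: abs_mult mult.commute)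
      then show ?thesis unfolding S_def Z_def by (simp only: atLeastAtMost_iff) linarith
    qed
    have Zm: "Z \<in> measurable (F u) (count_space UNIV)"
      unfolding Z_def by (rule measurable_compose[OF _ measurable_real_floor]) (use A in measurable)
    have UZ: "(\<lambda>\<omega>. U \<omega> * indicator {k} (Z \<omega>)) \<in> borel_measurable (F u)" for k
      using U by (intro borel_measurable_times_ennreal measurable_compose[OF Zm]) auto
    have [measurable]: "U \<in> borel_measurable M" "G \<in> borel_measurable M" "Z \<in> measurable M (count_space UNIV)"
      using U Zm D measurable_F_M by blast+
    have split: "f \<omega> = (\<Sum>k\<in>S. f \<omega> * indicator {k} (Z \<omega>))" for f :: "'a \<Rightarrow> ennreal" and \<omega>
      using fS ZS[of \<omega>] by (subst sum.remove[of _ "Z \<omega>"]) (auto simp: indicator_def)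
    have "(\<integral>\<^sup>+\<omega>. U \<omega> * ennreal (exp (\<theta> * (B n \<omega> * G \<omega>))) \<partial>M)
       = (\<integral>\<^sup>+\<omega>. (\<Sum>k\<in>S. (U \<omega> * indicator {k} (Z \<omega>)) * ennreal (exp ((\<theta> * (real_of_int k / real (Suc n))) * G \<omega>))) \<partial>M)"
    proof (rule nn_integral_cong)
      fix \<omega>
      have "U \<omega> * ennreal (exp (\<theta> * (B n \<omega> * G \<omega>)))
          = (\<Sum>k\<in>S. U \<omega> * ennreal (exp (\<theta> * (B n \<omega> * G \<omega>))) * indicator {k} (Z \<omega>))"
        by (rule split)
      also have "\<dots> = (\<Sum>k\<in>S. (U \<omega> * indicator {k} (Z \<omega>)) * ennreal (exp ((\<theta> * (real_of_int k / real (Suc n))) * G \<omega>)))"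
        by (intro sum.cong refl) (simp add: indicator_def B_def Z_def mult.assoc del: of_nat_Suc)
      finally show "U \<omega> * ennreal (exp (\<theta> * (B n \<omega> * G \<omega>)))
          = (\<Sum>k\<in>S. (U \<omega> * indicator {k} (Z \<omega>)) * ennreal (exp ((\<theta> * (real_of_int k / real (Suc n))) * G \<omega>)))" .
    qed
    also have "\<dots> = (\<Sum>k\<in>S. \<integral>\<^sup>+\<omega>. (U \<omega> * indicator {k} (Z \<omega>)) * ennreal (exp ((\<theta> * (real_of_int k / real (Suc n))) * G \<omega>)) \<partial>M)"
      by (rule nn_integral_sum) (intro borel_measurable_times_ennreal UZ[THEN measurable_F_M[OF D(1)]]; measurable)
    also have "\<dots> \<le> (\<Sum>k\<in>S. ?c * (\<integral>\<^sup>+\<omega>. U \<omega> * indicator {k} (Z \<omega>) \<partial>M))"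
    proof (rule sum_mono)
      fix k assume "k \<in> S"
      show "(\<integral>\<^sup>+\<omega>. (U \<omega> * indicator {k} (Z \<omega>)) * ennreal (exp ((\<theta> * (real_of_int k / real (Suc n))) * G \<omega>)) \<partial>M)
         \<le> ?c * (\<integral>\<^sup>+\<omega>. U \<omega> * indicator {k} (Z \<omega>) \<partial>M)"
      \<comment> \<open>An attained level inherits the bound of \<open>B n\<close> at a witness; for
        any other level the indicator is identically zero.\<close>
      proof (cases "\<exists>\<omega>. Z \<omega> = k")
        case False
        then have "indicator {k} (Z \<omega>) = (0::ennreal)" for \<omega> by (auto simp: indicator_def)
        then show ?thesis by simp
      next
        case True
        then obtain \<omega> where w: "Z \<omega> = k" by blast
        then have "\<bar>real_of_int k / real (Suc n)\<bar> \<le> K + 1 / real (Suc n)"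
          using Bb[of n \<omega>] by (simp add: B_def Z_def)
        then have "(real_of_int k / real (Suc n))\<^sup>2 \<le> (K + 1 / real (Suc n))\<^sup>2"
          by (metis abs_le_square_iff abs_of_nonneg order_trans abs_ge_zero)
        then have "(\<theta> * (real_of_int k / real (Suc n)))\<^sup>2 * \<sigma>\<^sup>2 / 2 \<le> \<theta>\<^sup>2 * ((K + 1 / real (Suc n)) * \<sigma>)\<^sup>2 / 2"
          unfolding power_mult_distrib
          by (intro divide_right_mono) (simp_all add: mult.assoc mult_left_mono mult_right_mono)
        then have "ennreal (exp ((\<theta> * (real_of_int k / real (Suc n)))\<^sup>2 * \<sigma>\<^sup>2 / 2)) \<le> ?c"
          by (intro ennreal_leI) (simp only: exp_le_cancel_iff)
        then show ?thesis
          by (intro order_trans[OF subg_exp[OF G UZ[of k]] mult_right_mono]) simp_all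
      qed
    qed
    also have "\<dots> = ?c * (\<Sum>k\<in>S. \<integral>\<^sup>+\<omega>. U \<omega> * indicator {k} (Z \<omega>) \<partial>M)" by (simp add: sum_distrib_left)
    also have "\<dots> = ?c * (\<integral>\<^sup>+\<omega>. (\<Sum>k\<in>S. U \<omega> * indicator {k} (Z \<omega>)) \<partial>M)"
      by (subst nn_integral_sum) (use UZ[THEN measurable_F_M[OF D(1)]] in auto)
    also have "\<dots> = ?c * (\<integral>\<^sup>+\<omega>. U \<omega> \<partial>M)" by (simp only: split[symmetric])
    finally show "(\<integral>\<^sup>+\<omega>. U \<omega> * ennreal (exp (\<theta> * (B n \<omega> * G \<omega>))) \<partial>M) \<le> ?c * (\<integral>\<^sup>+\<omega>. U \<omega> \<partial>M)" .
  next
    show "0 < (K + 1 / real (Suc n)) * \<sigma>" using K D by (simp add: add_pos_pos)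
  qed (use D(1,2) in auto)
  note subg_B = this
  have limB: "AE \<omega> in M. (\<lambda>n. B n \<omega> * G \<omega>) \<longlonglongrightarrow> A \<omega> * G \<omega>"
  proof (intro AE_I2 tendsto_mult tendsto_const)
    fix \<omega>
    have "(\<lambda>n. B n \<omega> - A \<omega>) \<longlonglongrightarrow> 0"
      by (rule Lim_null_comparison[OF _ LIMSEQ_inverse_real_of_nat])
        (use BA in \<open>auto simp: inverse_eq_divide\<close>)
    then show "(\<lambda>n. B n \<omega>) \<longlonglongrightarrow> A \<omega>" by (simp add: LIM_zero_iff)
  qed
  have "(\<lambda>n. (K + inverse (real (Suc n))) * \<sigma>) \<longlonglongrightarrow> (K + 0) * \<sigma>"
    by (intro tendsto_intros LIMSEQ_inverse_real_of_nat)
  then have "(\<lambda>n. (K + 1 / real (Suc n)) * \<sigma>) \<longlonglongrightarrow> K * \<sigma>"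
    by (simp only: inverse_eq_divide add_0_right)
  moreover have "0 < K * \<sigma>" using K D(4) by simp
  ultimately show ?thesis by (rule subg_limit[OF subg_B limB])
qed

end

section \<open>The maximal inequality and polynomial moments of maxima\<close>

text \<open>This is \<open>ln x \<le> x\<close> at \<open>x = y / (2 * q)\<close>. The best constant
  is smaller by the factor \<open>exp (- q)\<close>, which is given away.\<close>

lemma powr_le_exp_half:
  fixes y q :: real
  assumes "0 \<le> y" "0 < q"
  shows "y powr q \<le> (2 * q) powr q * exp (y / 2)"
proof (cases "y = 0")
  case False
  then have y: "0 < y" using assms by simp
  have "ln (y / (2 * q)) \<le> y / (2 * q)" using y assms by (intro ln_bound) simp
  then have "q * ln (y / (2 * q)) \<le> y / 2" using assms by (simp add: field_simps)
  then have "(y / (2 * q)) powr q \<le> exp (y / 2)" using y assms by (simp add: powr_def)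
  then have "(2 * q) powr q * (y / (2 * q)) powr q \<le> (2 * q) powr q * exp (y / 2)"
    by (intro mult_left_mono) auto
  then show ?thesis using y assms by (simp add: powr_mult[symmetric])
qed (use assms in simp)

text \<open>For fixed \<open>x\<close> the function \<open>sqrt r + x / sqrt r\<close> of
  \<open>r\<close> is minimal at \<open>r = x\<close>. Updating a running maximum either leaves
  \<open>m\<close> unchanged or moves it to that minimiser, so the expression cannot grow.\<close>

lemma sqrt_running_max_step:
  fixes x m :: real
  assumes "0 < x" "0 < m"
  shows "sqrt (max m x) + x / sqrt (max m x) \<le> sqrt m + x / sqrt m"
proof (cases "x \<le> m")
  case False
  define a b where "a = sqrt x" and "b = sqrt m"
  have ab: "0 < a" "0 < b" "x = a * a" "m = b * b" using assms by (auto simp: a_def b_def)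
  have "2 * (a * b) \<le> a * a + b * b" using sum_squares_bound[of a b] by (simp add: power2_eq_square)
  then have "2 * a \<le> b + a * a / b" using ab by (simp add: field_simps)
  moreover have "sqrt (max m x) = a" "sqrt m = b" using False by (auto simp: max_def a_def b_def)
  ultimately show ?thesis using ab by simp
qed (auto simp: max_def)

context filtered_space
begin

text \<open>A pathwise form of Doob's argument for the square root of the supermartingale
  \<open>exp (\<theta> M\<^sub>n - \<theta>\<^sup>2/2 \<Sum>\<sigma>\<^sup>2)\<close>; no integrability of the increments has to be checked.\<close>

lemma subg_maximal:
  fixes t \<sigma> :: "nat \<Rightarrow> real" and D :: "nat \<Rightarrow> 'a \<Rightarrow> real" and \<theta> :: real
  assumes D: "\<And>n. n < N \<Longrightarrow> subg (t n) (t (Suc n)) (\<sigma> n) (D n)"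
    and t: "\<And>n. n \<le> N \<Longrightarrow> 0 \<le> t n"
  shows "(\<integral>\<^sup>+\<omega>. ennreal (Max ((\<lambda>n. exp (\<theta> / 2 * (\<Sum>j<n. D j \<omega>))) ` {..N})) \<partial>M)
           \<le> ennreal (2 * exp (\<theta>\<^sup>2 / 4 * (\<Sum>j<N. (\<sigma> j)\<^sup>2)))"
proof -
  \<comment> \<open>\<open>S\<close> is the exponential supermartingale and \<open>R\<close> its
    running maximum; both start at 1.\<close>
  define S where "S n \<omega> = exp (\<theta> * (\<Sum>j<n. D j \<omega>) - \<theta>\<^sup>2 / 2 * (\<Sum>j<n. (\<sigma> j)\<^sup>2))" for n \<omega>
  define R where "R n \<omega> = Max ((\<lambda>i. S i \<omega>) ` {..n})" for n \<omega>
  have Spos: "0 < S n \<omega>" for n \<omega> by (simp add: S_def)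
  have Rge: "S i \<omega> \<le> R n \<omega>" if "i \<le> n" for i n \<omega> using that by (auto simp: R_def)
  have Rpos: "0 < R n \<omega>" for n \<omega> using Spos[of 0 \<omega>] Rge[of 0 n \<omega>] by linarith
  have R0: "R 0 \<omega> = 1" for \<omega> by (simp add: R_def S_def)
  have RSuc: "R (Suc n) \<omega> = max (R n \<omega>) (S (Suc n) \<omega>)" for n \<omega>
    unfolding R_def atMost_Suc by (simp add: max.commute)
  have SSuc: "S (Suc n) \<omega> = S n \<omega> * exp (\<theta> * D n \<omega>) * exp (- (\<theta>\<^sup>2 * (\<sigma> n)\<^sup>2 / 2))" for n \<omega>
    unfolding S_def exp_add[symmetric] by (simp add: algebra_simps)
  have SRF: "S n \<in> borel_measurable (F (t n)) \<and> R n \<in> borel_measurable (F (t n))" if "n \<le> N" for n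
    using that
  proof (induction n)
    case 0
    have "S 0 = (\<lambda>\<omega>. 1)" "R 0 = (\<lambda>\<omega>. 1)" using R0 by (auto simp: S_def)
    then show ?case by simp
  next
    case (Suc n)
    then have n: "n < N" by simp
    note d = subgD[OF D[OF n]]
    have "S n \<in> borel_measurable (F (t (Suc n)))" "R n \<in> borel_measurable (F (t (Suc n)))"
      using Suc measurable_F_mono[OF d(1,2)] by auto
    note [measurable] = this d(5)
    have "S (Suc n) \<in> borel_measurable (F (t (Suc n)))" unfolding SSuc[abs_def] by measurable
    moreover from this have "R (Suc n) \<in> borel_measurable (F (t (Suc n)))"
      unfolding RSuc[abs_def] by measurable
    ultimately show ?case by simp
  qed
  have SRM: "S n \<in> borel_measurable M" "R n \<in> borel_measurable M" if "n \<le> N" for n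
    using SRF[OF that] measurable_F_M[OF t[OF that]] by auto
  have "(\<integral>\<^sup>+\<omega>. ennreal (sqrt (R n \<omega>) + S n \<omega> / sqrt (R n \<omega>)) \<partial>M) \<le> 2" if "n \<le> N" for n
    using that
  proof (induction n)
    case 0
    have "S 0 \<omega> = 1" for \<omega> by (simp add: S_def)
    then show ?case by (simp add: R0 emeasure_space_1)
  next
    \<comment> \<open>The potential \<open>sqrt (R n) + S n / sqrt (R n)\<close> starts at 2. In
      each step \<open>R\<close> is updated pathwise by the preceding inequality, and
      \<open>S\<close> is taken back from \<open>Suc n\<close> to \<open>n\<close> in the mean, with
      the test function \<open>S n / sqrt (R n)\<close>, which is known at time \<open>t n\<close>.
      Hence the mean of the potential never exceeds 2.\<close>
    case (Suc n)
    then have n: "n < N" "n \<le> N" by auto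
    note d = subgD[OF D[OF n(1)]]
    note [measurable] = SRM[OF n(2)] SRM[OF Suc.prems] d(6)
    let ?U = "\<lambda>\<omega>. ennreal (S n \<omega> / sqrt (R n \<omega>))"
    have U: "?U \<in> borel_measurable (F (t n))"
      using SRF[OF n(2)] by (intro measurable_compose[OF _ measurable_ennreal] borel_measurable_divide
        measurable_compose[OF _ borel_measurable_sqrt]) auto
    have e: "ennreal (S (Suc n) \<omega> / sqrt (R n \<omega>))
        = ennreal (exp (- (\<theta>\<^sup>2 * (\<sigma> n)\<^sup>2 / 2))) * (?U \<omega> * ennreal (exp (\<theta> * D n \<omega>)))" for \<omega>
      unfolding SSuc using Spos[of n \<omega>] Rpos[of n \<omega>]
      by (simp add: ennreal_mult[symmetric] mult_ac)
    have "(\<integral>\<^sup>+\<omega>. ennreal (S (Suc n) \<omega> / sqrt (R n \<omega>)) \<partial>M)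
        = ennreal (exp (- (\<theta>\<^sup>2 * (\<sigma> n)\<^sup>2 / 2))) * (\<integral>\<^sup>+\<omega>. ?U \<omega> * ennreal (exp (\<theta> * D n \<omega>)) \<partial>M)"
      unfolding e by (rule nn_integral_cmult) measurable
    also have "\<dots> \<le> ennreal (exp (- (\<theta>\<^sup>2 * (\<sigma> n)\<^sup>2 / 2))) *
        (ennreal (exp (\<theta>\<^sup>2 * (\<sigma> n)\<^sup>2 / 2)) * (\<integral>\<^sup>+\<omega>. ?U \<omega> \<partial>M))"
      by (intro mult_left_mono subg_exp[OF D[OF n(1)] U]) simp
    also have "\<dots> = (\<integral>\<^sup>+\<omega>. ?U \<omega> \<partial>M)"
      by (simp add: mult.assoc[symmetric] ennreal_mult[symmetric] exp_add[symmetric])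
    finally have step: "(\<integral>\<^sup>+\<omega>. ennreal (S (Suc n) \<omega> / sqrt (R n \<omega>)) \<partial>M) \<le> (\<integral>\<^sup>+\<omega>. ?U \<omega> \<partial>M)" .
    have "(\<integral>\<^sup>+\<omega>. ennreal (sqrt (R (Suc n) \<omega>) + S (Suc n) \<omega> / sqrt (R (Suc n) \<omega>)) \<partial>M)
        \<le> (\<integral>\<^sup>+\<omega>. ennreal (sqrt (R n \<omega>)) + ennreal (S (Suc n) \<omega> / sqrt (R n \<omega>)) \<partial>M)"
      unfolding RSuc using sqrt_running_max_step[OF Spos[of "Suc n"] Rpos[of n]] Spos Rpos
      by (intro nn_integral_mono) (simp add: ennreal_plus[symmetric] less_imp_le del: ennreal_plus)
    also have "\<dots> = (\<integral>\<^sup>+\<omega>. ennreal (sqrt (R n \<omega>)) \<partial>M) + (\<integral>\<^sup>+\<omega>. ennreal (S (Suc n) \<omega> / sqrt (R n \<omega>)) \<partial>M)"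
      by (rule nn_integral_add) measurable
    also have "\<dots> \<le> (\<integral>\<^sup>+\<omega>. ennreal (sqrt (R n \<omega>)) \<partial>M) + (\<integral>\<^sup>+\<omega>. ?U \<omega> \<partial>M)"
      by (intro add_left_mono step)
    also have "\<dots> = (\<integral>\<^sup>+\<omega>. ennreal (sqrt (R n \<omega>)) + ?U \<omega> \<partial>M)"
      by (rule nn_integral_add[symmetric]) measurable
    also have "\<dots> = (\<integral>\<^sup>+\<omega>. ennreal (sqrt (R n \<omega>) + S n \<omega> / sqrt (R n \<omega>)) \<partial>M)"
      using Spos Rpos by (intro nn_integral_cong) (simp add: less_imp_le)
    finally show ?case using Suc.IH[OF n(2)] by (rule order_trans)
  qed
  note bound' = this[OF order_refl]
  have bound: "(\<integral>\<^sup>+\<omega>. ennreal (sqrt (R N \<omega>)) \<partial>M) \<le> 2"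
  proof (rule order_trans[OF nn_integral_mono bound'])
    show "ennreal (sqrt (R N \<omega>)) \<le> ennreal (sqrt (R N \<omega>) + S N \<omega> / sqrt (R N \<omega>))" for \<omega>
      using Spos[of N \<omega>] Rpos[of N \<omega>] by (intro ennreal_leI) simp
  qed
  have "(\<integral>\<^sup>+\<omega>. ennreal (Max ((\<lambda>n. exp (\<theta> / 2 * (\<Sum>j<n. D j \<omega>))) ` {..N})) \<partial>M)
      \<le> (\<integral>\<^sup>+\<omega>. ennreal (exp (\<theta>\<^sup>2 / 4 * (\<Sum>j<N. (\<sigma> j)\<^sup>2))) * ennreal (sqrt (R N \<omega>)) \<partial>M)"
  proof (rule nn_integral_mono)
    fix \<omega>
    have "exp (\<theta> / 2 * (\<Sum>j<n. D j \<omega>)) \<le> exp (\<theta>\<^sup>2 / 4 * (\<Sum>j<N. (\<sigma> j)\<^sup>2)) * sqrt (R N \<omega>)" if "n \<le> N" for n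
    proof -
      \<comment> \<open>The exponential with half the parameter is \<open>sqrt (S n)\<close> times
        half the compensator, which is largest at \<open>n = N\<close>; this is the origin of the
        factor \<open>\<theta>^2 / 4\<close>.\<close>
      have "exp (\<theta> / 2 * (\<Sum>j<n. D j \<omega>))
          = exp (\<theta>\<^sup>2 / 4 * (\<Sum>j<n. (\<sigma> j)\<^sup>2)) * exp ((\<theta> * (\<Sum>j<n. D j \<omega>) - \<theta>\<^sup>2 / 2 * (\<Sum>j<n. (\<sigma> j)\<^sup>2)) / 2)"
        unfolding exp_add[symmetric] by (simp add: field_simps)
      also have "exp ((\<theta> * (\<Sum>j<n. D j \<omega>) - \<theta>\<^sup>2 / 2 * (\<Sum>j<n. (\<sigma> j)\<^sup>2)) / 2) = sqrt (S n \<omega>)"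
        unfolding S_def by (rule real_sqrt_unique[symmetric]) (simp_all add: power2_eq_square exp_add[symmetric])
      also have "exp (\<theta>\<^sup>2 / 4 * (\<Sum>j<n. (\<sigma> j)\<^sup>2)) * sqrt (S n \<omega>)
          \<le> exp (\<theta>\<^sup>2 / 4 * (\<Sum>j<N. (\<sigma> j)\<^sup>2)) * sqrt (R N \<omega>)"
        using that Rge[OF that, of \<omega>] Spos[of n \<omega>]
        by (intro mult_mono) (auto intro!: mult_left_mono sum_mono2)
      finally show ?thesis .
    qed
    then have "Max ((\<lambda>n. exp (\<theta> / 2 * (\<Sum>j<n. D j \<omega>))) ` {..N})
        \<le> exp (\<theta>\<^sup>2 / 4 * (\<Sum>j<N. (\<sigma> j)\<^sup>2)) * sqrt (R N \<omega>)"
      by (intro Max.boundedI) auto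
    then show "ennreal (Max ((\<lambda>n. exp (\<theta> / 2 * (\<Sum>j<n. D j \<omega>))) ` {..N}))
        \<le> ennreal (exp (\<theta>\<^sup>2 / 4 * (\<Sum>j<N. (\<sigma> j)\<^sup>2))) * ennreal (sqrt (R N \<omega>))"
      using Rpos[of N \<omega>] by (simp add: ennreal_mult[symmetric] less_imp_le ennreal_leI)
  qed
  also have "\<dots> = ennreal (exp (\<theta>\<^sup>2 / 4 * (\<Sum>j<N. (\<sigma> j)\<^sup>2))) * (\<integral>\<^sup>+\<omega>. ennreal (sqrt (R N \<omega>)) \<partial>M)"
    by (intro nn_integral_cmult measurable_compose[OF _ measurable_ennreal]
        measurable_compose[OF _ borel_measurable_sqrt] SRM order_refl)
  also have "\<dots> \<le> ennreal (exp (\<theta>\<^sup>2 / 4 * (\<Sum>j<N. (\<sigma> j)\<^sup>2))) * 2"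
    by (intro mult_left_mono bound) simp
  also have "\<dots> = ennreal (2 * exp (\<theta>\<^sup>2 / 4 * (\<Sum>j<N. (\<sigma> j)\<^sup>2)))"
    by (simp add: ennreal_mult mult.commute)
  finally show ?thesis .
qed

text \<open>The parameters \<open>1 / s\<close> and \<open>- 1 / s\<close> normalise the exponent to
  \<open>1 / 4\<close> and cover both signs of the partial sums; the factor 4 is a 2 from each sign.
  The power is then dominated by the exponential through \<open>powr_le_exp_half\<close> at
  \<open>\<bar>P n \<omega>\<bar> / s\<close>.\<close>

lemma subg_max_moment:
  fixes t \<sigma> :: "nat \<Rightarrow> real" and D :: "nat \<Rightarrow> 'a \<Rightarrow> real" and q :: real
  assumes D: "\<And>n. n < N \<Longrightarrow> subg (t n) (t (Suc n)) (\<sigma> n) (D n)"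
    and t: "\<And>n. n \<le> N \<Longrightarrow> 0 \<le> t n" and q: "0 < q"
    and s: "(\<Sum>j<N. (\<sigma> j)\<^sup>2) \<le> s\<^sup>2" "0 < s"
  shows "(\<integral>\<^sup>+\<omega>. ennreal (Max ((\<lambda>n. \<bar>\<Sum>j<n. D j \<omega>\<bar>) ` {..N}) powr q) \<partial>M)
           \<le> ennreal (4 * exp (1 / 4) * (2 * q) powr q * s powr q)"
proof -
  define P where "P n \<omega> = (\<Sum>j<n. D j \<omega>)" for n \<omega>
  define E where "E \<theta> \<omega> = Max ((\<lambda>n. exp (\<theta> / 2 * P n \<omega>)) ` {..N})" for \<theta> \<omega>
  have [measurable]: "P n \<in> borel_measurable M" if "n \<le> N" for n
    unfolding P_def using that subgD(6)[OF D] by (intro borel_measurable_sum) auto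
  have [measurable]: "E \<theta> \<in> borel_measurable M" for \<theta>
    unfolding E_def[abs_def] by (intro borel_measurable_Max) auto
  have bnd: "(\<integral>\<^sup>+\<omega>. ennreal (E \<theta> \<omega>) \<partial>M) \<le> ennreal (2 * exp (1 / 4))" if "\<theta>\<^sup>2 = 1 / s\<^sup>2" for \<theta>
  proof -
    have "\<theta>\<^sup>2 / 4 * (\<Sum>j<N. (\<sigma> j)\<^sup>2) \<le> \<theta>\<^sup>2 / 4 * s\<^sup>2" by (intro mult_left_mono s(1)) simp
    also have "\<dots> = 1 / 4" using that s(2) by simp
    finally have le: "ennreal (2 * exp (\<theta>\<^sup>2 / 4 * (\<Sum>j<N. (\<sigma> j)\<^sup>2))) \<le> ennreal (2 * exp (1 / 4))"
      by (intro ennreal_leI) simp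
    show ?thesis unfolding E_def P_def
      by (rule order_trans[OF subg_maximal[of N t \<sigma> D \<theta>] le]) (use D t in auto)
  qed
  let ?c = "(2 * q) powr q * s powr q"
  have "(\<integral>\<^sup>+\<omega>. ennreal (Max ((\<lambda>n. \<bar>P n \<omega>\<bar>) ` {..N}) powr q) \<partial>M)
      \<le> (\<integral>\<^sup>+\<omega>. ennreal ?c * (ennreal (E (1 / s) \<omega>) + ennreal (E (- 1 / s) \<omega>)) \<partial>M)"
  proof (rule nn_integral_mono)
    fix \<omega>
    have "Max ((\<lambda>n. \<bar>P n \<omega>\<bar>) ` {..N}) \<in> (\<lambda>n. \<bar>P n \<omega>\<bar>) ` {..N}" by (intro Max_in) auto
    then have "\<exists>n\<le>N. Max ((\<lambda>n. \<bar>P n \<omega>\<bar>) ` {..N}) = \<bar>P n \<omega>\<bar>" by blast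
    then obtain n where n: "n \<le> N" "Max ((\<lambda>n. \<bar>P n \<omega>\<bar>) ` {..N}) = \<bar>P n \<omega>\<bar>" by blast
    have E: "exp (\<theta> / 2 * P n \<omega>) \<le> E \<theta> \<omega>" for \<theta> unfolding E_def using n(1) by (intro Max_ge) auto
    have E0: "0 \<le> E \<theta> \<omega>" for \<theta> using E[of \<theta>] exp_ge_zero order_trans by blast
    have "exp (\<bar>P n \<omega>\<bar> / s / 2) \<le> exp ((1 / s) / 2 * P n \<omega>) + exp ((- 1 / s) / 2 * P n \<omega>)"
      by (cases "0 \<le> P n \<omega>") (auto simp: mult.commute add_increasing add_increasing2)
    also have "\<dots> \<le> E (1 / s) \<omega> + E (- 1 / s) \<omega>" by (intro add_mono E)
    finally have e: "exp (\<bar>P n \<omega>\<bar> / s / 2) \<le> E (1 / s) \<omega> + E (- 1 / s) \<omega>" .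
    have "\<bar>P n \<omega>\<bar> powr q = s powr q * (\<bar>P n \<omega>\<bar> / s) powr q"
      using s(2) by (simp add: powr_mult[symmetric])
    also have "\<dots> \<le> s powr q * ((2 * q) powr q * exp (\<bar>P n \<omega>\<bar> / s / 2))"
      using s(2) q by (intro mult_left_mono powr_le_exp_half) auto
    also have "\<dots> \<le> s powr q * ((2 * q) powr q * (E (1 / s) \<omega> + E (- 1 / s) \<omega>))"
      by (intro mult_left_mono e) auto
    finally have "\<bar>P n \<omega>\<bar> powr q \<le> ?c * (E (1 / s) \<omega> + E (- 1 / s) \<omega>)" by (simp add: mult_ac)
    then have "ennreal (\<bar>P n \<omega>\<bar> powr q) \<le> ennreal (?c * (E (1 / s) \<omega> + E (- 1 / s) \<omega>))"
      by (rule ennreal_leI)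
    also have "\<dots> = ennreal ?c * (ennreal (E (1 / s) \<omega>) + ennreal (E (- 1 / s) \<omega>))"
      using E0 by (subst ennreal_mult) auto
    finally show "ennreal (Max ((\<lambda>n. \<bar>P n \<omega>\<bar>) ` {..N}) powr q)
        \<le> ennreal ?c * (ennreal (E (1 / s) \<omega>) + ennreal (E (- 1 / s) \<omega>))" unfolding n(2) .
  qed
  also have "\<dots> = ennreal ?c * ((\<integral>\<^sup>+\<omega>. ennreal (E (1 / s) \<omega>) \<partial>M) + (\<integral>\<^sup>+\<omega>. ennreal (E (- 1 / s) \<omega>) \<partial>M))"
    by (subst nn_integral_cmult, measurable, subst nn_integral_add, measurable)
  also have "\<dots> \<le> ennreal ?c * (ennreal (2 * exp (1 / 4)) + ennreal (2 * exp (1 / 4)))"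
    by (intro mult_left_mono add_mono bnd) (simp_all add: power_divide)
  also have "\<dots> = ennreal (?c * (2 * exp (1 / 4) + 2 * exp (1 / 4)))"
    by (subst ennreal_mult, simp, simp, subst ennreal_plus) simp_all
  also have "?c * (2 * exp (1 / 4) + 2 * exp (1 / 4)) = 4 * exp (1 / 4) * (2 * q) powr q * s powr q"
    by simp
  finally show ?thesis unfolding P_def .
qed

end

section \<open>Stochastic integrals of deterministic functions\<close>

text \<open>Completing the square: the tilted density is a multiple of the Gaussian density with
  mean \<open>\<theta> * \<sigma>\<^sup>2\<close>.\<close>

lemma nn_integral_exp_normal_density:
  assumes "0 < \<sigma>"
  shows "(\<integral>\<^sup>+x. ennreal (normal_density 0 \<sigma> x) * ennreal (exp (\<theta> * x)) \<partial>lborel)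
    = ennreal (exp (\<theta>\<^sup>2 * \<sigma>\<^sup>2 / 2))"
proof -
  have "normal_density 0 \<sigma> x * exp (\<theta> * x)
      = exp (\<theta>\<^sup>2 * \<sigma>\<^sup>2 / 2) * normal_density (\<theta> * \<sigma>\<^sup>2) \<sigma> x" for x
  proof -
    have "- (x\<^sup>2 / (2 * \<sigma>\<^sup>2)) + \<theta> * x = \<theta>\<^sup>2 * \<sigma>\<^sup>2 / 2 - (x - \<theta> * \<sigma>\<^sup>2)\<^sup>2 / (2 * \<sigma>\<^sup>2)"
      using assms by (simp add: field_simps power2_eq_square)
    then have "exp (- (x\<^sup>2 / (2 * \<sigma>\<^sup>2))) * exp (\<theta> * x)
        = exp (\<theta>\<^sup>2 * \<sigma>\<^sup>2 / 2) * exp (- ((x - \<theta> * \<sigma>\<^sup>2)\<^sup>2 / (2 * \<sigma>\<^sup>2)))"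
      unfolding exp_add[symmetric] by simp
    then show ?thesis by (simp add: normal_density_def mult_ac)
  qed
  then have "(\<integral>\<^sup>+x. ennreal (normal_density 0 \<sigma> x) * ennreal (exp (\<theta> * x)) \<partial>lborel)
      = (\<integral>\<^sup>+x. ennreal (exp (\<theta>\<^sup>2 * \<sigma>\<^sup>2 / 2)) * ennreal (normal_density (\<theta> * \<sigma>\<^sup>2) \<sigma> x) \<partial>lborel)"
    by (simp add: ennreal_mult[symmetric])
  also have "\<dots> = ennreal (exp (\<theta>\<^sup>2 * \<sigma>\<^sup>2 / 2)) * (\<integral>\<^sup>+x. ennreal (normal_density (\<theta> * \<sigma>\<^sup>2) \<sigma> x) \<partial>lborel)"
    by (rule nn_integral_cmult) measurable
  also have "(\<integral>\<^sup>+x. ennreal (normal_density (\<theta> * \<sigma>\<^sup>2) \<sigma> x) \<partial>lborel) = 1"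
    using assms by (subst nn_integral_eq_integral) auto
  finally show ?thesis by simp
qed

section \<open>Increments of a Wiener process given the past\<close>

locale filtered_wiener = filtered_space M F for M :: "'a measure" and F +
  fixes w :: "real \<Rightarrow> 'a \<Rightarrow> real"
  assumes wiener: "wiener_process M F w"
begin

lemma wiener_adapted: "0 \<le> t \<Longrightarrow> w t \<in> borel_measurable (F t)"
  using wiener[unfolded wiener_process_def, THEN conjunct1] by blast

lemma wiener_measurable: "0 \<le> t \<Longrightarrow> w t \<in> borel_measurable M"
  using wiener_adapted measurable_F_M by blast

lemma incr_adapted:
  "0 \<le> s \<Longrightarrow> 0 \<le> r \<Longrightarrow> s \<le> t \<Longrightarrow> r \<le> t \<Longrightarrow> (\<lambda>\<omega>. w r \<omega> - w s \<omega>) \<in> borel_measurable (F t)"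
  by (intro borel_measurable_diff measurable_F_mono[OF _ _ wiener_adapted])

lemma incr_distributed:
  assumes "0 \<le> s" "s < t"
  shows "distributed M lborel (\<lambda>\<omega>. w t \<omega> - w s \<omega>) (\<lambda>x. ennreal (normal_density 0 (sqrt (t - s)) x))"
  using wiener[unfolded wiener_process_def] assms by blast

text \<open>The generators of both random variables lie in the two \<sigma>-algebras whose
  independence is known. The map \<open>g\<close> is kept general because squares and exponentials
  of the increment are both used later.\<close>

lemma incr_indep:
  assumes "0 \<le> s" "s < t" and x: "x \<in> measurable (F s) N" and g: "g \<in> measurable borel N'"
  shows "indep_var N x N' (\<lambda>\<omega>. g (w t \<omega> - w s \<omega>))"
  unfolding indep_var_eq
proof (intro conjI)
  let ?d = "\<lambda>\<omega>. w t \<omega> - w s \<omega>" and ?gd = "\<lambda>\<omega>. g (w t \<omega> - w s \<omega>)"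
  show "random_variable N x" using assms measurable_F_M by blast
  have "random_variable borel ?d"
    using assms wiener_measurable[of s] wiener_measurable[of t] by simp
  then show "random_variable N' ?gd" using g by (rule measurable_compose)
  have ind: "indep_set (sets (F s)) (sets (vimage_algebra (space M) ?d borel))"
    using wiener[unfolded wiener_process_def] assms(1,2) by blast
  have 1: "sigma_sets (space M) {x -` A \<inter> space M |A. A \<in> sets N} \<subseteq> sets (F s)"
  proof -
    have "{x -` A \<inter> space M |A. A \<in> sets N} \<subseteq> sets (F s)"
      using measurable_sets[OF x] space_F[OF assms(1)] by auto
    from sets.sigma_sets_subset[OF this] show ?thesis using space_F[OF assms(1)] by simp
  qed
  have 2: "sigma_sets (space M) {?gd -` A \<inter> space M |A. A \<in> sets N'}
      \<subseteq> sets (vimage_algebra (space M) ?d borel)"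
  proof -
    have "?gd -` A \<inter> space M \<in> sets (vimage_algebra (space M) ?d borel)" if "A \<in> sets N'" for A
    proof -
      have "?gd -` A \<inter> space M = ?d -` (g -` A) \<inter> space M" by auto
      moreover have "g -` A \<in> sets borel" using measurable_sets[OF g that] by simp
      ultimately show ?thesis using in_vimage_algebra by metis
    qed
    then have "{?gd -` A \<inter> space M |A. A \<in> sets N'} \<subseteq> sets (vimage_algebra (space M) ?d borel)" by blast
    from sets.sigma_sets_subset[OF this] show ?thesis by simp
  qed
  show "indep_set (sigma_sets (space M) {x -` A \<inter> space M |A. A \<in> sets N})
     (sigma_sets (space M) {?gd -` A \<inter> space M |A. A \<in> sets N'})"
    using ind 1 2 unfolding indep_sets2_eq by (meson subset_trans subsetD)
qed

lemma nn_integral_exp_incr: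
  assumes "0 \<le> s" "s \<le> t" and U: "U \<in> borel_measurable (F s)"
  shows "(\<integral>\<^sup>+\<omega>. U \<omega> * ennreal (exp (\<theta> * (w t \<omega> - w s \<omega>))) \<partial>M)
    = ennreal (exp (\<theta>\<^sup>2 * (t - s) / 2)) * (\<integral>\<^sup>+\<omega>. U \<omega> \<partial>M)"
proof (cases "s = t")
  case False
  then have st: "s < t" using assms by simp
  let ?d = "\<lambda>\<omega>. w t \<omega> - w s \<omega>"
  have "indep_var borel U borel (\<lambda>\<omega>. ennreal (exp (\<theta> * ?d \<omega>)))"
    by (rule incr_indep[OF assms(1) st U]) measurable
  then have ind: "indep_vars (case_bool borel borel) (case_bool U (\<lambda>\<omega>. ennreal (exp (\<theta> * ?d \<omega>)))) UNIV"
    unfolding indep_var_def .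
  have ind': "indep_vars (\<lambda>_. borel) (case_bool U (\<lambda>\<omega>. ennreal (exp (\<theta> * ?d \<omega>)))) UNIV"
    using ind by (rule back_subst[of "\<lambda>N. indep_vars N _ _"]) (auto simp: fun_eq_iff split: bool.split)
  have "(\<integral>\<^sup>+\<omega>. (\<Prod>i\<in>UNIV. case_bool U (\<lambda>\<omega>. ennreal (exp (\<theta> * ?d \<omega>))) i \<omega>) \<partial>M)
      = (\<Prod>i\<in>UNIV. \<integral>\<^sup>+\<omega>. case_bool U (\<lambda>\<omega>. ennreal (exp (\<theta> * ?d \<omega>))) i \<omega> \<partial>M)"
    by (rule indep_vars_nn_integral[OF _ ind']) auto
  then have "(\<integral>\<^sup>+\<omega>. U \<omega> * ennreal (exp (\<theta> * ?d \<omega>)) \<partial>M)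
      = (\<integral>\<^sup>+\<omega>. U \<omega> \<partial>M) * (\<integral>\<^sup>+\<omega>. ennreal (exp (\<theta> * ?d \<omega>)) \<partial>M)"
    by (simp add: UNIV_bool mult.commute)
  also have "(\<integral>\<^sup>+\<omega>. ennreal (exp (\<theta> * ?d \<omega>)) \<partial>M) = ennreal (exp (\<theta>\<^sup>2 * (t - s) / 2))"
    using distributed_nn_integral[OF incr_distributed[OF assms(1) st], of "\<lambda>x. ennreal (exp (\<theta> * x))"]
      nn_integral_exp_normal_density[of "sqrt (t - s)" \<theta>] st by simp
  finally show ?thesis by (simp add: mult.commute)
qed simp

lemma incr_moments:
  assumes "0 \<le> s" "s < t"
  shows "integrable M (\<lambda>\<omega>. w t \<omega> - w s \<omega>)" "expectation (\<lambda>\<omega>. w t \<omega> - w s \<omega>) = 0"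
    "integrable M (\<lambda>\<omega>. (w t \<omega> - w s \<omega>)\<^sup>2)" "expectation (\<lambda>\<omega>. (w t \<omega> - w s \<omega>)\<^sup>2) = t - s"
proof -
  note D = incr_distributed[OF assms]
  have s: "0 < sqrt (t - s)" using assms by simp
  show "integrable M (\<lambda>\<omega>. w t \<omega> - w s \<omega>)"
    by (rule distributed_integrable_var[OF D _ integrable_normal_moment_nz_1[OF s]]) simp
  show e: "expectation (\<lambda>\<omega>. w t \<omega> - w s \<omega>) = 0"
    using normal_distributed_expectation[OF s D] .
  show "integrable M (\<lambda>\<omega>. (w t \<omega> - w s \<omega>)\<^sup>2)"
    using distributed_integrable[OF D, of "\<lambda>x. x\<^sup>2"] integrable_normal_moment[OF s, of 0 2] by simp
  show "expectation (\<lambda>\<omega>. (w t \<omega> - w s \<omega>)\<^sup>2) = t - s"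
    using normal_distributed_variance[OF s D] assms unfolding e by simp
qed

lemma incr_mult:
  assumes "0 \<le> s" "s \<le> t" and x: "x \<in> borel_measurable (F s)" "integrable M x"
  shows "integrable M (\<lambda>\<omega>. x \<omega> * (w t \<omega> - w s \<omega>))" "expectation (\<lambda>\<omega>. x \<omega> * (w t \<omega> - w s \<omega>)) = 0"
    "integrable M (\<lambda>\<omega>. x \<omega> * (w t \<omega> - w s \<omega>)\<^sup>2)"
    "expectation (\<lambda>\<omega>. x \<omega> * (w t \<omega> - w s \<omega>)\<^sup>2) = expectation x * (t - s)"
proof -
  let ?d = "\<lambda>\<omega>. w t \<omega> - w s \<omega>"
  have "integrable M (\<lambda>\<omega>. x \<omega> * ?d \<omega>) \<and> expectation (\<lambda>\<omega>. x \<omega> * ?d \<omega>) = 0 \<and>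
    integrable M (\<lambda>\<omega>. x \<omega> * (?d \<omega>)\<^sup>2) \<and> expectation (\<lambda>\<omega>. x \<omega> * (?d \<omega>)\<^sup>2) = expectation x * (t - s)"
  proof (cases "s = t")
    case False
    then have st: "s < t" using assms by simp
    note m = incr_moments[OF assms(1) st]
    have i: "indep_var borel x borel ?d"
      by (rule incr_indep[OF assms(1) st x(1), of "\<lambda>y. y"]) simp
    have i2: "indep_var borel x borel (\<lambda>\<omega>. (?d \<omega>)\<^sup>2)"
      by (rule incr_indep[OF assms(1) st x(1)]) measurable
    show ?thesis
      using indep_var_integrable[OF i x(2) m(1)] indep_var_lebesgue_integral[OF i x(2) m(1)]
        indep_var_integrable[OF i2 x(2) m(3)] indep_var_lebesgue_integral[OF i2 x(2) m(3)] m by simp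
  qed simp
  then show "integrable M (\<lambda>\<omega>. x \<omega> * ?d \<omega>)" "expectation (\<lambda>\<omega>. x \<omega> * ?d \<omega>) = 0"
    "integrable M (\<lambda>\<omega>. x \<omega> * (?d \<omega>)\<^sup>2)" "expectation (\<lambda>\<omega>. x \<omega> * (?d \<omega>)\<^sup>2) = expectation x * (t - s)"
    by blast+
qed

text \<open>The suffix refers to the order \<open>a \<le> c\<close> of the left end points, so that
  \<open>z\<close> is known when the later interval starts. Splitting overlapping intervals at
  \<open>c\<close> and at the smaller right end point leaves one squared increment over the overlap;
  every other product contains an increment that is independent of its cofactor and has mean
  zero.\<close>

lemma incr_covariance_le:
  assumes ab: "0 \<le> a" "a \<le> b" and cd: "c \<le> d" and ac: "a \<le> c"
    and z: "z \<in> borel_measurable (F c)" "\<And>\<omega>. \<omega> \<in> space M \<Longrightarrow> \<bar>z \<omega>\<bar> \<le> K"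
  shows "integrable M (\<lambda>\<omega>. z \<omega> * (w b \<omega> - w a \<omega>) * (w d \<omega> - w c \<omega>)) \<and>
    expectation (\<lambda>\<omega>. z \<omega> * (w b \<omega> - w a \<omega>) * (w d \<omega> - w c \<omega>))
      = expectation z * max 0 (min b d - max a c)"
proof -
  have c0: "0 \<le> c" using ab ac by simp
  have zM: "z \<in> borel_measurable M" using z(1) c0 measurable_F_M by blast
  have iz: "integrable M z"
    by (rule integrable_const_bound[of _ K]) (use z(2) zM in auto)
  have izx: "integrable M (\<lambda>\<omega>. z \<omega> * (w r \<omega> - w s \<omega>))" if "0 \<le> s" "s \<le> r" for s r
  proof -
    have "integrable M (\<lambda>\<omega>. 1 * (w r \<omega> - w s \<omega>))" by (rule incr_mult[OF that]) auto
    then have "integrable M (\<lambda>\<omega>. K * (w r \<omega> - w s \<omega>))" by simp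
    then show ?thesis
    proof (rule Bochner_Integration.integrable_bound)
      show "(\<lambda>\<omega>. z \<omega> * (w r \<omega> - w s \<omega>)) \<in> borel_measurable M"
        using zM wiener_measurable that by simp
      show "AE \<omega> in M. norm (z \<omega> * (w r \<omega> - w s \<omega>)) \<le> norm (K * (w r \<omega> - w s \<omega>))"
        unfolding real_norm_def abs_mult
        by (intro AE_I2 mult_right_mono order_trans[OF z(2) abs_ge_self]) auto
    qed
  qed
  show ?thesis
  proof (cases "b \<le> c")
    case True
    have "(\<lambda>\<omega>. z \<omega> * (w b \<omega> - w a \<omega>)) \<in> borel_measurable (F c)"
      using z(1) True ab ac by (intro borel_measurable_times incr_adapted) auto
    from incr_mult[OF c0 cd this izx] ab True ac show ?thesis by simp
  next
    case False
    then have cb: "c < b" by simp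
    have zP: "(\<lambda>\<omega>. z \<omega> * (w c \<omega> - w a \<omega>)) \<in> borel_measurable (F c)"
      using z(1) ab ac c0 by (intro borel_measurable_times incr_adapted) auto
    have izP: "integrable M (\<lambda>\<omega>. z \<omega> * (w c \<omega> - w a \<omega>))" using izx ab ac by simp
    show ?thesis
    proof (cases "b \<le> d")
      case True
      have zb: "(\<lambda>\<omega>. z \<omega> * (w b \<omega> - w a \<omega>)) \<in> borel_measurable (F b)"
        using measurable_F_mono[OF c0 less_imp_le[OF cb] z(1)] ab cb by (intro borel_measurable_times incr_adapted) auto
      have b0: "0 \<le> b" using ab by simp
      note 1 = incr_mult[OF c0 less_imp_le[OF cb] zP izP]
        and 2 = incr_mult[OF c0 less_imp_le[OF cb] z(1) iz]
        and 3 = incr_mult[OF b0 True zb izx[OF ab]]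
      have "(\<lambda>\<omega>. z \<omega> * (w b \<omega> - w a \<omega>) * (w d \<omega> - w c \<omega>))
        = (\<lambda>\<omega>. z \<omega> * (w c \<omega> - w a \<omega>) * (w b \<omega> - w c \<omega>) + z \<omega> * (w b \<omega> - w c \<omega>)\<^sup>2
             + z \<omega> * (w b \<omega> - w a \<omega>) * (w d \<omega> - w b \<omega>))"
        by (auto simp: fun_eq_iff algebra_simps power2_eq_square)
      then show ?thesis using 1 2 3 True cb ac by simp
    next
      case False
      have d0: "0 \<le> d" using c0 cd by simp
      have db: "d \<le> b" using False by simp
      have zd: "(\<lambda>\<omega>. z \<omega> * (w d \<omega> - w c \<omega>)) \<in> borel_measurable (F d)"
        using measurable_F_mono[OF c0 cd z(1)] c0 cd by (intro borel_measurable_times incr_adapted) auto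
      note 1 = incr_mult[OF c0 cd zP izP]
        and 2 = incr_mult[OF c0 cd z(1) iz]
        and 3 = incr_mult[OF d0 db zd izx[OF c0 cd]]
      have "(\<lambda>\<omega>. z \<omega> * (w b \<omega> - w a \<omega>) * (w d \<omega> - w c \<omega>))
        = (\<lambda>\<omega>. z \<omega> * (w c \<omega> - w a \<omega>) * (w d \<omega> - w c \<omega>) + z \<omega> * (w d \<omega> - w c \<omega>)\<^sup>2
             + z \<omega> * (w d \<omega> - w c \<omega>) * (w b \<omega> - w d \<omega>))"
        by (auto simp: fun_eq_iff algebra_simps power2_eq_square)
      then show ?thesis using 1 2 3 False cd ac by simp
    qed
  qed
qed

lemma incr_covariance:
  assumes ab: "0 \<le> a" "a \<le> b" and cd: "0 \<le> c" "c \<le> d"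
    and x: "x \<in> borel_measurable (F a)" "bounded (x ` space M)"
    and y: "y \<in> borel_measurable (F c)" "bounded (y ` space M)"
  shows "integrable M (\<lambda>\<omega>. (x \<omega> * (w b \<omega> - w a \<omega>)) * (y \<omega> * (w d \<omega> - w c \<omega>)))" (is ?I)
    "expectation (\<lambda>\<omega>. (x \<omega> * (w b \<omega> - w a \<omega>)) * (y \<omega> * (w d \<omega> - w c \<omega>)))
      = expectation (\<lambda>\<omega>. x \<omega> * y \<omega>) * max 0 (min b d - max a c)" (is ?E)
proof -
  obtain K L where K: "\<And>\<omega>. \<omega> \<in> space M \<Longrightarrow> \<bar>x \<omega>\<bar> \<le> K" and L: "\<And>\<omega>. \<omega> \<in> space M \<Longrightarrow> \<bar>y \<omega>\<bar> \<le> L"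
    using x(2) y(2) unfolding bounded_real by (metis imageI)
  have KL: "\<bar>x \<omega> * y \<omega>\<bar> \<le> K * L" if "\<omega> \<in> space M" for \<omega>
    using K[OF that] L[OF that] unfolding abs_mult by (intro mult_mono') auto
  have "?I \<and> ?E"
  proof (cases "a \<le> c")
    case True
    have z: "(\<lambda>\<omega>. x \<omega> * y \<omega>) \<in> borel_measurable (F c)"
      using measurable_F_mono[OF ab(1) True x(1)] y(1) by (rule borel_measurable_times)
    have "(\<lambda>\<omega>. (x \<omega> * (w b \<omega> - w a \<omega>)) * (y \<omega> * (w d \<omega> - w c \<omega>)))
        = (\<lambda>\<omega>. x \<omega> * y \<omega> * (w b \<omega> - w a \<omega>) * (w d \<omega> - w c \<omega>))"
      by (auto simp: fun_eq_iff mult_ac)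
    then show ?thesis using incr_covariance_le[OF ab cd(2) True z KL] by simp
  next
    case False
    then have ca: "c \<le> a" by simp
    have z: "(\<lambda>\<omega>. x \<omega> * y \<omega>) \<in> borel_measurable (F a)"
      using x(1) measurable_F_mono[OF cd(1) ca y(1)] by (rule borel_measurable_times)
    have "(\<lambda>\<omega>. (x \<omega> * (w b \<omega> - w a \<omega>)) * (y \<omega> * (w d \<omega> - w c \<omega>)))
        = (\<lambda>\<omega>. x \<omega> * y \<omega> * (w d \<omega> - w c \<omega>) * (w b \<omega> - w a \<omega>))"
      by (auto simp: fun_eq_iff mult_ac)
    then show ?thesis
      using incr_covariance_le[OF cd ab(2) ca z KL] by (simp add: min.commute max.commute)
  qed
  then show ?I ?E by auto
qed

text \<open>The intervals may overlap and need not come from one partition. The difference of two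
  simple integrals on unrelated grids is again of this form, so common refinements never have to be
  built.\<close>

lemma wiener_isometry:
  fixes l r :: "'i \<Rightarrow> real" and \<xi> :: "'i \<Rightarrow> 'a \<Rightarrow> real"
  assumes I: "finite I" and lr: "\<And>i. i \<in> I \<Longrightarrow> 0 \<le> l i" "\<And>i. i \<in> I \<Longrightarrow> l i \<le> r i"
    and \<xi>: "\<And>i. i \<in> I \<Longrightarrow> \<xi> i \<in> borel_measurable (F (l i))" "\<And>i. i \<in> I \<Longrightarrow> bounded (\<xi> i ` space M)"
  shows "(\<integral>\<^sup>+\<omega>. ennreal ((\<Sum>i\<in>I. \<xi> i \<omega> * (w (r i) \<omega> - w (l i) \<omega>))\<^sup>2) \<partial>M)
    = (\<integral>\<^sup>+\<omega>. (\<integral>\<^sup>+s. ennreal ((\<Sum>i\<in>I. \<xi> i \<omega> * indicator {l i<..r i} s)\<^sup>2) \<partial>lborel) \<partial>M)"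
proof -
  \<comment> \<open>The length of the overlap of two intervals. Both sides of the isometry reduce to
    the same double sum weighted by it.\<close>
  define ov where "ov i j = max 0 (min (r i) (r j) - max (l i) (l j))" for i j
  have \<xi>M: "\<xi> i \<in> borel_measurable M" if "i \<in> I" for i using \<xi>(1) lr(1) that measurable_F_M by blast
  have i\<xi>: "integrable M (\<lambda>\<omega>. \<xi> i \<omega> * \<xi> j \<omega>)" if ij: "i \<in> I" "j \<in> I" for i j
  proof -
    obtain K where "\<And>\<omega>. \<omega> \<in> space M \<Longrightarrow> \<bar>\<xi> i \<omega>\<bar> \<le> K"
      using \<xi>(2)[OF ij(1)] unfolding bounded_real by blast
    moreover obtain L where "\<And>\<omega>. \<omega> \<in> space M \<Longrightarrow> \<bar>\<xi> j \<omega>\<bar> \<le> L"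
      using \<xi>(2)[OF ij(2)] unfolding bounded_real by blast
    ultimately have "\<bar>\<xi> i \<omega> * \<xi> j \<omega>\<bar> \<le> K * L" if "\<omega> \<in> space M" for \<omega>
      using that unfolding abs_mult by (intro mult_mono') auto
    then show ?thesis by (intro integrable_const_bound[of _ "K * L"]) (use \<xi>M ij in auto)
  qed
  have iov: "integrable lborel (\<lambda>s. indicat_real {l i<..r i} s * indicat_real {l j<..r j} s)"
    "(\<integral>s. indicator {l i<..r i} s * indicator {l j<..r j} s \<partial>lborel) = ov i j" for i j
  proof -
    have e: "(\<lambda>s. indicator {l i<..r i} s * indicator {l j<..r j} s)
        = (indicator {max (l i) (l j)<..min (r i) (r j)} :: real \<Rightarrow> real)"
      by (auto simp: indicator_def fun_eq_iff)
    show "integrable lborel (\<lambda>s. indicat_real {l i<..r i} s * indicat_real {l j<..r j} s)"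
      unfolding e by (cases "max (l i) (l j) \<le> min (r i) (r j)") (auto simp del: max.bounded_iff min.bounded_iff simp: integrable_indicator_iff)
    show "(\<integral>s. indicator {l i<..r i} s * indicator {l j<..r j} s \<partial>lborel) = ov i j"
      unfolding e ov_def by (cases "max (l i) (l j) \<le> min (r i) (r j)") (simp_all del: max.bounded_iff min.bounded_iff)
  qed
  define Q where "Q \<omega> = (\<Sum>i\<in>I. \<Sum>j\<in>I. \<xi> i \<omega> * \<xi> j \<omega> * ov i j)" for \<omega>
  have inner: "(\<integral>\<^sup>+s. ennreal ((\<Sum>i\<in>I. \<xi> i \<omega> * indicator {l i<..r i} s)\<^sup>2) \<partial>lborel) = ennreal (Q \<omega>)"
    and Q0: "0 \<le> Q \<omega>" for \<omega>
  proof -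
    have e: "(\<Sum>i\<in>I. \<xi> i \<omega> * indicator {l i<..r i} s)\<^sup>2
        = (\<Sum>i\<in>I. \<Sum>j\<in>I. \<xi> i \<omega> * \<xi> j \<omega> * (indicator {l i<..r i} s * indicator {l j<..r j} s))" for s
      unfolding power2_eq_square sum_product by (simp add: mult_ac)
    have hb: "integrable lborel (\<lambda>s. (\<Sum>i\<in>I. \<xi> i \<omega> * indicator {l i<..r i} s)\<^sup>2)"
      "(\<integral>s. (\<Sum>i\<in>I. \<xi> i \<omega> * indicator {l i<..r i} s)\<^sup>2 \<partial>lborel) = Q \<omega>"
      unfolding e Q_def using iov by simp_all
    show "(\<integral>\<^sup>+s. ennreal ((\<Sum>i\<in>I. \<xi> i \<omega> * indicator {l i<..r i} s)\<^sup>2) \<partial>lborel) = ennreal (Q \<omega>)"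
      using nn_integral_eq_integral[OF hb(1)] hb(2) by simp
    show "0 \<le> Q \<omega>" unfolding hb(2)[symmetric] by simp
  qed
  have iQ: "integrable M Q" "expectation Q = (\<Sum>i\<in>I. \<Sum>j\<in>I. expectation (\<lambda>\<omega>. \<xi> i \<omega> * \<xi> j \<omega>) * ov i j)"
    unfolding Q_def using i\<xi> by simp_all
  have e: "(\<Sum>i\<in>I. \<xi> i \<omega> * (w (r i) \<omega> - w (l i) \<omega>))\<^sup>2
    = (\<Sum>i\<in>I. \<Sum>j\<in>I. (\<xi> i \<omega> * (w (r i) \<omega> - w (l i) \<omega>)) * (\<xi> j \<omega> * (w (r j) \<omega> - w (l j) \<omega>)))" for \<omega>
    unfolding power2_eq_square sum_product by simp
  have iL: "integrable M (\<lambda>\<omega>. (\<Sum>i\<in>I. \<xi> i \<omega> * (w (r i) \<omega> - w (l i) \<omega>))\<^sup>2)"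
    "expectation (\<lambda>\<omega>. (\<Sum>i\<in>I. \<xi> i \<omega> * (w (r i) \<omega> - w (l i) \<omega>))\<^sup>2) = expectation Q"
    unfolding e iQ(2) ov_def using incr_covariance[OF lr lr \<xi> \<xi>] by simp_all
  have "(\<integral>\<^sup>+\<omega>. ennreal ((\<Sum>i\<in>I. \<xi> i \<omega> * (w (r i) \<omega> - w (l i) \<omega>))\<^sup>2) \<partial>M) = ennreal (expectation Q)"
    using nn_integral_eq_integral[OF iL(1)] iL(2) by simp
  also have "\<dots> = (\<integral>\<^sup>+\<omega>. ennreal (Q \<omega>) \<partial>M)"
    using nn_integral_eq_integral[OF iQ(1)] Q0 by simp
  finally show ?thesis unfolding inner .
qed

text \<open>Conditioning successively on \<open>F (l k)\<close> multiplies exact Gaussian factors,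
  so variances add over disjoint increments. Adding deviations instead would give a bound that
  deteriorates with the number of grid points.\<close>

lemma wiener_sum_subg:
  fixes l g :: "nat \<Rightarrow> real"
  assumes l: "0 \<le> l 0" "\<And>i. i < n \<Longrightarrow> l i \<le> l (Suc i)" and g: "\<And>i. i < n \<Longrightarrow> \<bar>g i\<bar> \<le> L"
    and L: "0 < L" and n: "l 0 < l n"
  shows "subg (l 0) (l n) (L * sqrt (l n - l 0)) (\<lambda>\<omega>. \<Sum>i<n. g i * (w (l (Suc i)) \<omega> - w (l i) \<omega>))"
proof -
  have mono: "l i \<le> l j" if "i \<le> j" "j \<le> n" for i j
    using that by (induction j) (auto simp: le_Suc_eq intro: order_trans[OF _ l(2)])
  have l0: "0 \<le> l i" if "i \<le> n" for i using mono[of 0 i] l(1) that by simp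
  have meas: "(\<lambda>\<omega>. \<Sum>i<k. g i * (w (l (Suc i)) \<omega> - w (l i) \<omega>)) \<in> borel_measurable (F (l k))" if "k \<le> n" for k
    using that by (intro borel_measurable_sum borel_measurable_times incr_adapted) (auto intro!: l0 mono)
  have "(\<integral>\<^sup>+\<omega>. U \<omega> * ennreal (exp (\<theta> * (\<Sum>i<k. g i * (w (l (Suc i)) \<omega> - w (l i) \<omega>)))) \<partial>M)
     \<le> ennreal (exp (\<theta>\<^sup>2 * (L\<^sup>2 * (l k - l 0)) / 2)) * (\<integral>\<^sup>+\<omega>. U \<omega> \<partial>M)"
    if U: "U \<in> borel_measurable (F (l 0))" and "k \<le> n" for U \<theta> k
    using \<open>k \<le> n\<close>
  proof (induction k)
    case (Suc k)
    then have k: "k < n" "k \<le> n" by auto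
    let ?S = "\<lambda>\<omega>. \<Sum>i<k. g i * (w (l (Suc i)) \<omega> - w (l i) \<omega>)"
    let ?V = "\<lambda>\<omega>. U \<omega> * ennreal (exp (\<theta> * ?S \<omega>))"
    have "U \<in> borel_measurable (F (l k))"
      using U l0[of 0] mono[of 0 k] k(2) measurable_F_mono by blast
    then have V: "?V \<in> borel_measurable (F (l k))" using meas[OF k(2)] by measurable
    have "(\<integral>\<^sup>+\<omega>. U \<omega> * ennreal (exp (\<theta> * (\<Sum>i<Suc k. g i * (w (l (Suc i)) \<omega> - w (l i) \<omega>)))) \<partial>M)
        = (\<integral>\<^sup>+\<omega>. ?V \<omega> * ennreal (exp ((\<theta> * g k) * (w (l (Suc k)) \<omega> - w (l k) \<omega>))) \<partial>M)"
      by (simp add: distrib_left exp_add ennreal_mult mult_ac)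
    also have "\<dots> = ennreal (exp ((\<theta> * g k)\<^sup>2 * (l (Suc k) - l k) / 2)) * (\<integral>\<^sup>+\<omega>. ?V \<omega> \<partial>M)"
      by (rule nn_integral_exp_incr[OF l0[OF k(2)] l(2)[OF k(1)] V])
    also have "\<dots> \<le> ennreal (exp (\<theta>\<^sup>2 * (L\<^sup>2 * (l (Suc k) - l k)) / 2)) *
        (ennreal (exp (\<theta>\<^sup>2 * (L\<^sup>2 * (l k - l 0)) / 2)) * (\<integral>\<^sup>+\<omega>. U \<omega> \<partial>M))"
    proof (intro mult_mono Suc.IH k ennreal_leI)
      have "(g k)\<^sup>2 \<le> L\<^sup>2" using power_mono[OF g[OF k(1)] abs_ge_zero, of 2] by simp
      then show "exp ((\<theta> * g k)\<^sup>2 * (l (Suc k) - l k) / 2) \<le> exp (\<theta>\<^sup>2 * (L\<^sup>2 * (l (Suc k) - l k)) / 2)"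
        using l(2)[OF k(1)] by (simp add: power_mult_distrib mult.assoc mult_left_mono mult_right_mono)
    qed auto
    also have "\<dots> = ennreal (exp (\<theta>\<^sup>2 * (L\<^sup>2 * (l (Suc k) - l 0)) / 2)) * (\<integral>\<^sup>+\<omega>. U \<omega> \<partial>M)"
      unfolding mult.assoc[symmetric] by (simp add: ennreal_mult[symmetric] exp_add[symmetric] algebra_simps add_divide_distrib[symmetric])
    finally show ?case .
  qed simp
  from this[OF _ order_refl] have "(\<integral>\<^sup>+\<omega>. U \<omega> * ennreal (exp (\<theta> * (\<Sum>i<n. g i * (w (l (Suc i)) \<omega> - w (l i) \<omega>)))) \<partial>M)
     \<le> ennreal (exp (\<theta>\<^sup>2 * (L * sqrt (l n - l 0))\<^sup>2 / 2)) * (\<integral>\<^sup>+\<omega>. U \<omega> \<partial>M)"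
    if "U \<in> borel_measurable (F (l 0))" for U \<theta>
    using n that by (simp add: power_mult_distrib)
  then show ?thesis unfolding subg_def using l(1) n L meas[OF order_refl] by simp
qed

end

section \<open>Uniform grids and approximation by step functions\<close>

definition ugrid :: "real \<Rightarrow> real \<Rightarrow> nat \<Rightarrow> nat \<Rightarrow> real" where
  "ugrid p q n i = p + (q - p) * real i / real n"

lemma ugrid_0 [simp]: "ugrid p q n 0 = p"
  and ugrid_n [simp]: "0 < n \<Longrightarrow> ugrid p q n n = q"
  by (simp_all add: ugrid_def)

lemma ugrid_mono: "p \<le> q \<Longrightarrow> i \<le> j \<Longrightarrow> ugrid p q n i \<le> ugrid p q n j"
  unfolding ugrid_def by (intro add_left_mono divide_right_mono mult_left_mono) auto

lemma ugrid_bounds: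
  assumes "p \<le> q" "i \<le> n" "0 < n"
  shows "p \<le> ugrid p q n i" "ugrid p q n i \<le> q"
  using ugrid_mono[OF assms(1), of 0 i n] ugrid_mono[OF assms(1,2), of n] assms(3) by auto

lemma ugrid_step: "ugrid p q n (Suc i) - ugrid p q n i = (q - p) / real n"
  by (simp add: ugrid_def diff_divide_distrib[symmetric] algebra_simps)

lemma ugrid_cell:
  assumes "p < s" "s \<le> q" "0 < n"
  shows "\<exists>i<n. ugrid p q n i < s \<and> s \<le> ugrid p q n (Suc i) \<and>
    (\<forall>j. ugrid p q n j < s \<longrightarrow> s \<le> ugrid p q n (Suc j) \<longrightarrow> j = i)"
proof -
  have pq: "0 < q - p" using assms by simp
  define x where "x = (s - p) * real n / (q - p)"
  have x: "0 < x" "x \<le> real n" using assms by (auto simp: x_def divide_simps)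
  have iff1: "ugrid p q n j < s \<longleftrightarrow> real j < x" for j
    using assms pq by (auto simp: ugrid_def x_def field_simps)
  have iff2: "s \<le> ugrid p q n j \<longleftrightarrow> x \<le> real j" for j
    using assms pq by (auto simp: ugrid_def x_def field_simps)
  \<comment> \<open>Cells are open on the left and closed on the right, hence the ceiling minus one
    instead of the floor.\<close>
  define i where "i = nat (\<lceil>x\<rceil> - 1)"
  have i: "real i < x" "x \<le> real (Suc i)" unfolding i_def using x(1) by linarith+
  show ?thesis
  proof (intro exI[of _ i] conjI allI impI)
    show "i < n" using i x by linarith
    show "ugrid p q n i < s" "s \<le> ugrid p q n (Suc i)" using i iff1 iff2 by auto
    show "j = i" if "ugrid p q n j < s" "s \<le> ugrid p q n (Suc j)" for j
      using that i unfolding iff1 iff2 by linarith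
  qed
qed

lemma step_approximation:
  fixes f :: "real \<Rightarrow> real"
  assumes pq: "p \<le> q" and cont: "continuous_on {p..q} f" and \<epsilon>: "0 < \<epsilon>"
  obtains n where "0 < n"
    "\<And>s. s \<in> {p<..q} \<Longrightarrow> \<bar>f s - (\<Sum>i<n. f (ugrid p q n i) * indicator {ugrid p q n i<..ugrid p q n (Suc i)} s)\<bar> \<le> \<epsilon>"
proof -
  obtain \<delta> where \<delta>: "0 < \<delta>" "\<And>x y. x \<in> {p..q} \<Longrightarrow> y \<in> {p..q} \<Longrightarrow> dist y x < \<delta> \<Longrightarrow> dist (f y) (f x) < \<epsilon>"
    using compact_uniformly_continuous[OF cont compact_Icc, unfolded uniformly_continuous_on_def,
        rule_format, OF \<epsilon>] by blast
  obtain n where n: "(q - p) / \<delta> < real n" using reals_Archimedean2 by blast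
  have n0: "0 < n"
  proof -
    have "0 \<le> (q - p) / \<delta>" using pq \<delta> by simp
    then have "0 < real n" using n by linarith
    then show ?thesis by simp
  qed
  have step: "(q - p) / real n < \<delta>" using n n0 \<delta> by (simp add: divide_simps mult.commute)
  show ?thesis
  proof (rule that[OF n0])
    fix s assume s: "s \<in> {p<..q}"
    have ps: "p < s" "s \<le> q" using s by auto
    from ugrid_cell[OF ps n0] obtain i where i: "i < n" "ugrid p q n i < s" "s \<le> ugrid p q n (Suc i)"
      and uniq: "\<forall>j. ugrid p q n j < s \<longrightarrow> s \<le> ugrid p q n (Suc j) \<longrightarrow> j = i"
      by (elim exE conjE)
    have "(\<Sum>j<n. f (ugrid p q n j) * indicator {ugrid p q n j<..ugrid p q n (Suc j)} s)
        = (\<Sum>j<n. if j = i then f (ugrid p q n i) else 0)"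
    proof (intro sum.cong refl)
      fix j
      have "indicator {ugrid p q n j<..ugrid p q n (Suc j)} s = (if j = i then 1 else 0 :: real)"
      proof (cases "j = i")
        case False
        then have "s \<notin> {ugrid p q n j<..ugrid p q n (Suc j)}" using uniq by auto
        then show ?thesis using False by simp
      qed (use i(2,3) in simp)
      then show "f (ugrid p q n j) * indicator {ugrid p q n j<..ugrid p q n (Suc j)} s
          = (if j = i then f (ugrid p q n i) else 0)" by simp
    qed
    also have "\<dots> = f (ugrid p q n i)" using i(1) by (simp add: sum.delta)
    finally have e: "(\<Sum>j<n. f (ugrid p q n j) * indicator {ugrid p q n j<..ugrid p q n (Suc j)} s) = f (ugrid p q n i)" .
    have "s - ugrid p q n i < \<delta>" using i(3) ugrid_step[of p q n i] step by linarith
    then have d: "dist s (ugrid p q n i) < \<delta>" using i(2) unfolding dist_real_def by linarith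
    have "dist (f s) (f (ugrid p q n i)) < \<epsilon>"
      by (rule \<delta>(2)[OF _ _ d]) (use ugrid_bounds[OF pq less_imp_le[OF i(1)] n0] s in simp_all)
    then show "\<bar>f s - (\<Sum>i<n. f (ugrid p q n i) * indicator {ugrid p q n i<..ugrid p q n (Suc i)} s)\<bar> \<le> \<epsilon>"
      unfolding e dist_real_def by (rule less_imp_le)
  qed
qed

lemma grid_mono:
  assumes "grid u v N \<tau>" "i \<le> j" "j \<le> N"
  shows "\<tau> i \<le> \<tau> j"
  using assms(2,3)
proof (induction j)
  case (Suc j)
  have "\<tau> j < \<tau> (Suc j)" using assms(1) Suc.prems unfolding grid_def by simp
  then show ?case using Suc by (cases "i = Suc j") auto
qed simp

lemma grid_bounds:
  assumes "grid u v N \<tau>" "i \<le> N"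
  shows "u \<le> \<tau> i" "\<tau> i \<le> v"
  using grid_mono[OF assms(1), of 0 i] grid_mono[OF assms(1), of i N] assms unfolding grid_def by auto

lemma power2_add_le: "(x + y)\<^sup>2 \<le> 2 * x\<^sup>2 + 2 * (y::real)\<^sup>2"
  using sum_squares_bound[of x y] by (simp add: power2_sum)

lemma elementary_process_eq_0:
  assumes "grid u v N \<tau>" "s \<notin> {u<..v}"
  shows "elementary_process N \<tau> \<xi> s \<omega> = 0"
  unfolding elementary_process_def
proof (intro sum.neutral ballI)
  fix i assume "i \<in> {..<N}"
  then have "s \<notin> {\<tau> i<..\<tau> (Suc i)}"
    using assms(2) grid_bounds[OF assms(1), of i] grid_bounds[OF assms(1), of "Suc i"] by auto
  then show "indicat_real {\<tau> i<..\<tau> (Suc i)} s *\<^sub>R \<xi> i \<omega> = 0" by simp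
qed

section \<open>Integrals of deterministic functions: from mean squares to exponential bounds\<close>

context filtered_wiener
begin

text \<open>\<open>J\<close> comes only with some approximating elementary processes on unknown
  grids. The isometry for overlapping intervals compares their integrals with that of a chosen step
  function, as both are close to \<open>f\<close>: one in mean square, the other uniformly. The
  factor 4 stems from two uses of \<open>power2_add_le\<close>, one for the integrands and one for
  \<open>J\<close>.\<close>

lemma ito_step_distance:
  fixes f :: "real \<Rightarrow> 'b::euclidean_space" and l r g :: "'i \<Rightarrow> real"
  assumes J: "has_ito_integral M F w (\<lambda>s \<omega>. f s) u v J" and uv: "0 \<le> u" "u \<le> v"
    and cont: "continuous_on {u..v} f" and e: "norm e = 1"
    and I: "finite I" and lr: "\<And>i. i \<in> I \<Longrightarrow> u \<le> l i" "\<And>i. i \<in> I \<Longrightarrow> l i \<le> r i" "\<And>i. i \<in> I \<Longrightarrow> r i \<le> v"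
    and approx: "\<And>s. s \<in> {u<..v} \<Longrightarrow> \<bar>f s \<bullet> e - (\<Sum>i\<in>I. g i * indicator {l i<..r i} s)\<bar> \<le> \<epsilon>"
  shows "(\<integral>\<^sup>+\<omega>. ennreal ((J \<omega> \<bullet> e - (\<Sum>i\<in>I. g i * (w (r i) \<omega> - w (l i) \<omega>)))\<^sup>2) \<partial>M) \<le> ennreal (4 * \<epsilon>\<^sup>2 * (v - u))"
proof -
  note J' = J[unfolded has_ito_integral_def, THEN conjunct2, THEN conjunct2, THEN conjunct2]
  have J_meas: "J \<in> borel_measurable M" by (rule J'[THEN conjunct1])
  from J'[THEN conjunct2] obtain N \<tau> and \<xi> :: "nat \<Rightarrow> nat \<Rightarrow> 'a \<Rightarrow> 'b"
    where ge: "\<forall>j. grid u v (N j) (\<tau> j) \<and> elementary_coeffs M F (N j) (\<tau> j) (\<xi> j)"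
    and lim1: "(\<lambda>j. \<integral>\<^sup>+\<omega>. (\<integral>\<^sup>+s\<in>{u..v}.
           ennreal ((norm (f s - elementary_process (N j) (\<tau> j) (\<xi> j) s \<omega>))\<^sup>2) \<partial>lborel) \<partial>M) \<longlonglongrightarrow> 0"
    and lim2: "(\<lambda>j. \<integral>\<^sup>+\<omega>. ennreal ((norm (J \<omega> - elementary_integral w (N j) (\<tau> j) (\<xi> j) \<omega>))\<^sup>2) \<partial>M) \<longlonglongrightarrow> 0"
    by (elim exE conjE)
  have g\<tau>: "grid u v (N j) (\<tau> j)" and el: "elementary_coeffs M F (N j) (\<tau> j) (\<xi> j)" for j
    using ge by auto
  define R where "R \<omega> = (\<Sum>i\<in>I. g i * (w (r i) \<omega> - w (l i) \<omega>))" for \<omega>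
  define A where "A j \<omega> = (\<integral>\<^sup>+s\<in>{u..v}.
           ennreal ((norm (f s - elementary_process (N j) (\<tau> j) (\<xi> j) s \<omega>))\<^sup>2) \<partial>lborel)" for j \<omega>
  define B where "B j \<omega> = ennreal ((norm (J \<omega> - elementary_integral w (N j) (\<tau> j) (\<xi> j) \<omega>))\<^sup>2)" for j \<omega>
  define E where "E j \<omega> = elementary_integral w (N j) (\<tau> j) (\<xi> j) \<omega> \<bullet> e" for j \<omega>
  have \<tau>0: "0 \<le> \<tau> j i" if "i \<le> N j" for i j using grid_bounds[OF g\<tau> that] uv by linarith
  have \<xi>F: "\<xi> j i \<in> borel_measurable (F (\<tau> j i))" and \<xi>b: "bounded (\<xi> j i ` space M)" if "i < N j" for i j
    using el that unfolding elementary_coeffs_def by auto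
  have \<xi>M: "\<xi> j i \<in> borel_measurable M" if "i < N j" for i j
    by (rule measurable_F_M[OF \<tau>0 \<xi>F[OF that]]) (use that in simp)
  have EI_meas: "elementary_integral w (N j) (\<tau> j) (\<xi> j) \<in> borel_measurable M" for j
    unfolding elementary_integral_def[abs_def]
    by (intro borel_measurable_sum borel_measurable_scaleR borel_measurable_diff wiener_measurable \<xi>M)
      (auto intro: \<tau>0)
  have B_meas: "B j \<in> borel_measurable M" for j
    unfolding B_def[abs_def] using EI_meas J_meas by measurable
  have R_meas: "R \<in> borel_measurable M"
    unfolding R_def[abs_def]
    by (intro borel_measurable_sum borel_measurable_times borel_measurable_diff wiener_measurable)
      (use lr uv in \<open>auto intro: order_trans[OF uv(1)] order_trans[OF order_trans[OF uv(1) lr(1)] lr(2)]\<close>)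
  have E_meas: "E j \<in> borel_measurable M" for j
    unfolding E_def[abs_def] using EI_meas by measurable
  have A_meas: "A j \<in> borel_measurable M" for j
  proof -
    \<comment> \<open>\<open>f\<close> is known to be continuous on \<open>{u..v}\<close> only; cut
      off outside it becomes a Borel function, and the integral over \<open>{u..v}\<close> does not
      see the change.\<close>
    define f' where "f' s = indicator {u..v} s *\<^sub>R f s" for s
    have f'[measurable]: "f' \<in> borel_measurable borel"
      unfolding f'_def using cont by (intro borel_measurable_continuous_on_indicator) auto
    have Ae: "A j \<omega> = (\<integral>\<^sup>+s. ennreal ((norm (f' s - elementary_process (N j) (\<tau> j) (\<xi> j) s \<omega>))\<^sup>2) * indicator {u..v} s \<partial>lborel)" for \<omega>
      unfolding A_def by (intro nn_integral_cong) (auto simp: f'_def indicator_def)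
    have ep: "(\<lambda>x. elementary_process (N j) (\<tau> j) (\<xi> j) (snd x) (fst x)) \<in> borel_measurable (M \<Otimes>\<^sub>M lborel)"
      unfolding elementary_process_def
    proof (intro borel_measurable_sum)
      fix i assume "i \<in> {..<N j}"
      then have [measurable]: "\<xi> j i \<in> borel_measurable M" using \<xi>M by auto
      show "(\<lambda>x. indicat_real {\<tau> j i<..\<tau> j (Suc i)} (snd x) *\<^sub>R \<xi> j i (fst x)) \<in> borel_measurable (M \<Otimes>\<^sub>M lborel)"
        by measurable
    qed
    have "(\<lambda>x. ennreal ((norm (f' (snd x) - elementary_process (N j) (\<tau> j) (\<xi> j) (snd x) (fst x)))\<^sup>2) * indicator {u..v} (snd x))
        \<in> borel_measurable (M \<Otimes>\<^sub>M lborel)"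
      using ep by measurable
    then have "(\<lambda>\<omega>. \<integral>\<^sup>+s. ennreal ((norm (f' (snd (\<omega>, s)) - elementary_process (N j) (\<tau> j) (\<xi> j) (snd (\<omega>, s)) (fst (\<omega>, s))))\<^sup>2)
        * indicator {u..v} (snd (\<omega>, s)) \<partial>lborel) \<in> borel_measurable M"
      by (intro lborel.borel_measurable_nn_integral) (simp add: case_prod_beta')
    then show ?thesis unfolding Ae[abs_def] by simp
  qed
  have main: "(\<integral>\<^sup>+\<omega>. ennreal ((E j \<omega> - R \<omega>)\<^sup>2) \<partial>M) \<le> 2 * (\<integral>\<^sup>+\<omega>. A j \<omega> \<partial>M) + ennreal (2 * \<epsilon>\<^sup>2 * (v - u))" for j
  proof -
    \<comment> \<open>The disjoint union of the two index sets turns the difference of the integrals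
      into a single simple integral, with coefficients \<open>- g i\<close> on the second
      part.\<close>
    define K where "K = ({..<N j} <+> I :: (nat + 'i) set)"
    define ll where "ll = case_sum (\<tau> j) l"
    define rr where "rr = case_sum (\<lambda>i. \<tau> j (Suc i)) r"
    define cc where "cc = case_sum (\<lambda>i \<omega>. \<xi> j i \<omega> \<bullet> e) (\<lambda>i \<omega>. - g i)"
    have fK: "finite K" using I by (simp add: K_def)
    have sumE: "E j \<omega> - R \<omega> = (\<Sum>k\<in>K. cc k \<omega> * (w (rr k) \<omega> - w (ll k) \<omega>))" for \<omega>
      unfolding K_def E_def R_def elementary_integral_def using I
      by (simp add: sum.Plus cc_def rr_def ll_def inner_sum_left sum_negf mult.commute)
    have sumP: "(\<Sum>k\<in>K. cc k \<omega> * indicator {ll k<..rr k} s)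
        = elementary_process (N j) (\<tau> j) (\<xi> j) s \<omega> \<bullet> e - (\<Sum>i\<in>I. g i * indicator {l i<..r i} s)" for \<omega> s
      unfolding K_def elementary_process_def sum.Plus[OF finite_lessThan I]
      by (simp add: cc_def rr_def ll_def inner_sum_left sum_negf mult.commute
          del: sum_mult_indicator sum_indicator_mult sum_indicator_scaleR)
    have iso: "(\<integral>\<^sup>+\<omega>. ennreal ((E j \<omega> - R \<omega>)\<^sup>2) \<partial>M)
       = (\<integral>\<^sup>+\<omega>. (\<integral>\<^sup>+s. ennreal ((\<Sum>k\<in>K. cc k \<omega> * indicator {ll k<..rr k} s)\<^sup>2) \<partial>lborel) \<partial>M)"
      unfolding sumE
    proof (rule wiener_isometry[OF fK])
      fix k assume k: "k \<in> K"
      show "0 \<le> ll k" using k \<tau>0 lr(1) uv by (auto simp: K_def ll_def intro: order_trans)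
      show "ll k \<le> rr k" using k lr(2) g\<tau>[of j] by (auto simp: K_def ll_def rr_def grid_def less_imp_le)
      show "cc k \<in> borel_measurable (F (ll k))"
        using k \<xi>F by (auto simp: K_def ll_def cc_def)
      show "bounded (cc k ` space M)"
      proof (cases k)
        case (Inl i)
        then have "i < N j" using k by (auto simp: K_def)
        then obtain B where B: "\<And>\<omega>. \<omega> \<in> space M \<Longrightarrow> norm (\<xi> j i \<omega>) \<le> B"
          using \<xi>b unfolding bounded_iff by blast
        have "\<bar>\<xi> j i \<omega> \<bullet> e\<bar> \<le> B" if "\<omega> \<in> space M" for \<omega>
          using Cauchy_Schwarz_ineq2[of "\<xi> j i \<omega>" e] B[OF that] e by simp
        then show ?thesis using Inl by (auto simp: cc_def bounded_real)
      next
        case (Inr i) then show ?thesis by (auto simp: cc_def bounded_real)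
      qed
    qed
    have pw: "ennreal ((\<Sum>k\<in>K. cc k \<omega> * indicator {ll k<..rr k} s)\<^sup>2)
        \<le> 2 * (ennreal ((norm (f s - elementary_process (N j) (\<tau> j) (\<xi> j) s \<omega>))\<^sup>2) * indicator {u..v} s)
          + ennreal (2 * \<epsilon>\<^sup>2) * indicator {u..v} s" for \<omega> s
    proof (cases "s \<in> {u<..v}")
      case True
      let ?P = "elementary_process (N j) (\<tau> j) (\<xi> j) s \<omega>" and ?S = "\<Sum>i\<in>I. g i * indicator {l i<..r i} s"
      have "(?P \<bullet> e - ?S)\<^sup>2 = ((?P - f s) \<bullet> e + (f s \<bullet> e - ?S))\<^sup>2" by (simp add: inner_diff_left)
      also have "\<dots> \<le> 2 * ((?P - f s) \<bullet> e)\<^sup>2 + 2 * (f s \<bullet> e - ?S)\<^sup>2" by (rule power2_add_le)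
      also have "\<dots> \<le> 2 * (norm (f s - ?P))\<^sup>2 + 2 * \<epsilon>\<^sup>2"
      proof -
        have "\<bar>(?P - f s) \<bullet> e\<bar> \<le> norm (f s - ?P)"
          using Cauchy_Schwarz_ineq2[of "?P - f s" e] e by (simp add: norm_minus_commute)
        from power_mono[OF this, of 2] power_mono[OF approx[OF True], of 2]
        show ?thesis by simp
      qed
      finally have "ennreal ((?P \<bullet> e - ?S)\<^sup>2) \<le> ennreal (2 * (norm (f s - ?P))\<^sup>2 + 2 * \<epsilon>\<^sup>2)"
        by (rule ennreal_leI)
      also have "\<dots> = 2 * ennreal ((norm (f s - ?P))\<^sup>2) + ennreal (2 * \<epsilon>\<^sup>2)"
        by (simp add: ennreal_mult)
      finally show ?thesis unfolding sumP using True by simp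
    next
      case False
      have "g i * indicator {l i<..r i} s = 0" if "i \<in> I" for i
        using False lr(1)[OF that] lr(3)[OF that] by (auto simp: indicator_def)
      then have "(\<Sum>i\<in>I. g i * indicator {l i<..r i} s) = 0" by (intro sum.neutral) auto
      then show ?thesis unfolding sumP elementary_process_eq_0[OF g\<tau> False] by simp
    qed
    have fE: "(\<lambda>s. ennreal ((norm (f s - elementary_process (N j) (\<tau> j) (\<xi> j) s \<omega>))\<^sup>2) * indicator {u..v} s)
        \<in> borel_measurable lborel" for \<omega>
    proof -
      have [measurable]: "(\<lambda>s. indicator {u..v} s *\<^sub>R f s) \<in> borel_measurable borel"
        using cont by (intro borel_measurable_continuous_on_indicator) auto
      have "(\<lambda>s. ennreal ((norm (indicator {u..v} s *\<^sub>R f s - elementary_process (N j) (\<tau> j) (\<xi> j) s \<omega>))\<^sup>2) * indicator {u..v} s)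
        \<in> borel_measurable lborel"
        unfolding elementary_process_def by measurable
      then show ?thesis
        by (rule back_subst[of "\<lambda>h. h \<in> borel_measurable lborel"]) (auto simp: fun_eq_iff indicator_def)
    qed
    have inner: "(\<integral>\<^sup>+s. ennreal ((\<Sum>k\<in>K. cc k \<omega> * indicator {ll k<..rr k} s)\<^sup>2) \<partial>lborel)
        \<le> 2 * A j \<omega> + ennreal (2 * \<epsilon>\<^sup>2 * (v - u))" for \<omega>
    proof -
      have "(\<integral>\<^sup>+s. ennreal ((\<Sum>k\<in>K. cc k \<omega> * indicator {ll k<..rr k} s)\<^sup>2) \<partial>lborel)
        \<le> (\<integral>\<^sup>+s. 2 * (ennreal ((norm (f s - elementary_process (N j) (\<tau> j) (\<xi> j) s \<omega>))\<^sup>2) * indicator {u..v} s)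
          + ennreal (2 * \<epsilon>\<^sup>2) * indicator {u..v} s \<partial>lborel)"
        by (intro nn_integral_mono pw)
      also have "\<dots> = 2 * A j \<omega> + ennreal (2 * \<epsilon>\<^sup>2) * emeasure lborel {u..v}"
        unfolding A_def using fE[of \<omega>]
        by (subst nn_integral_add) (auto simp: nn_integral_cmult nn_integral_cmult_indicator)
      also have "\<dots> = 2 * A j \<omega> + ennreal (2 * \<epsilon>\<^sup>2 * (v - u))"
        using uv by (simp add: ennreal_mult[symmetric])
      finally show ?thesis .
    qed
    have "(\<integral>\<^sup>+\<omega>. ennreal ((E j \<omega> - R \<omega>)\<^sup>2) \<partial>M) \<le> (\<integral>\<^sup>+\<omega>. 2 * A j \<omega> + ennreal (2 * \<epsilon>\<^sup>2 * (v - u)) \<partial>M)"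
      unfolding iso by (intro nn_integral_mono inner)
    also have "\<dots> = 2 * (\<integral>\<^sup>+\<omega>. A j \<omega> \<partial>M) + ennreal (2 * \<epsilon>\<^sup>2 * (v - u))"
      using A_meas by (subst nn_integral_add) (auto simp: nn_integral_cmult emeasure_space_1)
    finally show ?thesis .
  qed
  have bound: "(\<integral>\<^sup>+\<omega>. ennreal ((J \<omega> \<bullet> e - R \<omega>)\<^sup>2) \<partial>M)
      \<le> 2 * (\<integral>\<^sup>+\<omega>. B j \<omega> \<partial>M) + 2 * (2 * (\<integral>\<^sup>+\<omega>. A j \<omega> \<partial>M) + ennreal (2 * \<epsilon>\<^sup>2 * (v - u)))" for j
  proof -
    have "ennreal ((J \<omega> \<bullet> e - R \<omega>)\<^sup>2) \<le> 2 * B j \<omega> + 2 * ennreal ((E j \<omega> - R \<omega>)\<^sup>2)" for \<omega>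
    proof -
      let ?K = "elementary_integral w (N j) (\<tau> j) (\<xi> j) \<omega>"
      have "(J \<omega> \<bullet> e - R \<omega>)\<^sup>2 = ((J \<omega> - ?K) \<bullet> e + (E j \<omega> - R \<omega>))\<^sup>2"
        by (simp add: inner_diff_left E_def)
      also have "\<dots> \<le> 2 * ((J \<omega> - ?K) \<bullet> e)\<^sup>2 + 2 * (E j \<omega> - R \<omega>)\<^sup>2" by (rule power2_add_le)
      also have "\<dots> \<le> 2 * (norm (J \<omega> - ?K))\<^sup>2 + 2 * (E j \<omega> - R \<omega>)\<^sup>2"
      proof -
        have "\<bar>(J \<omega> - ?K) \<bullet> e\<bar> \<le> norm (J \<omega> - ?K)"
          using Cauchy_Schwarz_ineq2[of "J \<omega> - ?K" e] e by simp
        from power_mono[OF this, of 2] show ?thesis by simp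
      qed
      finally have "ennreal ((J \<omega> \<bullet> e - R \<omega>)\<^sup>2) \<le> ennreal (2 * (norm (J \<omega> - ?K))\<^sup>2 + 2 * (E j \<omega> - R \<omega>)\<^sup>2)"
        by (rule ennreal_leI)
      also have "\<dots> = 2 * B j \<omega> + 2 * ennreal ((E j \<omega> - R \<omega>)\<^sup>2)"
        unfolding B_def by (simp add: ennreal_mult)
      finally show ?thesis .
    qed
    then have "(\<integral>\<^sup>+\<omega>. ennreal ((J \<omega> \<bullet> e - R \<omega>)\<^sup>2) \<partial>M) \<le> (\<integral>\<^sup>+\<omega>. 2 * B j \<omega> + 2 * ennreal ((E j \<omega> - R \<omega>)\<^sup>2) \<partial>M)"
      by (intro nn_integral_mono)
    also have "\<dots> = 2 * (\<integral>\<^sup>+\<omega>. B j \<omega> \<partial>M) + 2 * (\<integral>\<^sup>+\<omega>. ennreal ((E j \<omega> - R \<omega>)\<^sup>2) \<partial>M)"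
      using B_meas E_meas R_meas by (subst nn_integral_add) (auto simp: nn_integral_cmult)
    also have "\<dots> \<le> 2 * (\<integral>\<^sup>+\<omega>. B j \<omega> \<partial>M) + 2 * (2 * (\<integral>\<^sup>+\<omega>. A j \<omega> \<partial>M) + ennreal (2 * \<epsilon>\<^sup>2 * (v - u)))"
      by (intro add_left_mono mult_left_mono main) simp
    finally show ?thesis .
  qed
  \<comment> \<open>The bound holds for each \<open>j\<close>, and both approximation errors of the
    defining sequence vanish; only the uniform error of the chosen step function survives.\<close>
  have "(\<lambda>j. 2 * (\<integral>\<^sup>+\<omega>. B j \<omega> \<partial>M) + 2 * (2 * (\<integral>\<^sup>+\<omega>. A j \<omega> \<partial>M) + ennreal (2 * \<epsilon>\<^sup>2 * (v - u))))
      \<longlonglongrightarrow> 2 * 0 + 2 * (2 * 0 + ennreal (2 * \<epsilon>\<^sup>2 * (v - u)))"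
    using lim1 lim2 unfolding A_def[symmetric] B_def[symmetric]
    by (intro tendsto_add ennreal_tendsto_cmult tendsto_const) auto
  then have "(\<integral>\<^sup>+\<omega>. ennreal ((J \<omega> \<bullet> e - R \<omega>)\<^sup>2) \<partial>M) \<le> 2 * 0 + 2 * (2 * 0 + ennreal (2 * \<epsilon>\<^sup>2 * (v - u)))"
    by (rule LIMSEQ_le_const) (use bound in blast)
  also have "\<dots> = ennreal 2 * ennreal (2 * \<epsilon>\<^sup>2 * (v - u))" by simp
  also have "\<dots> = ennreal (2 * (2 * \<epsilon>\<^sup>2 * (v - u)))"
    by (rule ennreal_mult[symmetric]) (use uv in simp_all)
  also have "2 * (2 * \<epsilon>\<^sup>2 * (v - u)) = 4 * \<epsilon>\<^sup>2 * (v - u)" by simp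
  finally show ?thesis unfolding R_def .
qed

end

context filtered_space
begin

text \<open>Mean-square convergence provides an almost surely convergent subsequence, to which
  \<open>subg_limit\<close> applies.\<close>

lemma subg_L2_limit:
  assumes G: "\<And>k. subg u v \<sigma> (G k)" and H: "H \<in> borel_measurable M"
    and lim: "(\<lambda>k. \<integral>\<^sup>+\<omega>. ennreal ((H \<omega> - G k \<omega>)\<^sup>2) \<partial>M) \<longlonglongrightarrow> 0"
    and fin: "\<And>k. (\<integral>\<^sup>+\<omega>. ennreal ((H \<omega> - G k \<omega>)\<^sup>2) \<partial>M) < \<top>"
  shows "subg u v \<sigma> H"
proof -
  note [measurable] = H subgD(6)[OF G]
  let ?d = "\<lambda>k \<omega>. (H \<omega> - G k \<omega>)\<^sup>2"
  have int: "integrable M (?d k)" for k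
    by (rule integrableI_nonneg) (use fin[of k] in auto)
  have "(\<lambda>k. ennreal (\<integral>\<omega>. norm (?d k \<omega>) \<partial>M)) \<longlonglongrightarrow> ennreal 0"
    using lim nn_integral_eq_integral[OF int] by simp
  then have "(\<lambda>k. \<integral>\<omega>. norm (?d k \<omega>) \<partial>M) \<longlonglongrightarrow> 0"
    by (subst (asm) tendsto_ennreal_iff) auto
  from tendsto_L1_AE_subseq[OF int this] obtain \<rho> :: "nat \<Rightarrow> nat"
    where AE: "AE \<omega> in M. (\<lambda>n. ?d (\<rho> n) \<omega>) \<longlonglongrightarrow> 0" by blast
  have "AE \<omega> in M. (\<lambda>n. G (\<rho> n) \<omega>) \<longlonglongrightarrow> H \<omega>"
    using AE
  proof eventually_elim
    case (elim \<omega>)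
    then have "(\<lambda>n. sqrt (?d (\<rho> n) \<omega>)) \<longlonglongrightarrow> sqrt 0" by (intro tendsto_real_sqrt)
    then have "(\<lambda>n. \<bar>H \<omega> - G (\<rho> n) \<omega>\<bar>) \<longlonglongrightarrow> 0" by simp
    then have "(\<lambda>n. H \<omega> - G (\<rho> n) \<omega>) \<longlonglongrightarrow> 0" by (rule tendsto_rabs_zero_cancel)
    then have "(\<lambda>n. H \<omega> - (H \<omega> - G (\<rho> n) \<omega>)) \<longlonglongrightarrow> H \<omega> - 0" by (intro tendsto_diff tendsto_const)
    then show ?case by simp
  qed
  then show ?thesis
    by (rule subg_limit[where G="\<lambda>n. G (\<rho> n)" and \<sigma>="\<lambda>_. \<sigma>", OF G _ tendsto_const subgD(4)[OF G]])
qed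

end

context filtered_wiener
begin

text \<open>\<open>Ju\<close> and \<open>Jv\<close> are separate limits, and additivity over
  intervals is not part of their definition. Approximating both with the same step function on
  \<open>{t0..u}\<close> makes that part cancel, and the rest involves increments after
  \<open>u\<close> only. Subtracting \<kappa> times the Wiener increment reduces the coefficient to
  \<open>f s \<bullet> e - \<kappa>\<close>, so the bound sees the oscillation \<open>L\<close> and
  not the size of \<open>f\<close>.\<close>

lemma ito_increment_subg:
  fixes f :: "real \<Rightarrow> 'b::euclidean_space"
  assumes Ju: "has_ito_integral M F w (\<lambda>s \<omega>. f s) t0 u Ju"
    and Jv: "has_ito_integral M F w (\<lambda>s \<omega>. f s) t0 v Jv"
    and t: "0 \<le> t0" "t0 \<le> u" "u < v" and cont: "continuous_on {t0..v} f" and e: "norm e = 1"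
    and L: "0 < L" "\<And>s. s \<in> {u..v} \<Longrightarrow> \<bar>f s \<bullet> e - \<kappa>\<bar> \<le> L"
  shows "subg u v (L * sqrt (v - u)) (\<lambda>\<omega>. Jv \<omega> \<bullet> e - Ju \<omega> \<bullet> e - \<kappa> * (w v \<omega> - w u \<omega>))"
proof -
  define H where "H \<omega> = Jv \<omega> \<bullet> e - Ju \<omega> \<bullet> e - \<kappa> * (w v \<omega> - w u \<omega>)" for \<omega>
  have Jm: "Ju \<in> borel_measurable M" "Jv \<in> borel_measurable M"
    using Ju[unfolded has_ito_integral_def, THEN conjunct2, THEN conjunct2, THEN conjunct2, THEN conjunct1]
      Jv[unfolded has_ito_integral_def, THEN conjunct2, THEN conjunct2, THEN conjunct2, THEN conjunct1] .
  have wm: "w u \<in> borel_measurable M" "w v \<in> borel_measurable M"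
    using t by (auto intro: wiener_measurable)
  have Hm: "H \<in> borel_measurable M" unfolding H_def[abs_def] using Jm wm by measurable
  have contu: "continuous_on {t0..u} f" "continuous_on {u..v} f"
    using cont t by (auto intro: continuous_on_subset)
  have conte: "continuous_on {t0..u} (\<lambda>s. f s \<bullet> e)" "continuous_on {u..v} (\<lambda>s. f s \<bullet> e)"
    using contu by (auto intro!: continuous_intros)
  have "\<exists>G. subg u v (L * sqrt (v - u)) G \<and>
      (\<integral>\<^sup>+\<omega>. ennreal ((H \<omega> - G \<omega>)\<^sup>2) \<partial>M) \<le> ennreal (16 * \<epsilon>\<^sup>2 * (v - t0))" if \<epsilon>: "0 < \<epsilon>" for \<epsilon>
  proof -
    obtain n1 where n1: "0 < n1" "\<And>s. s \<in> {t0<..u} \<Longrightarrow> \<bar>f s \<bullet> e - (\<Sum>i<n1. f (ugrid t0 u n1 i) \<bullet> e *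
        indicator {ugrid t0 u n1 i<..ugrid t0 u n1 (Suc i)} s)\<bar> \<le> \<epsilon>"
      using step_approximation[OF t(2) conte(1) \<epsilon>] by blast
    obtain n2 where n2: "0 < n2" "\<And>s. s \<in> {u<..v} \<Longrightarrow> \<bar>f s \<bullet> e - (\<Sum>i<n2. f (ugrid u v n2 i) \<bullet> e *
        indicator {ugrid u v n2 i<..ugrid u v n2 (Suc i)} s)\<bar> \<le> \<epsilon>"
      using step_approximation[OF less_imp_le[OF t(3)] conte(2) \<epsilon>] by blast
    have b1: "t0 \<le> ugrid t0 u n1 i" "ugrid t0 u n1 i \<le> u" if "i \<le> n1" for i
      using ugrid_bounds[OF t(2) that n1(1)] by auto
    have b2: "u \<le> ugrid u v n2 i" "ugrid u v n2 i \<le> v" if "i \<le> n2" for i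
      using ugrid_bounds[OF less_imp_le[OF t(3)] that n2(1)] by auto
    have nn: "0 \<le> ugrid t0 u n1 i" if "i \<le> n1" for i using b1(1)[OF that] t(1) by linarith
    have nn': "0 \<le> ugrid u v n2 i" if "i \<le> n2" for i using b2(1)[OF that] t(1,2) by linarith
    define S1 where "S1 \<omega> = (\<Sum>i<n1. f (ugrid t0 u n1 i) \<bullet> e * (w (ugrid t0 u n1 (Suc i)) \<omega> - w (ugrid t0 u n1 i) \<omega>))" for \<omega>
    define S2 where "S2 \<omega> = (\<Sum>i<n2. f (ugrid u v n2 i) \<bullet> e * (w (ugrid u v n2 (Suc i)) \<omega> - w (ugrid u v n2 i) \<omega>))" for \<omega>
    have Sm: "S1 \<in> borel_measurable M" "S2 \<in> borel_measurable M"
      unfolding S1_def[abs_def] S2_def[abs_def]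
      by (intro borel_measurable_sum borel_measurable_times borel_measurable_diff borel_measurable_const
          wiener_measurable; simp add: nn nn')+
    have d1: "(\<integral>\<^sup>+\<omega>. ennreal ((Ju \<omega> \<bullet> e - S1 \<omega>)\<^sup>2) \<partial>M) \<le> ennreal (4 * \<epsilon>\<^sup>2 * (u - t0))"
      unfolding S1_def
      by (rule ito_step_distance[OF Ju t(1,2) contu(1) e]) (use b1 n1 ugrid_mono[OF t(2)] in auto)
    have d2: "(\<integral>\<^sup>+\<omega>. ennreal ((Jv \<omega> \<bullet> e - (S1 \<omega> + S2 \<omega>))\<^sup>2) \<partial>M) \<le> ennreal (4 * \<epsilon>\<^sup>2 * (v - t0))"
    proof -
      define K where "K = ({..<n1} <+> {..<n2})"
      define l where "l = case_sum (ugrid t0 u n1) (ugrid u v n2)"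
      define r where "r = case_sum (\<lambda>i. ugrid t0 u n1 (Suc i)) (\<lambda>i. ugrid u v n2 (Suc i))"
      define g where "g = case_sum (\<lambda>i. f (ugrid t0 u n1 i) \<bullet> e) (\<lambda>i. f (ugrid u v n2 i) \<bullet> e)"
      have S: "S1 \<omega> + S2 \<omega> = (\<Sum>k\<in>K. g k * (w (r k) \<omega> - w (l k) \<omega>))" for \<omega>
        unfolding K_def S1_def S2_def sum.Plus[OF finite_lessThan finite_lessThan]
        by (simp add: g_def l_def r_def)
      show ?thesis unfolding S
      proof (rule ito_step_distance[OF Jv _ _ cont e])
        fix s assume s: "s \<in> {t0<..v}"
        have split: "(\<Sum>k\<in>K. g k * indicator {l k<..r k} s)
          = (\<Sum>i<n1. f (ugrid t0 u n1 i) \<bullet> e * indicator {ugrid t0 u n1 i<..ugrid t0 u n1 (Suc i)} s)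
           + (\<Sum>i<n2. f (ugrid u v n2 i) \<bullet> e * indicator {ugrid u v n2 i<..ugrid u v n2 (Suc i)} s)"
          unfolding K_def sum.Plus[OF finite_lessThan finite_lessThan]
          by (simp add: g_def l_def r_def del: sum_mult_indicator)
        show "\<bar>f s \<bullet> e - (\<Sum>k\<in>K. g k * indicator {l k<..r k} s)\<bar> \<le> \<epsilon>"
        proof (cases "s \<le> u")
          case True
          have "(\<Sum>i<n2. f (ugrid u v n2 i) \<bullet> e * indicator {ugrid u v n2 i<..ugrid u v n2 (Suc i)} s) = 0"
          proof (intro sum.neutral ballI)
            fix i assume "i \<in> {..<n2}"
            then have "s \<notin> {ugrid u v n2 i<..ugrid u v n2 (Suc i)}" using True b2(1)[of i] by simp
            then show "f (ugrid u v n2 i) \<bullet> e * indicator {ugrid u v n2 i<..ugrid u v n2 (Suc i)} s = 0" by simp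
          qed
          then show ?thesis unfolding split using n1(2)[of s] s True by (simp del: sum_mult_indicator)
        next
          case False
          have "(\<Sum>i<n1. f (ugrid t0 u n1 i) \<bullet> e * indicator {ugrid t0 u n1 i<..ugrid t0 u n1 (Suc i)} s) = 0"
          proof (intro sum.neutral ballI)
            fix i assume "i \<in> {..<n1}"
            then have "s \<notin> {ugrid t0 u n1 i<..ugrid t0 u n1 (Suc i)}" using False b1(2)[of "Suc i"] by simp
            then show "f (ugrid t0 u n1 i) \<bullet> e * indicator {ugrid t0 u n1 i<..ugrid t0 u n1 (Suc i)} s = 0" by simp
          qed
          then show ?thesis unfolding split using n2(2)[of s] s False by (simp del: sum_mult_indicator)
        qed
      next
        fix k assume k: "k \<in> K"
        show "t0 \<le> l k"
        proof (cases k)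
          case (Inl i) then show ?thesis using k b1(1)[of i] by (auto simp: K_def l_def)
        next
          case (Inr i) then show ?thesis using k b2(1)[of i] t(2) by (auto simp: K_def l_def)
        qed
        show "r k \<le> v"
        proof (cases k)
          case (Inl i) then show ?thesis using k b1(2)[of "Suc i"] t(3) by (auto simp: K_def r_def)
        next
          case (Inr i) then show ?thesis using k b2(2)[of "Suc i"] by (auto simp: K_def r_def)
        qed
        show "l k \<le> r k"
          using ugrid_mono[OF t(2), of _ "Suc _"] ugrid_mono[OF less_imp_le[OF t(3)], of _ "Suc _"]
          by (auto simp: l_def r_def split: sum.split)
      qed (use t in \<open>auto simp: K_def\<close>)
    qed
    have tele: "(\<Sum>i<n2. w (ugrid u v n2 (Suc i)) \<omega> - w (ugrid u v n2 i) \<omega>) = w v \<omega> - w u \<omega>" for \<omega>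
      using n2(1) by (subst sum_lessThan_telescope) simp
    \<comment> \<open>As the increments telescope to \<open>w v - w u\<close>, the constant \<kappa>
      can be moved into the coefficients.\<close>
    define G where "G \<omega> = (\<Sum>i<n2. (f (ugrid u v n2 i) \<bullet> e - \<kappa>) * (w (ugrid u v n2 (Suc i)) \<omega> - w (ugrid u v n2 i) \<omega>))" for \<omega>
    have GS: "G \<omega> = S2 \<omega> - \<kappa> * (w v \<omega> - w u \<omega>)" for \<omega>
      unfolding G_def S2_def tele[symmetric] sum_distrib_left
      by (simp add: left_diff_distrib sum_subtractf)
    have "subg (ugrid u v n2 0) (ugrid u v n2 n2) (L * sqrt (ugrid u v n2 n2 - ugrid u v n2 0)) G"
      unfolding G_def[abs_def]
    proof (rule wiener_sum_subg)
      show "\<bar>f (ugrid u v n2 i) \<bullet> e - \<kappa>\<bar> \<le> L" if "i < n2" for i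
        using L(2)[of "ugrid u v n2 i"] b2[of i] that by simp
      show "ugrid u v n2 i \<le> ugrid u v n2 (Suc i)" for i
        using t by (intro ugrid_mono) auto
    qed (use t L n2(1) in auto)
    then have sG: "subg u v (L * sqrt (v - u)) G" using n2(1) by simp
    have "(\<integral>\<^sup>+\<omega>. ennreal ((H \<omega> - G \<omega>)\<^sup>2) \<partial>M)
        \<le> (\<integral>\<^sup>+\<omega>. 2 * ennreal ((Jv \<omega> \<bullet> e - (S1 \<omega> + S2 \<omega>))\<^sup>2) + 2 * ennreal ((Ju \<omega> \<bullet> e - S1 \<omega>)\<^sup>2) \<partial>M)"
    proof (rule nn_integral_mono)
      fix \<omega>
      have "(H \<omega> - G \<omega>)\<^sup>2 = ((Jv \<omega> \<bullet> e - (S1 \<omega> + S2 \<omega>)) + (- (Ju \<omega> \<bullet> e - S1 \<omega>)))\<^sup>2"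
        unfolding H_def GS by (simp add: algebra_simps)
      also have "\<dots> \<le> 2 * (Jv \<omega> \<bullet> e - (S1 \<omega> + S2 \<omega>))\<^sup>2 + 2 * (- (Ju \<omega> \<bullet> e - S1 \<omega>))\<^sup>2"
        by (rule power2_add_le)
      finally have "ennreal ((H \<omega> - G \<omega>)\<^sup>2)
          \<le> ennreal (2 * (Jv \<omega> \<bullet> e - (S1 \<omega> + S2 \<omega>))\<^sup>2 + 2 * (- (Ju \<omega> \<bullet> e - S1 \<omega>))\<^sup>2)" by (rule ennreal_leI)
      also have "\<dots> = 2 * ennreal ((Jv \<omega> \<bullet> e - (S1 \<omega> + S2 \<omega>))\<^sup>2) + 2 * ennreal ((Ju \<omega> \<bullet> e - S1 \<omega>)\<^sup>2)"
        unfolding power2_minus by (simp add: ennreal_mult)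
      finally show "ennreal ((H \<omega> - G \<omega>)\<^sup>2)
          \<le> 2 * ennreal ((Jv \<omega> \<bullet> e - (S1 \<omega> + S2 \<omega>))\<^sup>2) + 2 * ennreal ((Ju \<omega> \<bullet> e - S1 \<omega>)\<^sup>2)" .
    qed
    also have "\<dots> = 2 * (\<integral>\<^sup>+\<omega>. ennreal ((Jv \<omega> \<bullet> e - (S1 \<omega> + S2 \<omega>))\<^sup>2) \<partial>M)
        + 2 * (\<integral>\<^sup>+\<omega>. ennreal ((Ju \<omega> \<bullet> e - S1 \<omega>)\<^sup>2) \<partial>M)"
      using Jm Sm by (subst nn_integral_add) (auto simp: nn_integral_cmult)
    also have "\<dots> \<le> 2 * ennreal (4 * \<epsilon>\<^sup>2 * (v - t0)) + 2 * ennreal (4 * \<epsilon>\<^sup>2 * (u - t0))"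
      by (intro add_mono mult_left_mono d1 d2) auto
    also have "\<dots> = ennreal (2 * (4 * \<epsilon>\<^sup>2 * (v - t0)) + 2 * (4 * \<epsilon>\<^sup>2 * (u - t0)))"
    proof -
      have "2 * ennreal x + 2 * ennreal y = ennreal (2 * x + 2 * y)" if "0 \<le> x" "0 \<le> y" for x y
        using that by (simp add: ennreal_mult)
      then show ?thesis using t by simp
    qed
    also have "\<dots> \<le> ennreal (16 * \<epsilon>\<^sup>2 * (v - t0))"
    proof (rule ennreal_leI)
      have "\<epsilon>\<^sup>2 * (u - t0) \<le> \<epsilon>\<^sup>2 * (v - t0)" using t by (intro mult_left_mono) auto
      then show "2 * (4 * \<epsilon>\<^sup>2 * (v - t0)) + 2 * (4 * \<epsilon>\<^sup>2 * (u - t0)) \<le> 16 * \<epsilon>\<^sup>2 * (v - t0)"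
        by (simp add: mult.assoc mult.commute[of "v - t0"])
    qed
    finally show ?thesis using sG by blast
  qed
  \<comment> \<open>With \<open>\<epsilon>\<close> equal to \<open>1 / Suc k\<close> the
    approximants converge in mean square while keeping one common deviation.\<close>
  then have "\<forall>k. \<exists>G. subg u v (L * sqrt (v - u)) G \<and>
      (\<integral>\<^sup>+\<omega>. ennreal ((H \<omega> - G \<omega>)\<^sup>2) \<partial>M) \<le> ennreal (16 * (inverse (real (Suc k)))\<^sup>2 * (v - t0))"
    by simp
  then obtain G where G: "\<And>k. subg u v (L * sqrt (v - u)) (G k)"
    "\<And>k. (\<integral>\<^sup>+\<omega>. ennreal ((H \<omega> - G k \<omega>)\<^sup>2) \<partial>M) \<le> ennreal (16 * (inverse (real (Suc k)))\<^sup>2 * (v - t0))"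
    by metis
  have "(\<lambda>k. 16 * (inverse (real (Suc k)))\<^sup>2 * (v - t0)) \<longlonglongrightarrow> 16 * 0\<^sup>2 * (v - t0)"
    by (intro tendsto_intros LIMSEQ_inverse_real_of_nat)
  then have "(\<lambda>k. ennreal (16 * (inverse (real (Suc k)))\<^sup>2 * (v - t0))) \<longlonglongrightarrow> 0"
    by (auto dest: tendsto_ennrealI simp del: of_nat_Suc)
  then have "(\<lambda>k. \<integral>\<^sup>+\<omega>. ennreal ((H \<omega> - G k \<omega>)\<^sup>2) \<partial>M) \<longlonglongrightarrow> 0"
    by (rule tendsto_sandwich[OF _ _ tendsto_const, rotated 2]) (use G(2) in auto)
  moreover have "(\<integral>\<^sup>+\<omega>. ennreal ((H \<omega> - G k \<omega>)\<^sup>2) \<partial>M) < \<top>" for k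
    using G(2)[of k] by (rule le_less_trans) simp
  ultimately have "subg u v (L * sqrt (v - u)) H" by (rule subg_L2_limit[OF G(1) Hm])
  then show ?thesis unfolding H_def[abs_def] .
qed

end

section \<open>Pathwise error analysis\<close>

lemma vector_derivative_lipschitz:
  fixes f :: "real \<Rightarrow> 'b::real_normed_vector"
  assumes "convex S" and f: "\<And>x. x \<in> S \<Longrightarrow> (f has_vector_derivative f' x) (at x within S)"
    and B: "\<And>x. x \<in> S \<Longrightarrow> norm (f' x) \<le> B" and xy: "x \<in> S" "y \<in> S"
  shows "norm (f x - f y) \<le> B * \<bar>x - y\<bar>"
proof -
  have "0 \<le> B" using B[OF xy(1)] norm_ge_zero order_trans by blast
  have "norm (f x - f y) \<le> B * norm (x - y)"
  proof (rule differentiable_bound[OF assms(1) _ _ xy])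
    show "(f has_derivative (\<lambda>h. h *\<^sub>R f' z)) (at z within S)" if "z \<in> S" for z
      using f[OF that] unfolding has_vector_derivative_def .
    show "onorm (\<lambda>h. h *\<^sub>R f' z) \<le> B" if "z \<in> S" for z
      using \<open>0 \<le> B\<close> B[OF that] by (intro onorm_bound) (auto simp: mult.commute[of B] mult_left_mono)
  qed
  then show ?thesis by simp
qed

lemma time_deriv_lipschitz:
  fixes f :: "real \<Rightarrow> 'b::real_normed_vector"
  assumes f: "f differentiable_on {p..q}" and pq: "p < q"
    and B: "\<And>t. t \<in> {p..q} \<Longrightarrow> norm (time_deriv {p..q} f t) \<le> B" and st: "s \<in> {p..q}" "t \<in> {p..q}"
  shows "norm (f s - f t) \<le> B * \<bar>s - t\<bar>"
proof (rule vector_derivative_lipschitz[OF _ _ B st])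
  show "(f has_vector_derivative time_deriv {p..q} f x) (at x within {p..q})" if "x \<in> {p..q}" for x
    using f that unfolding time_deriv_def differentiable_on_def
    by (auto simp: vector_derivative_works[symmetric])
qed auto

text \<open>The formula of \<open>space_deriv\<close> with time frozen, so that estimates for a
  single map of the space variable can be applied to its derivatives again.\<close>

definition partial_deriv :: "'d::finite \<Rightarrow> (real^'d \<Rightarrow> real^'d) \<Rightarrow> real^'d \<Rightarrow> real^'d" where
  "partial_deriv q g x = vector_derivative (\<lambda>u. g (x + u *\<^sub>R axis q 1)) (at 0)"

text \<open>Differentiability is given at parameter 0 for every base point; shifting the base point
  turns this into a derivative along the whole line.\<close>

lemma partial_deriv_has_vector_derivative:
  fixes g :: "real^'d \<Rightarrow> real^'d"
  assumes "\<And>x. (\<lambda>u. g (x + u *\<^sub>R axis q 1)) differentiable (at 0)"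
  shows "((\<lambda>u. g (x + u *\<^sub>R axis q 1)) has_vector_derivative partial_deriv q g (x + u *\<^sub>R axis q 1)) (at u within S)"
proof -
  have "((\<lambda>u'. g ((x + u *\<^sub>R axis q 1) + u' *\<^sub>R axis q 1)) has_vector_derivative partial_deriv q g (x + u *\<^sub>R axis q 1)) (at 0)"
    using assms[of "x + u *\<^sub>R axis q 1"] unfolding partial_deriv_def by (simp add: vector_derivative_works)
  then have "(((\<lambda>u'. g ((x + u *\<^sub>R axis q 1) + u' *\<^sub>R axis q 1)) \<circ> (\<lambda>y. y - u)) has_vector_derivative 1 *\<^sub>R partial_deriv q g (x + u *\<^sub>R axis q 1)) (at u)"
    by (intro vector_diff_chain_at) (auto intro!: derivative_eq_intros)
  moreover have "(\<lambda>u'. g ((x + u *\<^sub>R axis q 1) + u' *\<^sub>R axis q 1)) \<circ> (\<lambda>y. y - u) = (\<lambda>u. g (x + u *\<^sub>R axis q 1))"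
    by (auto simp: fun_eq_iff algebra_simps)
  ultimately show ?thesis by (simp add: has_vector_derivative_at_within)
qed

text \<open>Coordinates are changed one at a time, each by the mean value inequality along an axis;
  the induction over the set of changed coordinates avoids total derivatives.\<close>

lemma partial_lipschitz:
  fixes g :: "real^'d \<Rightarrow> real^'d"
  assumes d: "\<And>q x. (\<lambda>u. g (x + u *\<^sub>R axis q 1)) differentiable (at 0)"
    and B: "\<And>q x. norm (partial_deriv q g x) \<le> B" and S: "finite S"
  shows "norm (g (x + (\<Sum>q\<in>S. v q *\<^sub>R axis q 1)) - g x) \<le> B * (\<Sum>q\<in>S. \<bar>v q\<bar>)"
  using S
proof (induction S)
  case (insert r S)
  let ?y = "x + (\<Sum>q\<in>S. v q *\<^sub>R axis q 1)"
  have "norm (g (?y + v r *\<^sub>R axis r 1) - g (?y + 0 *\<^sub>R axis r 1)) \<le> B * \<bar>v r - 0\<bar>"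
    by (rule vector_derivative_lipschitz[where S=UNIV and f="\<lambda>u. g (?y + u *\<^sub>R axis r 1)"
          and f'="\<lambda>u. partial_deriv r g (?y + u *\<^sub>R axis r 1)"])
      (auto intro: partial_deriv_has_vector_derivative d B)
  then have "norm (g (?y + v r *\<^sub>R axis r 1) - g ?y) \<le> B * \<bar>v r\<bar>" by simp
  then have "norm ((g (?y + v r *\<^sub>R axis r 1) - g ?y) + (g ?y - g x)) \<le> B * \<bar>v r\<bar> + B * (\<Sum>q\<in>S. \<bar>v q\<bar>)"
    using insert.IH by (intro norm_triangle_le add_mono)
  then show ?case using insert.hyps by (simp add: algebra_simps)
qed simp

text \<open>Again one coordinate at a time. For the new coordinate \<open>r\<close> the linear term
  with slope \<open>partial_deriv r g x\<close> is subtracted before the mean value inequality is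
  applied; the remaining derivative is a difference of \<open>partial_deriv r g\<close> at two
  points, controlled by \<open>partial_lipschitz\<close>. Mixed derivatives are bounded but never
  interchanged.\<close>

lemma partial_taylor:
  fixes g :: "real^'d \<Rightarrow> real^'d"
  assumes d: "\<And>q x. (\<lambda>u. g (x + u *\<^sub>R axis q 1)) differentiable (at 0)"
    and d2: "\<And>q r x. (\<lambda>u. partial_deriv r g (x + u *\<^sub>R axis q 1)) differentiable (at 0)"
    and B: "\<And>q r x. norm (partial_deriv q (partial_deriv r g) x) \<le> B" and B0: "0 \<le> B" and S: "finite S"
  shows "norm (g (x + (\<Sum>q\<in>S. v q *\<^sub>R axis q 1)) - g x - (\<Sum>q\<in>S. v q *\<^sub>R partial_deriv q g x)) \<le> B * (\<Sum>q\<in>S. \<bar>v q\<bar>)\<^sup>2"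
  using S
proof (induction S)
  case (insert r S)
  let ?y = "x + (\<Sum>q\<in>S. v q *\<^sub>R axis q 1)" and ?s = "\<Sum>q\<in>S. \<bar>v q\<bar>"
  let ?f = "\<lambda>u. g (?y + u *\<^sub>R axis r 1) - u *\<^sub>R partial_deriv r g x"
  have pdl: "norm (partial_deriv r g (?y + u *\<^sub>R axis r 1) - partial_deriv r g x) \<le> B * (\<bar>v r\<bar> + ?s)" if "\<bar>u\<bar> \<le> \<bar>v r\<bar>" for u
  proof -
    \<comment> \<open>The intermediate point differs from \<open>x\<close> by \<open>u\<close> in
      coordinate \<open>r\<close> and by \<open>v\<close> in the coordinates of \<open>S\<close>,
      which is the update \<open>v(r := u)\<close> on \<open>insert r S\<close>.\<close>
    have "norm (partial_deriv r g (x + (\<Sum>q\<in>insert r S. (v(r := u)) q *\<^sub>R axis q 1)) - partial_deriv r g x)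
        \<le> B * (\<Sum>q\<in>insert r S. \<bar>(v(r := u)) q\<bar>)"
      by (rule partial_lipschitz) (use d2 B insert.hyps in auto)
    moreover have "(\<Sum>q\<in>S. (v(r := u)) q *\<^sub>R axis q (1::real)) = (\<Sum>q\<in>S. v q *\<^sub>R axis q 1)"
      "(\<Sum>q\<in>S. \<bar>(v(r := u)) q\<bar>) = ?s"
      using insert.hyps by (auto intro!: sum.cong)
    ultimately have "norm (partial_deriv r g (?y + u *\<^sub>R axis r 1) - partial_deriv r g x) \<le> B * (\<bar>u\<bar> + ?s)"
      using insert.hyps by (simp add: algebra_simps)
    also have "\<dots> \<le> B * (\<bar>v r\<bar> + ?s)" using that B0 by (intro mult_left_mono) auto
    finally show ?thesis .
  qed
  have "norm (?f (v r) - ?f 0) \<le> (B * (\<bar>v r\<bar> + ?s)) * \<bar>v r - 0\<bar>"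
  proof (rule vector_derivative_lipschitz[where S="{- \<bar>v r\<bar>..\<bar>v r\<bar>}" and f="?f"
          and f'="\<lambda>u. partial_deriv r g (?y + u *\<^sub>R axis r 1) - partial_deriv r g x"])
    fix u assume "u \<in> {- \<bar>v r\<bar>..\<bar>v r\<bar>}"
    then show "norm (partial_deriv r g (?y + u *\<^sub>R axis r 1) - partial_deriv r g x) \<le> B * (\<bar>v r\<bar> + ?s)" by (intro pdl) auto
    have "((\<lambda>u. u *\<^sub>R partial_deriv r g x) has_vector_derivative partial_deriv r g x) (at u within {- \<bar>v r\<bar>..\<bar>v r\<bar>})"
      by (auto intro!: derivative_eq_intros)
    then show "(?f has_vector_derivative partial_deriv r g (?y + u *\<^sub>R axis r 1) - partial_deriv r g x) (at u within {- \<bar>v r\<bar>..\<bar>v r\<bar>})"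
      by (intro has_vector_derivative_diff partial_deriv_has_vector_derivative d)
  qed auto
  then have 1: "norm (g (?y + v r *\<^sub>R axis r 1) - v r *\<^sub>R partial_deriv r g x - g ?y) \<le> B * (\<bar>v r\<bar> + ?s) * \<bar>v r\<bar>" by simp
  have "norm ((g (?y + v r *\<^sub>R axis r 1) - v r *\<^sub>R partial_deriv r g x - g ?y)
      + (g ?y - g x - (\<Sum>q\<in>S. v q *\<^sub>R partial_deriv q g x))) \<le> B * (\<bar>v r\<bar> + ?s) * \<bar>v r\<bar> + B * ?s\<^sup>2"
    by (intro norm_triangle_le add_mono 1 insert.IH)
  also have "\<dots> \<le> B * (\<bar>v r\<bar> + ?s)\<^sup>2"
  proof -
    have s0: "0 \<le> ?s" by (intro sum_nonneg) auto
    \<comment> \<open>Of the mixed product \<open>\<bar>v r\<bar> * ?s\<close> one copy is used and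
      two are available.\<close>
    have "(\<bar>v r\<bar> + ?s) * \<bar>v r\<bar> + ?s\<^sup>2 \<le> (\<bar>v r\<bar> + ?s)\<^sup>2"
      using s0 by (simp add: power2_eq_square algebra_simps)
    then have "B * ((\<bar>v r\<bar> + ?s) * \<bar>v r\<bar> + ?s\<^sup>2) \<le> B * (\<bar>v r\<bar> + ?s)\<^sup>2" using B0 by (rule mult_left_mono)
    then show ?thesis by (simp add: algebra_simps)
  qed
  finally show ?case using insert.hyps by (simp add: algebra_simps)
qed simp

lemma taylor2:
  fixes g :: "real^'d \<Rightarrow> real^'d"
  assumes d: "\<And>q x. (\<lambda>u. g (x + u *\<^sub>R axis q 1)) differentiable (at 0)"
    and d2: "\<And>q r x. (\<lambda>u. partial_deriv r g (x + u *\<^sub>R axis q 1)) differentiable (at 0)"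
    and B: "\<And>q r x. norm (partial_deriv q (partial_deriv r g) x) \<le> B" and B0: "0 \<le> B"
  shows "norm (g (x + v) - g x - (\<Sum>q\<in>UNIV. (v $ q) *\<^sub>R partial_deriv q g x)) \<le> B * (real CARD('d))\<^sup>2 * (norm v)\<^sup>2"
proof -
  have e: "(\<Sum>q\<in>UNIV. (v $ q) *\<^sub>R axis q 1) = v"
    using basis_expansion[of v] by (simp add: scalar_mult_eq_scaleR)
  have "(\<Sum>q\<in>UNIV. \<bar>v $ q\<bar>) \<le> (\<Sum>q\<in>(UNIV::'d set). norm v)"
    by (intro sum_mono component_le_norm_cart)
  then have l: "(\<Sum>q\<in>UNIV. \<bar>v $ q\<bar>) \<le> real CARD('d) * norm v" by simp
  have "norm (g (x + v) - g x - (\<Sum>q\<in>UNIV. (v $ q) *\<^sub>R partial_deriv q g x)) \<le> B * (\<Sum>q\<in>UNIV. \<bar>v $ q\<bar>)\<^sup>2"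
    using partial_taylor[OF d d2 B B0, of UNIV x "\<lambda>q. v $ q"] unfolding e by simp
  also have "\<dots> \<le> B * (real CARD('d) * norm v)\<^sup>2"
    using B0 l by (intro mult_left_mono power_mono) (auto intro: sum_nonneg)
  finally show ?thesis by (simp add: power_mult_distrib)
qed

section \<open>Gronwall inequalities\<close>

text \<open>The induction runs on the majorant with \<open>K\<close> and the sum, not on
  \<open>e\<close>: in each step the majorant grows by at most
  \<open>1 + l n \<le> exp (l n)\<close>.\<close>

lemma discrete_gronwall:
  fixes e l :: "nat \<Rightarrow> real"
  assumes e: "\<And>n. n \<le> N \<Longrightarrow> e n \<le> K + (\<Sum>j<n. l j * e j)" and l: "\<And>j. 0 \<le> l j" and n: "n \<le> N" and K: "0 \<le> K"
  shows "e n \<le> K * exp (\<Sum>j<n. l j)"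
proof -
  have "K + (\<Sum>j<n. l j * e j) \<le> K * exp (\<Sum>j<n. l j)" using n
  proof (induction n)
    case (Suc n)
    then have IH: "K + (\<Sum>j<n. l j * e j) \<le> K * exp (\<Sum>j<n. l j)" by simp
    have "K + (\<Sum>j<Suc n. l j * e j) = (K + (\<Sum>j<n. l j * e j)) + l n * e n" by simp
    also have "\<dots> \<le> (K + (\<Sum>j<n. l j * e j)) + l n * (K + (\<Sum>j<n. l j * e j))"
      using e[of n] l[of n] Suc.prems by (intro add_left_mono mult_left_mono) auto
    also have "\<dots> = (1 + l n) * (K + (\<Sum>j<n. l j * e j))" by (simp add: algebra_simps)
    also have "\<dots> \<le> exp (l n) * (K * exp (\<Sum>j<n. l j))"
    proof (rule order_trans[OF mult_left_mono[OF IH] mult_right_mono])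
      show "0 \<le> 1 + l n" using l[of n] by simp
      show "1 + l n \<le> exp (l n)" by (rule exp_ge_add_one_self)
      show "0 \<le> K * exp (\<Sum>j<n. l j)" using K by simp
    qed
    finally show ?case by (simp add: exp_add mult_ac)
  qed simp
  then show ?thesis using e[OF n] by linarith
qed

text \<open>The function is measured against the weight \<open>exp (2 * c * (t - t0))\<close>. With
  the rate \<open>2 * c\<close> the integral term takes at most half of the weighted maximum
  \<open>m\<close>, which is then absorbed; this explains the factor 2 and the doubled rate.\<close>

lemma integral_gronwall:
  fixes \<psi> :: "real \<Rightarrow> real"
  assumes tT: "t0 \<le> T" and c: "0 < c" and cont: "continuous_on {t0..T} \<psi>"
    and b: "\<And>t. t \<in> {t0..T} \<Longrightarrow> \<psi> t \<le> K + c * integral {t0..t} \<psi>" and K: "0 \<le> K" and s: "s \<in> {t0..T}"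
  shows "\<psi> s \<le> 2 * K * exp (2 * c * (T - t0))"
proof -
  let ?g = "\<lambda>t. exp (- (2 * c * (t - t0))) * \<psi> t"
  have "continuous_on {t0..T} ?g" using cont by (intro continuous_intros)
  then obtain t where t: "t \<in> {t0..T}" and max: "\<And>r. r \<in> {t0..T} \<Longrightarrow> ?g r \<le> ?g t"
    using continuous_attains_sup[of "{t0..T}" ?g] tT by auto
  define m where "m = max 0 (?g t)"
  have psi: "\<psi> r \<le> m * exp (2 * c * (r - t0))" if "r \<in> {t0..T}" for r
  proof -
    have "\<psi> r = ?g r * exp (2 * c * (r - t0))" by (simp add: exp_minus)
    also have "\<dots> \<le> m * exp (2 * c * (r - t0))" using max[OF that] by (intro mult_right_mono) (auto simp: m_def)
    finally show ?thesis .
  qed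
  have hi: "((\<lambda>r. m * exp (2 * c * (r - t0))) has_integral
      (m / (2 * c) * exp (2 * c * (t - t0)) - m / (2 * c) * exp (2 * c * (t0 - t0)))) {t0..t}"
    using t c by (intro fundamental_theorem_of_calculus)
      (auto intro!: derivative_eq_intros simp: has_real_derivative_iff_has_vector_derivative[symmetric])
  have "m \<le> 2 * K"
  proof (cases "0 \<le> ?g t")
    case True
    then have m: "m = ?g t" by (simp add: m_def)
    have "integral {t0..t} \<psi> \<le> integral {t0..t} (\<lambda>r. m * exp (2 * c * (r - t0)))"
      using t hi psi by (intro integral_le integrable_continuous_interval continuous_on_subset[OF cont])
        (auto intro!: continuous_intros)
    also have "\<dots> = m / (2 * c) * exp (2 * c * (t - t0)) - m / (2 * c)"
      using integral_unique[OF hi] by simp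
    also have "\<dots> \<le> m / (2 * c) * exp (2 * c * (t - t0))" using c by (simp add: m_def)
    finally have "c * integral {t0..t} \<psi> \<le> c * (m / (2 * c) * exp (2 * c * (t - t0)))"
      using c by (intro mult_left_mono) auto
    also have "\<dots> = m * exp (2 * c * (t - t0)) / 2" using c by simp
    finally have "\<psi> t \<le> K + m * exp (2 * c * (t - t0)) / 2" using b[OF t] by linarith
    moreover have "\<psi> t = m * exp (2 * c * (t - t0))" unfolding m by (simp add: exp_minus)
    ultimately have "m * exp (2 * c * (t - t0)) \<le> 2 * K" by linarith
    moreover have "m * 1 \<le> m * exp (2 * c * (t - t0))" using t c by (intro mult_left_mono) (auto simp: m_def)
    ultimately show ?thesis by linarith
  qed (use K in \<open>simp add: m_def\<close>)
  have "\<psi> s \<le> m * exp (2 * c * (s - t0))" using psi[OF s] .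
  also have "\<dots> \<le> (2 * K) * exp (2 * c * (T - t0))"
    using \<open>m \<le> 2 * K\<close> s c K by (intro mult_mono) (auto simp: m_def)
  finally show ?thesis .
qed

section \<open>Solvability and stability of the stage equations\<close>

text \<open>The stages are a definite description, so nothing can be derived before the equations
  are known to be uniquely solvable. For \<open>c * S * h \<le> 1 / 2\<close> the stage map is a
  contraction with factor \<open>1 / 2\<close>, and the same factor absorbs the implicit terms in
  both estimates. The second estimate later yields continuity in \<open>y\<close> and with it the
  measurability of the scheme.\<close>

lemma srk_stages_props:
  fixes a :: "real \<Rightarrow> real^'d \<Rightarrow> real^'d" and A0 :: "real^'s^'s" and c0 :: "real^'s"
  assumes lip: "\<And>j x y. norm (a (t + c0 $ j * h) x - a (t + c0 $ j * h) y) \<le> c * norm (x - y)"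
    and growth: "\<And>j x. norm (a (t + c0 $ j * h) x) \<le> c * (1 + norm x)"
    and c: "0 \<le> c" and h: "0 \<le> h"
    and S: "S = (\<Sum>i\<in>UNIV. \<Sum>j\<in>UNIV. \<bar>A0 $ i $ j\<bar>)" "c * S * h \<le> 1 / 2"
  shows "norm (srk_stages a A0 c0 t h y $ i - y) \<le> 2 * S * c * h * (1 + norm y)"
    and "norm (srk_stages a A0 c0 t h y - srk_stages a A0 c0 t h y') \<le> 2 * real CARD('s) * norm (y - y')"
proof -
  define \<Phi> where "\<Phi> y H = (\<chi> i. y + (\<Sum>j\<in>UNIV. (A0 $ i $ j * h) *\<^sub>R a (t + c0 $ j * h) (H $ j)))"
    for y and H :: "(real^'d)^'s"
  have nsum: "norm H \<le> (\<Sum>i\<in>UNIV. norm (H $ i))" for H :: "(real^'d)^'s"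
    unfolding norm_vec_def by (rule L2_set_le_sum) auto
  have S0: "0 \<le> S" unfolding S(1) by (intro sum_nonneg) auto
  have Srow: "(\<Sum>j\<in>UNIV. \<bar>A0 $ i $ j\<bar>) \<le> S" for i
    unfolding S(1) by (rule member_le_sum) (auto intro: sum_nonneg)
  have contr: "norm (\<Phi> y H - \<Phi> y H') \<le> 1 / 2 * norm (H - H')" for y H H'
  proof -
    have "norm ((\<Phi> y H - \<Phi> y H') $ i) \<le> (\<Sum>j\<in>UNIV. \<bar>A0 $ i $ j\<bar>) * (c * h * norm (H - H'))" for i
    proof -
      have "(\<Phi> y H - \<Phi> y H') $ i
          = (\<Sum>j\<in>UNIV. (A0 $ i $ j * h) *\<^sub>R (a (t + c0 $ j * h) (H $ j) - a (t + c0 $ j * h) (H' $ j)))"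
        by (simp add: \<Phi>_def sum_subtractf scaleR_diff_right)
      also have "norm \<dots> \<le> (\<Sum>j\<in>UNIV. \<bar>A0 $ i $ j\<bar> * (c * h * norm (H - H')))"
      proof (intro sum_norm_le)
        fix j
        have "norm (a (t + c0 $ j * h) (H $ j) - a (t + c0 $ j * h) (H' $ j)) \<le> c * norm (H $ j - H' $ j)"
          by (rule lip)
        also have "\<dots> \<le> c * norm (H - H')"
          using c Finite_Cartesian_Product.norm_nth_le[of "H - H'" j] by (intro mult_left_mono) simp_all
        finally have "\<bar>A0 $ i $ j * h\<bar> * norm (a (t + c0 $ j * h) (H $ j) - a (t + c0 $ j * h) (H' $ j))
            \<le> \<bar>A0 $ i $ j * h\<bar> * (c * norm (H - H'))" by (rule mult_left_mono) simp
        then show "norm ((A0 $ i $ j * h) *\<^sub>R (a (t + c0 $ j * h) (H $ j) - a (t + c0 $ j * h) (H' $ j)))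
            \<le> \<bar>A0 $ i $ j\<bar> * (c * h * norm (H - H'))"
          using h by (simp add: abs_mult mult_ac)
      qed
      finally show ?thesis by (simp add: sum_distrib_right)
    qed
    then have "norm (\<Phi> y H - \<Phi> y H') \<le> (\<Sum>i\<in>UNIV. (\<Sum>j\<in>UNIV. \<bar>A0 $ i $ j\<bar>) * (c * h * norm (H - H')))"
      by (intro order_trans[OF nsum] sum_mono)
    also have "\<dots> = c * S * h * norm (H - H')" unfolding S(1) sum_distrib_right[symmetric] by (simp add: mult_ac)
    also have "\<dots> \<le> 1 / 2 * norm (H - H')" using S(2) by (intro mult_right_mono) auto
    finally show ?thesis .
  qed
  have ex1: "\<exists>!H. \<Phi> y H = H" for y
  proof (rule banach_fix_type[of "1 / 2"])
    show "\<forall>x z. dist (\<Phi> y x) (\<Phi> y z) \<le> 1 / 2 * dist x z" unfolding dist_norm using contr by blast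
  qed auto
  have iff: "\<Phi> y H = H \<longleftrightarrow> (\<forall>i. H $ i = y + (\<Sum>j\<in>UNIV. (A0 $ i $ j * h) *\<^sub>R a (t + c0 $ j * h) (H $ j)))" for y H
    unfolding \<Phi>_def vec_eq_iff by auto
  have fixp: "\<Phi> y (srk_stages a A0 c0 t h y) = srk_stages a A0 c0 t h y" for y
    unfolding srk_stages_def iff[symmetric] by (rule theI'[OF ex1])
  let ?H = "srk_stages a A0 c0 t h"
  \<comment> \<open>The stage farthest from \<open>y\<close> is estimated in terms of itself: at
    most half of \<open>m\<close> returns on the right-hand side.\<close>
  define m where "m = Max (range (\<lambda>i. norm (?H y $ i - y)))"
  have mi: "norm (?H y $ i - y) \<le> m" for i unfolding m_def by (intro Max_ge) auto
  have "m \<in> range (\<lambda>i. norm (?H y $ i - y))" unfolding m_def by (intro Max_in) auto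
  then obtain k where k: "m = norm (?H y $ k - y)" by auto
  have m0: "0 \<le> m" unfolding k by simp
  have "?H y $ k = \<Phi> y (?H y) $ k" unfolding fixp ..
  then have "?H y $ k - y = (\<Sum>j\<in>UNIV. (A0 $ k $ j * h) *\<^sub>R a (t + c0 $ j * h) (?H y $ j))"
    by (simp add: \<Phi>_def)
  also have "norm \<dots> \<le> (\<Sum>j\<in>UNIV. \<bar>A0 $ k $ j\<bar> * (h * c * (1 + norm y + m)))"
  proof (intro sum_norm_le)
    fix j
    have "norm (?H y $ j) \<le> norm y + m" using mi[of j] norm_triangle_sub[of "?H y $ j" y] by linarith
    then have "c * (1 + norm (?H y $ j)) \<le> c * (1 + norm y + m)" using c by (intro mult_left_mono) auto
    then have "norm (a (t + c0 $ j * h) (?H y $ j)) \<le> c * (1 + norm y + m)"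
      using growth[of j "?H y $ j"] by linarith
    then have "\<bar>A0 $ k $ j * h\<bar> * norm (a (t + c0 $ j * h) (?H y $ j)) \<le> \<bar>A0 $ k $ j * h\<bar> * (c * (1 + norm y + m))"
      by (rule mult_left_mono) simp
    then show "norm ((A0 $ k $ j * h) *\<^sub>R a (t + c0 $ j * h) (?H y $ j)) \<le> \<bar>A0 $ k $ j\<bar> * (h * c * (1 + norm y + m))"
      using h by (simp add: abs_mult mult_ac)
  qed
  also have "\<dots> = (\<Sum>j\<in>UNIV. \<bar>A0 $ k $ j\<bar>) * (h * c * (1 + norm y + m))" by (simp add: sum_distrib_right)
  also have "\<dots> \<le> S * (h * c * (1 + norm y + m))"
    using Srow h c m0 by (intro mult_right_mono) auto
  also have "\<dots> = S * h * c * (1 + norm y) + c * S * h * m" by (simp add: algebra_simps)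
  also have "\<dots> \<le> S * h * c * (1 + norm y) + 1 / 2 * m" using S(2) m0 by (intro add_left_mono mult_right_mono)
  finally have "m \<le> 2 * (S * h * c * (1 + norm y))" unfolding k[symmetric] by linarith
  then show "norm (?H y $ i - y) \<le> 2 * S * c * h * (1 + norm y)" using mi[of i] by (simp add: mult_ac)
  \<comment> \<open>At the common argument \<open>?H y'\<close> the two stage maps differ by the
    constant \<open>y - y'\<close> in each of the \<open>CARD('s)\<close> components.\<close>
  have "?H y - ?H y' = (\<Phi> y (?H y) - \<Phi> y (?H y')) + (\<Phi> y (?H y') - \<Phi> y' (?H y'))"
    by (simp only: fixp) simp
  also have "norm \<dots> \<le> 1 / 2 * norm (?H y - ?H y') + real CARD('s) * norm (y - y')"
  proof (intro norm_triangle_le add_mono contr)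
    have "norm (\<Phi> y (?H y') - \<Phi> y' (?H y')) \<le> (\<Sum>i\<in>(UNIV::'s set). norm (y - y'))"
      by (rule order_trans[OF nsum]) (simp add: \<Phi>_def)
    then show "norm (\<Phi> y (?H y') - \<Phi> y' (?H y')) \<le> real CARD('s) * norm (y - y')" by simp
  qed
  finally show "norm (?H y - ?H y') \<le> 2 * real CARD('s) * norm (y - y')" by linarith
qed

section \<open>Regularity of the drift, and paths without their drift integral\<close>

locale additive_drift =
  fixes a :: "real \<Rightarrow> real^'d \<Rightarrow> real^'d" and t0 T c :: real
  assumes t0_T: "t0 < T" and c_pos: "0 < c" and C12: "C12_on {t0..T} a"
    and growth: "\<And>t x. t \<in> {t0..T} \<Longrightarrow> norm (a t x) \<le> c * (1 + norm x)"
    and lip: "\<And>t x y. t \<in> {t0..T} \<Longrightarrow> norm (a t x - a t y) \<le> c * norm (x - y)"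
    and space1: "\<And>t x q. t \<in> {t0..T} \<Longrightarrow> norm (space_deriv q a t x) \<le> c"
    and space2: "\<And>t x q r. t \<in> {t0..T} \<Longrightarrow> norm (space_deriv q (space_deriv r a) t x) \<le> c"
    and time1: "\<And>t x. t \<in> {t0..T} \<Longrightarrow> norm (time_deriv {t0..T} (\<lambda>s. a s x) t) \<le> c * (1 + norm x)"
begin

lemma space_deriv_partial: "space_deriv q a t = partial_deriv q (a t)"
  and space_deriv_partial2: "space_deriv q (space_deriv r a) t = partial_deriv q (partial_deriv r (a t))"
  unfolding space_deriv_def partial_deriv_def by auto

lemma drift_time:
  assumes "s \<in> {t0..T}" "t \<in> {t0..T}"
  shows "norm (a s x - a t x) \<le> c * (1 + norm x) * \<bar>s - t\<bar>"
proof (rule time_deriv_lipschitz[where f="\<lambda>s. a s x", OF _ t0_T _ assms])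
  show "(\<lambda>s. a s x) differentiable_on {t0..T}"
    using C12 unfolding C12_on_def by blast
qed (rule time1)

lemma drift_taylor:
  assumes "t \<in> {t0..T}"
  shows "norm (a t (x + v) - a t x - (\<Sum>q\<in>UNIV. (v $ q) *\<^sub>R space_deriv q a t x))
    \<le> c * (real CARD('d))\<^sup>2 * (norm v)\<^sup>2"
  unfolding space_deriv_partial
proof (rule taylor2)
  show "(\<lambda>u. a t (x + u *\<^sub>R axis q 1)) differentiable (at 0)" for q x
    using C12 assms unfolding C12_on_def by blast
  show "(\<lambda>u. partial_deriv r (a t) (x + u *\<^sub>R axis q 1)) differentiable (at 0)" for q r x
    using C12 assms unfolding C12_on_def space_deriv_partial by blast
  show "norm (partial_deriv q (partial_deriv r (a t)) x) \<le> c" for q r x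
    using space2[OF assms, of q r x] unfolding space_deriv_partial2 .
qed (use c_pos in simp)

lemma drift_continuous:
  assumes "continuous_on S x" "S \<subseteq> {t0..T}"
  shows "continuous_on S (\<lambda>s. a s (x s))"
proof -
  have "continuous_on ({t0..T} \<times> UNIV) (\<lambda>(t, x). a t x)" using C12 unfolding C12_on_def by blast
  then have "continuous_on S (\<lambda>s. (\<lambda>(t, x). a t x) (s, x s))"
    by (rule continuous_on_compose2) (use assms in \<open>auto intro!: continuous_intros\<close>)
  then show ?thesis by simp
qed

text \<open>Defined for a single path, so that the error analysis stays deterministic until moments
  are taken.\<close>

definition driftless :: "(real \<Rightarrow> real^'d) \<Rightarrow> real \<Rightarrow> real^'d" where
  "driftless x s = x s - integral {t0..s} (\<lambda>r. a r (x r))"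

lemma drift_integral_diff:
  assumes x: "continuous_on {t0..T} x" and uv: "t0 \<le> u" "u \<le> v" "v \<le> T"
  shows "integral {t0..v} (\<lambda>r. a r (x r)) - integral {t0..u} (\<lambda>r. a r (x r)) = integral {u..v} (\<lambda>r. a r (x r))"
proof -
  have "(\<lambda>r. a r (x r)) integrable_on {t0..v}"
    using uv by (intro integrable_continuous_interval drift_continuous continuous_on_subset[OF x]) auto
  from Henstock_Kurzweil_Integration.integral_combine[OF uv(1,2) this] show ?thesis by (simp add: algebra_simps)
qed

lemma driftless_diff:
  assumes "continuous_on {t0..T} x" "t0 \<le> u" "u \<le> v" "v \<le> T"
  shows "driftless x v - driftless x u = x v - x u - integral {u..v} (\<lambda>r. a r (x r))"
  using drift_integral_diff[OF assms] unfolding driftless_def by (simp add: algebra_simps)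

lemma driftless_continuous:
  assumes "continuous_on {t0..T} x"
  shows "continuous_on {t0..T} (driftless x)"
  unfolding driftless_def[abs_def] using assms t0_T
  by (intro continuous_on_diff indefinite_integral_continuous_1 integrable_continuous_interval drift_continuous) auto

text \<open>Gronwall along one path. The noise enters only through its largest excursion
  \<open>Q\<close>, so moments of the solution follow from those of \<open>Q\<close> and of the
  initial value.\<close>

lemma path_bound:
  assumes x: "continuous_on {t0..T} x"
    and Q: "\<And>s. s \<in> {t0..T} \<Longrightarrow> norm (driftless x s - driftless x t0) \<le> Q" and s: "s \<in> {t0..T}"
  shows "norm (x s) \<le> 2 * (norm (x t0) + Q + c * (T - t0)) * exp (2 * c * (T - t0))"
proof (rule integral_gronwall[where \<psi>="\<lambda>s. norm (x s)"])
  have "0 \<le> Q" using Q[of t0] t0_T by simp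
  then show "0 \<le> norm (x t0) + Q + c * (T - t0)" using c_pos t0_T by simp
  fix t assume t: "t \<in> {t0..T}"
  have cx: "continuous_on {t0..t} x" using x by (rule continuous_on_subset) (use t in auto)
  have "norm (integral {t0..t} (\<lambda>r. a r (x r))) \<le> integral {t0..t} (\<lambda>r. c * (1 + norm (x r)))"
    using t by (intro integral_norm_bound_integral integrable_continuous_interval drift_continuous[OF cx]
        growth continuous_intros cx) auto
  also have "\<dots> = c * (integral {t0..t} (\<lambda>r. 1) + integral {t0..t} (\<lambda>r. norm (x r)))"
    unfolding integral_mult_right
    by (subst Henstock_Kurzweil_Integration.integral_add)
      (auto intro!: integrable_continuous_interval continuous_intros cx)
  also have "\<dots> = c * (t - t0) + c * integral {t0..t} (\<lambda>r. norm (x r))"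
    using t by (simp add: algebra_simps)
  also have "\<dots> \<le> c * (T - t0) + c * integral {t0..t} (\<lambda>r. norm (x r))"
    using t c_pos by (intro add_right_mono mult_left_mono) auto
  finally have 1: "norm (integral {t0..t} (\<lambda>r. a r (x r))) \<le> c * (T - t0) + c * integral {t0..t} (\<lambda>r. norm (x r))" .
  have "x t = x t0 + (driftless x t - driftless x t0) + integral {t0..t} (\<lambda>r. a r (x r))"
    using driftless_diff[OF x, of t0 t] t by simp
  also have "norm \<dots> \<le> norm (x t0) + Q + (c * (T - t0) + c * integral {t0..t} (\<lambda>r. norm (x r)))"
    by (intro norm_triangle_le add_mono 1 Q[OF t] order_refl)
  finally show "norm (x t) \<le> (norm (x t0) + Q + c * (T - t0)) + c * integral {t0..t} (\<lambda>r. norm (x r))" by simp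
qed (use x s t0_T c_pos in \<open>auto intro!: continuous_intros\<close>)

end

section \<open>One-step errors and the pathwise error recursion\<close>

locale additive_srk = additive_drift a t0 T c
  for a :: "real \<Rightarrow> real^'d \<Rightarrow> real^'d" and t0 T c :: real +
  fixes \<alpha> c0 :: "real^'s" and A0 :: "real^'s^'s"
  assumes c0_range: "\<And>i. c0 $ i \<in> {0..1}" and \<alpha>_sum: "\<alpha> \<bullet> 1 = 1"
begin

definition A0_norm :: real where "A0_norm = (\<Sum>i\<in>UNIV. \<Sum>j\<in>UNIV. \<bar>A0 $ i $ j\<bar>)"

text \<open>A stage is displaced from \<open>y\<close> by at most
  \<open>2 * A0_norm * c * h * (1 + norm y)\<close>, and the Lipschitz bound of the drift adds
  another \<open>c\<close>; the second summand \<open>c\<close> is the cost of the time shift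
  \<open>c0 $ i * h \<le> h\<close>.\<close>

definition K_stage :: real where "K_stage = (\<Sum>i\<in>UNIV. \<bar>\<alpha> $ i\<bar>) * (2 * A0_norm * c\<^sup>2 + c)"

lemma A0_norm_nonneg: "0 \<le> A0_norm" unfolding A0_norm_def by (intro sum_nonneg) auto

lemma K_stage_nonneg: "0 \<le> K_stage"
  unfolding K_stage_def using A0_norm_nonneg c_pos by (intro mult_nonneg_nonneg sum_nonneg) auto

lemma c0_scaled:
  assumes "0 \<le> h"
  shows "0 \<le> c0 $ i * h" "c0 $ i * h \<le> h"
  using mult_right_mono[of "c0 $ i" 1 h] c0_range[of i] assms by auto

lemma stage_time:
  assumes "t0 \<le> t" "0 \<le> h" "t + h \<le> T"
  shows "t + c0 $ i * h \<in> {t0..T}"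
  using c0_scaled[OF assms(2), of i] assms by auto

lemma stages:
  assumes "t0 \<le> t" "0 \<le> h" "t + h \<le> T" and "c * A0_norm * h \<le> 1 / 2"
  shows "norm (srk_stages a A0 c0 t h y $ i - y) \<le> 2 * A0_norm * c * h * (1 + norm y)"
    and "norm (srk_stages a A0 c0 t h y - srk_stages a A0 c0 t h y') \<le> 2 * real CARD('s) * norm (y - y')"
  using c_pos assms(2,4)
  by (intro srk_stages_props lip growth stage_time[OF assms(1-3)] A0_norm_def; simp)+

text \<open>As \<alpha> sums to 1, the Euler term \<open>h *\<^sub>R a t y\<close> can be
  distributed over the stages. Each difference of drifts is then of order \<open>h\<close>, from the
  displacement of the stage and from the shift in time, and the prefactor supplies the second
  \<open>h\<close>.\<close>

lemma srk_drift_error: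
  assumes t: "t0 \<le> t" "0 \<le> h" "t + h \<le> T" and h: "c * A0_norm * h \<le> 1 / 2"
  shows "norm ((\<Sum>i\<in>UNIV. (\<alpha> $ i * h) *\<^sub>R a (t + c0 $ i * h) (srk_stages a A0 c0 t h y $ i)) - h *\<^sub>R a t y)
    \<le> K_stage * h\<^sup>2 * (1 + norm y)"
proof -
  let ?H = "srk_stages a A0 c0 t h y"
  have "(\<Sum>i\<in>UNIV. \<alpha> $ i) = 1" using \<alpha>_sum by (simp add: inner_vec_def)
  then have "(\<Sum>i\<in>UNIV. (\<alpha> $ i * h) *\<^sub>R a t y) = h *\<^sub>R a t y"
    by (simp add: scaleR_sum_left[symmetric] sum_distrib_right[symmetric])
  then have "(\<Sum>i\<in>UNIV. (\<alpha> $ i * h) *\<^sub>R a (t + c0 $ i * h) (?H $ i)) - h *\<^sub>R a t y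
     = (\<Sum>i\<in>UNIV. (\<alpha> $ i * h) *\<^sub>R (a (t + c0 $ i * h) (?H $ i) - a t y))"
    by (simp add: scaleR_diff_right sum_subtractf)
  also have "norm \<dots> \<le> (\<Sum>i\<in>UNIV. \<bar>\<alpha> $ i\<bar> * ((2 * A0_norm * c\<^sup>2 + c) * h\<^sup>2 * (1 + norm y)))"
  proof (intro sum_norm_le)
    fix i
    have st: "t + c0 $ i * h \<in> {t0..T}" using t by (rule stage_time)
    have tI: "t \<in> {t0..T}" using t by auto
    have "norm (a (t + c0 $ i * h) (?H $ i) - a (t + c0 $ i * h) y) \<le> c * norm (?H $ i - y)"
      by (rule lip[OF st])
    also have "\<dots> \<le> c * (2 * A0_norm * c * h * (1 + norm y))"
      using c_pos by (intro mult_left_mono stages(1)[OF t h]) auto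
    finally have 1: "norm (a (t + c0 $ i * h) (?H $ i) - a (t + c0 $ i * h) y) \<le> c * (2 * A0_norm * c * h * (1 + norm y))" .
    have "norm (a (t + c0 $ i * h) y - a t y) \<le> c * (1 + norm y) * \<bar>t + c0 $ i * h - t\<bar>"
      by (rule drift_time[OF st tI])
    also have "\<dots> \<le> c * (1 + norm y) * h"
    proof (rule mult_left_mono)
      show "\<bar>t + c0 $ i * h - t\<bar> \<le> h" using c0_scaled[OF t(2), of i] by simp
    qed (use c_pos in simp)
    finally have 2: "norm (a (t + c0 $ i * h) y - a t y) \<le> c * (1 + norm y) * h" .
    have "norm ((a (t + c0 $ i * h) (?H $ i) - a (t + c0 $ i * h) y) + (a (t + c0 $ i * h) y - a t y))
        \<le> c * (2 * A0_norm * c * h * (1 + norm y)) + c * (1 + norm y) * h"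
      by (intro norm_triangle_le add_mono 1 2)
    also have "\<dots> = (2 * A0_norm * c\<^sup>2 + c) * h * (1 + norm y)" by (simp add: algebra_simps power2_eq_square)
    finally have "norm (a (t + c0 $ i * h) (?H $ i) - a t y) \<le> (2 * A0_norm * c\<^sup>2 + c) * h * (1 + norm y)" by simp
    then have "\<bar>\<alpha> $ i * h\<bar> * norm (a (t + c0 $ i * h) (?H $ i) - a t y)
        \<le> \<bar>\<alpha> $ i * h\<bar> * ((2 * A0_norm * c\<^sup>2 + c) * h * (1 + norm y))" by (rule mult_left_mono) simp
    then show "norm ((\<alpha> $ i * h) *\<^sub>R (a (t + c0 $ i * h) (?H $ i) - a t y))
        \<le> \<bar>\<alpha> $ i\<bar> * ((2 * A0_norm * c\<^sup>2 + c) * h\<^sup>2 * (1 + norm y))"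
      using t(2) by (simp add: abs_mult power2_eq_square mult_ac)
  qed
  also have "\<dots> = K_stage * h\<^sup>2 * (1 + norm y)"
    unfolding K_stage_def by (simp add: sum_distrib_right[symmetric] mult_ac)
  finally show ?thesis .
qed

definition srk_drift :: "real \<Rightarrow> real \<Rightarrow> real^'d \<Rightarrow> real^'d" where
  "srk_drift t h y = (\<Sum>i\<in>UNIV. (\<alpha> $ i * h) *\<^sub>R a (t + c0 $ i * h) (srk_stages a A0 c0 t h y $ i))"

text \<open>The conditionally centred part of the one-step error, where \<open>w\<close> is the noise
  contribution of the scheme; the rest of the one-step error is controlled pathwise.\<close>

definition one_step_martingale :: "(real \<Rightarrow> real^'d) \<Rightarrow> real^'d \<Rightarrow> real \<Rightarrow> real \<Rightarrow> real^'d" where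
  "one_step_martingale x w u v =
     (\<Sum>q\<in>UNIV. integral {u..v} (\<lambda>s. (driftless x s - driftless x u) $ q) *\<^sub>R space_deriv q a u (x u))
     + (driftless x v - driftless x u - w)"

text \<open>The Taylor expansion is made along the driftless increment: the state \<open>x s\<close>
  differs from \<open>x u\<close> plus that increment by a drift integral of order
  \<open>v - u\<close>, which only feeds the remainder, and the linear term left over is the one in
  \<open>one_step_martingale\<close>. The vector \<open>w\<close> can be arbitrary since it cancels
  against its copy in that term.\<close>

lemma local_error:
  assumes x: "continuous_on {t0..T} x" and uv: "t0 \<le> u" "u \<le> v" "v \<le> T"
    and h: "c * A0_norm * (v - u) \<le> 1 / 2"
    and B: "\<And>s. s \<in> {u..v} \<Longrightarrow> norm (x s) \<le> B"
    and Q: "\<And>s. s \<in> {u..v} \<Longrightarrow> norm (driftless x s - driftless x u) \<le> Q"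
  shows "norm (x v - x u - (v - u) *\<^sub>R (a u (x u) - a u y) - srk_drift u (v - u) y - w - one_step_martingale x w u v)
    \<le> (v - u)\<^sup>2 * (c + c\<^sup>2) * (1 + B) + c * (real CARD('d))\<^sup>2 * ((v - u) * Q\<^sup>2) + K_stage * (v - u)\<^sup>2 * (1 + norm y)"
proof -
  let ?z = "driftless x"
  let ?h = "v - u"
  let ?P = "\<lambda>s. \<Sum>q\<in>UNIV. ((?z s - ?z u) $ q) *\<^sub>R space_deriv q a u (x u)"
  let ?E = "(c + c\<^sup>2) * (1 + B) * ?h + c * (real CARD('d))\<^sup>2 * Q\<^sup>2"
  have u: "u \<in> {t0..T}" and sub: "{u..v} \<subseteq> {t0..T}" using uv by auto
  have cx: "continuous_on {u..v} x" and cz: "continuous_on {u..v} ?z"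
    using x driftless_continuous[OF x] sub by (auto intro: continuous_on_subset)
  have ca: "continuous_on {u..v} (\<lambda>s. a s (x s))" by (rule drift_continuous[OF cx sub])
  have cV: "continuous_on {u..v} (\<lambda>s. (?z s - ?z u) $ q)" for q
    by (intro continuous_intros cz)
  have cP: "continuous_on {u..v} ?P" by (intro continuous_intros cV)
  have B0: "0 \<le> B" using B[of u] uv norm_ge_zero order_trans by (metis atLeastAtMost_iff order_refl)
  have pw: "norm (a s (x s) - a u (x u) - ?P s) \<le> ?E" if s: "s \<in> {u..v}" for s
  proof -
    have sI: "s \<in> {t0..T}" using s sub by auto
    have xs: "c * (1 + norm (x r)) \<le> c * (1 + B)" if "r \<in> {u..v}" for r
      using B[OF that] c_pos by (intro mult_left_mono) auto
    have "norm (a s (x s) - a u (x s)) \<le> c * (1 + norm (x s)) * \<bar>s - u\<bar>" by (rule drift_time[OF sI u])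
    also have "\<dots> \<le> c * (1 + B) * ?h" using xs[OF s] s c_pos B0 by (intro mult_mono) auto
    finally have 1: "norm (a s (x s) - a u (x s)) \<le> c * (1 + B) * ?h" .
    have "x s - (x u + (?z s - ?z u)) = integral {u..s} (\<lambda>r. a r (x r))"
      using driftless_diff[OF x uv(1), of s] s uv by simp
    moreover have "norm (integral {u..s} (\<lambda>r. a r (x r))) \<le> (c * (1 + B)) * (s - u)"
    proof (rule integral_bound)
      show "continuous_on {u..s} (\<lambda>r. a r (x r))" using ca by (rule continuous_on_subset) (use s in auto)
      show "norm (a r (x r)) \<le> c * (1 + B)" if "r \<in> {u..s}" for r
        using growth[of r "x r"] xs[of r] that s sub by force
    qed (use s in simp)
    moreover have "(c * (1 + B)) * (s - u) \<le> (c * (1 + B)) * ?h"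
      using s c_pos B0 by (intro mult_left_mono) auto
    ultimately have "norm (x s - (x u + (?z s - ?z u))) \<le> c * (1 + B) * ?h" by simp
    then have "c * norm (x s - (x u + (?z s - ?z u))) \<le> c * (c * (1 + B) * ?h)"
      using c_pos by (intro mult_left_mono) auto
    then have 2: "norm (a u (x s) - a u (x u + (?z s - ?z u))) \<le> c * (c * (1 + B) * ?h)"
      using lip[OF u, of "x s" "x u + (?z s - ?z u)"] by linarith
    have "norm (a u (x u + (?z s - ?z u)) - a u (x u) - ?P s) \<le> c * (real CARD('d))\<^sup>2 * (norm (?z s - ?z u))\<^sup>2"
      by (rule drift_taylor[OF u])
    also have "\<dots> \<le> c * (real CARD('d))\<^sup>2 * Q\<^sup>2"
      using Q[OF s] c_pos by (intro mult_left_mono power_mono) auto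
    finally have 3: "norm (a u (x u + (?z s - ?z u)) - a u (x u) - ?P s) \<le> c * (real CARD('d))\<^sup>2 * Q\<^sup>2" .
    \<comment> \<open>Three replacements are added up: freezing the time, dropping the drift part of
      the increment, and expanding to first order.\<close>
    have "norm ((a s (x s) - a u (x s)) + (a u (x s) - a u (x u + (?z s - ?z u)))
        + (a u (x u + (?z s - ?z u)) - a u (x u) - ?P s))
      \<le> c * (1 + B) * ?h + c * (c * (1 + B) * ?h) + c * (real CARD('d))\<^sup>2 * Q\<^sup>2"
      by (intro norm_triangle_le add_mono 1 2 3)
    moreover have "c * (1 + B) * ?h + c * (c * (1 + B) * ?h) = (c + c\<^sup>2) * (1 + B) * ?h"
      by (simp add: algebra_simps power2_eq_square)
    moreover have tele: "(p - q) + (q - r) + (r - k - l) = p - k - l" for p q r k l :: "real^'d" by simp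
    ultimately show ?thesis unfolding tele by linarith
  qed
  have "norm (integral {u..v} (\<lambda>s. a s (x s) - a u (x u) - ?P s)) \<le> ?E * (v - u)"
    by (rule integral_bound[OF uv(2) _ pw]) (intro continuous_intros ca cP, auto)
  moreover have "integral {u..v} (\<lambda>s. a s (x s) - a u (x u) - ?P s)
      = integral {u..v} (\<lambda>s. a s (x s)) - ?h *\<^sub>R a u (x u)
        - (\<Sum>q\<in>UNIV. integral {u..v} (\<lambda>s. (?z s - ?z u) $ q) *\<^sub>R space_deriv q a u (x u))"
  proof -
    have i: "(\<lambda>s. a s (x s)) integrable_on {u..v}" "(\<lambda>s. a u (x u)) integrable_on {u..v}" "?P integrable_on {u..v}"
      "\<And>q. (\<lambda>s. (?z s - ?z u) $ q) integrable_on {u..v}"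
      using ca cP cV by (auto intro: integrable_continuous_interval)
    have iq: "((\<lambda>s. ((?z s - ?z u) $ q) *\<^sub>R space_deriv q a u (x u)) has_integral
        integral {u..v} (\<lambda>s. (?z s - ?z u) $ q) *\<^sub>R space_deriv q a u (x u)) {u..v}" for q
      by (rule has_integral_scaleR_left) (use i(4) in \<open>rule integrable_integral\<close>)
    have "(?P has_integral (\<Sum>q\<in>UNIV. integral {u..v} (\<lambda>s. (?z s - ?z u) $ q) *\<^sub>R space_deriv q a u (x u))) {u..v}"
      by (intro has_integral_sum iq) auto
    moreover have "((\<lambda>s. a u (x u)) has_integral ?h *\<^sub>R a u (x u)) {u..v}"
      using has_integral_const_real[of "a u (x u)" u v] uv by simp
    ultimately show ?thesis
      using integrable_integral[OF i(1)] by (intro integral_unique has_integral_diff)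
  qed
  ultimately have 4: "norm (integral {u..v} (\<lambda>s. a s (x s)) - ?h *\<^sub>R a u (x u)
        - (\<Sum>q\<in>UNIV. integral {u..v} (\<lambda>s. (?z s - ?z u) $ q) *\<^sub>R space_deriv q a u (x u))) \<le> ?E * ?h" by simp
  have "norm (srk_drift u ?h y - ?h *\<^sub>R a u y) \<le> K_stage * ?h\<^sup>2 * (1 + norm y)"
    unfolding srk_drift_def by (rule srk_drift_error) (use uv h in auto)
  then have 5: "norm (?h *\<^sub>R a u y - srk_drift u ?h y) \<le> K_stage * ?h\<^sup>2 * (1 + norm y)"
    by (simp add: norm_minus_commute)
  have "x v - x u - ?h *\<^sub>R (a u (x u) - a u y) - srk_drift u ?h y - w - one_step_martingale x w u v
    = (integral {u..v} (\<lambda>s. a s (x s)) - ?h *\<^sub>R a u (x u)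
        - (\<Sum>q\<in>UNIV. integral {u..v} (\<lambda>s. (?z s - ?z u) $ q) *\<^sub>R space_deriv q a u (x u)))
      + (?h *\<^sub>R a u y - srk_drift u ?h y)"
    unfolding one_step_martingale_def driftless_diff[OF x uv(1,2,3)] by (simp add: algebra_simps)
  also have "norm \<dots> \<le> ?E * ?h + K_stage * ?h\<^sup>2 * (1 + norm y)"
    by (intro norm_triangle_le add_mono 4 5)
  also have "?E * ?h = ?h\<^sup>2 * (c + c\<^sup>2) * (1 + B) + c * (real CARD('d))\<^sup>2 * (?h * Q\<^sup>2)"
    by (simp add: algebra_simps power2_eq_square)
  finally show ?thesis .
qed

text \<open>The exponential is the Gronwall factor; the other factor dominates the constants of all
  remainders, its 1 covering the bound \<open>m\<close> for the centred sums.\<close>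

definition K_path :: real where
  "K_path = exp ((c + K_stage) * (T - t0)) * (1 + c + c\<^sup>2 + K_stage + c * (real CARD('d))\<^sup>2)"

text \<open>The error is telescoped, and the terms \<open>one_step_martingale\<close> are split off
  and summed before norms are taken, so that their cancellation survives in \<open>m\<close>. Only
  the rest enters the Gronwall sum. Everything is deterministic here; \<open>B\<close>,
  \<open>Q\<close> and \<open>m\<close> become random later.\<close>

lemma pathwise_error:
  fixes \<tau> :: "nat \<Rightarrow> real"
  assumes x: "continuous_on {t0..T} x" and g: "grid t0 T N \<tau>"
    and h: "\<And>n. n < N \<Longrightarrow> \<tau> (Suc n) - \<tau> n \<le> h" "h \<le> 1" "c * A0_norm * h \<le> 1 / 2"
    and y0: "y 0 = x t0"
    and y: "\<And>n. n < N \<Longrightarrow> y (Suc n) = y n + srk_drift (\<tau> n) (\<tau> (Suc n) - \<tau> n) (y n) + w n"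
    and B: "\<And>s. s \<in> {t0..T} \<Longrightarrow> norm (x s) \<le> B"
    and Q: "\<And>n s. n < N \<Longrightarrow> s \<in> {\<tau> n..\<tau> (Suc n)} \<Longrightarrow> norm (driftless x s - driftless x (\<tau> n)) \<le> Q n"
    and m: "\<And>n. n \<le> N \<Longrightarrow> norm (\<Sum>j<n. one_step_martingale x (w j) (\<tau> j) (\<tau> (Suc j))) \<le> m"
    and n: "n \<le> N"
  shows "norm (x (\<tau> n) - y n) \<le> K_path * (m + h * (T - t0) * (1 + B) + (\<Sum>j<N. (\<tau> (Suc j) - \<tau> j) * (Q j)\<^sup>2))"
proof -
  \<comment> \<open>Zero beyond the grid, because the Gronwall lemma asks for nonnegative weights at
    every index.\<close>
  define \<delta> where "\<delta> j = (if j < N then \<tau> (Suc j) - \<tau> j else 0)" for j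
  define e where "e n = x (\<tau> n) - y n" for n
  define R where "R j = (c + c\<^sup>2 + K_stage) * (\<delta> j)\<^sup>2 * (1 + B) + c * (real CARD('d))\<^sup>2 * (\<delta> j * (Q j)\<^sup>2)" for j
  let ?D = "\<lambda>j. one_step_martingale x (w j) (\<tau> j) (\<tau> (Suc j))"
  have \<tau>: "t0 \<le> \<tau> n" "\<tau> n \<le> T" if "n \<le> N" for n using grid_bounds[OF g that] .
  have \<delta>0: "0 \<le> \<delta> j" for j using g unfolding grid_def \<delta>_def by (auto simp: less_imp_le)
  have \<delta>h: "\<delta> j \<le> h" for j
  proof (cases "j < N")
    case False
    have "N \<noteq> 0" using g t0_T unfolding grid_def by (metis less_irrefl)
    then have "0 \<le> h" using h(1)[of 0] \<delta>0[of 0] by (simp add: \<delta>_def)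
    then show ?thesis using False by (simp add: \<delta>_def)
  qed (use h(1) in \<open>simp add: \<delta>_def\<close>)
  have h0: "0 \<le> h" using \<delta>0[of 0] \<delta>h[of 0] by linarith
  have B0: "0 \<le> B" using B[of t0] t0_T norm_ge_zero order_trans by (metis atLeastAtMost_iff order_refl less_imp_le)
  have sum\<delta>: "(\<Sum>j<n. \<delta> j) = \<tau> n - t0" if "n \<le> N" for n
  proof -
    have "(\<Sum>j<n. \<delta> j) = (\<Sum>j<n. \<tau> (Suc j) - \<tau> j)" using that by (intro sum.cong) (auto simp: \<delta>_def)
    also have "\<dots> = \<tau> n - t0" using g by (simp add: sum_lessThan_telescope grid_def)
    finally show ?thesis .
  qed
  have R0: "0 \<le> R j" for j
    unfolding R_def using c_pos K_stage_nonneg B0 \<delta>0[of j]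
    by (intro add_nonneg_nonneg mult_nonneg_nonneg) auto
  have step: "norm (e (Suc j) - e j - ?D j) \<le> (c + K_stage) * \<delta> j * norm (e j) + R j" if j: "j < N" for j
  proof -
    let ?u = "\<tau> j" and ?v = "\<tau> (Suc j)"
    have uv: "t0 \<le> ?u" "?u \<le> ?v" "?v \<le> T" "?v - ?u = \<delta> j"
      using \<tau>[of j] \<tau>[of "Suc j"] \<delta>0[of j] j by (auto simp: \<delta>_def)
    have hj: "c * A0_norm * (?v - ?u) \<le> 1 / 2"
      using order_trans[OF mult_left_mono[OF \<delta>h[of j], of "c * A0_norm"] h(3)] c_pos A0_norm_nonneg uv(4) by simp
    have le: "norm (x ?v - x ?u - \<delta> j *\<^sub>R (a ?u (x ?u) - a ?u (y j)) - srk_drift ?u (\<delta> j) (y j) - w j - ?D j)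
      \<le> (\<delta> j)\<^sup>2 * (c + c\<^sup>2) * (1 + B) + c * (real CARD('d))\<^sup>2 * (\<delta> j * (Q j)\<^sup>2) + K_stage * (\<delta> j)\<^sup>2 * (1 + norm (y j))"
      using local_error[OF x uv(1-3) hj, of B "Q j" "y j" "w j"] B Q[OF j] uv(1,3) unfolding uv(4) by auto
    have "norm (y j) \<le> B + norm (e j)"
      using norm_triangle_sub[of "y j" "x ?u"] B[of ?u] uv unfolding e_def by (auto simp: norm_minus_commute)
    then have "K_stage * (\<delta> j)\<^sup>2 * (1 + norm (y j)) \<le> K_stage * (\<delta> j)\<^sup>2 * (1 + (B + norm (e j)))"
      using K_stage_nonneg by (intro mult_left_mono) auto
    also have "\<dots> = K_stage * (\<delta> j)\<^sup>2 * (1 + B) + K_stage * norm (e j) * (\<delta> j)\<^sup>2" by (simp add: algebra_simps)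
    \<comment> \<open>Here \<open>h \<le> 1\<close> turns the quadratic weight of the error into a
      linear one, whose sum over the grid stays bounded.\<close>
    also have "\<dots> \<le> K_stage * (\<delta> j)\<^sup>2 * (1 + B) + K_stage * norm (e j) * \<delta> j"
    proof -
      have "(\<delta> j)\<^sup>2 \<le> \<delta> j" using \<delta>0[of j] \<delta>h[of j] h(2) by (simp add: power2_eq_square mult_left_le)
      then show ?thesis using K_stage_nonneg by (intro add_left_mono mult_left_mono) auto
    qed
    finally have 1: "K_stage * (\<delta> j)\<^sup>2 * (1 + norm (y j)) \<le> K_stage * (\<delta> j)\<^sup>2 * (1 + B) + K_stage * norm (e j) * \<delta> j" .
    have "\<delta> j * norm (a ?u (x ?u) - a ?u (y j)) \<le> \<delta> j * (c * norm (e j))"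
      using lip[of ?u "x ?u" "y j"] uv \<delta>0[of j] unfolding e_def by (intro mult_left_mono) auto
    then have 2: "norm (\<delta> j *\<^sub>R (a ?u (x ?u) - a ?u (y j))) \<le> \<delta> j * (c * norm (e j))" using \<delta>0[of j] by simp
    let ?L = "x ?v - x ?u - \<delta> j *\<^sub>R (a ?u (x ?u) - a ?u (y j)) - srk_drift ?u (\<delta> j) (y j) - w j - ?D j"
      and ?A = "\<delta> j *\<^sub>R (a ?u (x ?u) - a ?u (y j))"
    have dec: "e (Suc j) - e j - ?D j = ?L + ?A"
    proof -
      have "y (Suc j) = y j + srk_drift ?u (\<delta> j) (y j) + w j" using y[OF j] unfolding uv(4) .
      moreover have "p - (q + r + k) - (l - q) - i = (p - l - f - r - k - i) + f" for p q r k l i f :: "real^'d" by simp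
      ultimately show ?thesis unfolding e_def by simp
    qed
    have "norm (?L + ?A) \<le> norm ?L + norm ?A" by (rule norm_triangle_ineq)
    also have "\<dots> \<le> ((\<delta> j)\<^sup>2 * (c + c\<^sup>2) * (1 + B) + c * (real CARD('d))\<^sup>2 * (\<delta> j * (Q j)\<^sup>2)
        + (K_stage * (\<delta> j)\<^sup>2 * (1 + B) + K_stage * norm (e j) * \<delta> j)) + \<delta> j * (c * norm (e j))"
      using le 1 2 by linarith
    also have "\<dots> = (c + K_stage) * \<delta> j * norm (e j) + R j" unfolding R_def by algebra
    finally show ?thesis unfolding dec .
  qed
  define P where "P = (\<Sum>j<N. R j)"
  have e0: "e 0 = 0" using y0 g unfolding e_def grid_def by simp
  have gr: "norm (e n) \<le> (m + P) + (\<Sum>j<n. ((c + K_stage) * \<delta> j) * norm (e j))" if n: "n \<le> N" for n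
  proof -
    have "e n = (\<Sum>j<n. e (Suc j) - e j)" using e0 by (simp add: sum_lessThan_telescope)
    also have "\<dots> = (\<Sum>j<n. ?D j) + (\<Sum>j<n. e (Suc j) - e j - ?D j)" by (simp add: sum_subtractf)
    also have "norm \<dots> \<le> m + (\<Sum>j<n. (c + K_stage) * \<delta> j * norm (e j) + R j)"
      using n by (intro norm_triangle_le add_mono m sum_norm_le step) auto
    also have "(\<Sum>j<n. (c + K_stage) * \<delta> j * norm (e j) + R j)
        \<le> P + (\<Sum>j<n. ((c + K_stage) * \<delta> j) * norm (e j))"
    proof -
      have "(\<Sum>j<n. R j) \<le> P" unfolding P_def using n R0 by (intro sum_mono2) auto
      then show ?thesis by (simp add: sum.distrib)
    qed
    finally show ?thesis by simp
  qed
  have m0: "0 \<le> m" using m[of 0] by simp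
  have P0: "0 \<le> P" unfolding P_def by (intro sum_nonneg R0)
  have "norm (e n) \<le> (m + P) * exp (\<Sum>j<n. (c + K_stage) * \<delta> j)"
    by (rule discrete_gronwall[where N=N and e="\<lambda>n. norm (e n)"])
      (use gr n m0 P0 c_pos K_stage_nonneg \<delta>0 in auto)
  also have "(\<Sum>j<n. (c + K_stage) * \<delta> j) = (c + K_stage) * (\<tau> n - t0)"
    using sum\<delta>[OF n] by (simp add: sum_distrib_left[symmetric])
  also have "(m + P) * exp ((c + K_stage) * (\<tau> n - t0)) \<le> (m + P) * exp ((c + K_stage) * (T - t0))"
    using \<tau>[OF n] m0 P0 c_pos K_stage_nonneg by (intro mult_left_mono) (auto intro!: mult_left_mono)
  also have "(m + P) * exp ((c + K_stage) * (T - t0))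
      \<le> K_path * (m + h * (T - t0) * (1 + B) + (\<Sum>j<N. (\<tau> (Suc j) - \<tau> j) * (Q j)\<^sup>2))"
  proof -
    let ?q = "\<Sum>j<N. \<delta> j * (Q j)\<^sup>2" and ?k = "1 + c + c\<^sup>2 + K_stage + c * (real CARD('d))\<^sup>2"
    have q: "?q = (\<Sum>j<N. (\<tau> (Suc j) - \<tau> j) * (Q j)\<^sup>2)" by (intro sum.cong) (auto simp: \<delta>_def)
    have q0: "0 \<le> ?q" using \<delta>0 by (intro sum_nonneg) auto
    \<comment> \<open>One factor \<open>\<delta> j\<close> is bounded by \<open>h\<close> and the
      other sums to the length of the interval: local remainders of order 2 give a global
      contribution of order 1.\<close>
    have d2: "(\<Sum>j<N. (\<delta> j)\<^sup>2) \<le> h * (T - t0)"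
    proof -
      have "(\<Sum>j<N. (\<delta> j)\<^sup>2) \<le> (\<Sum>j<N. h * \<delta> j)"
        using \<delta>0 \<delta>h by (intro sum_mono) (simp add: power2_eq_square mult_right_mono)
      also have "\<dots> = h * (T - t0)" using sum\<delta>[of N] g by (simp add: sum_distrib_left[symmetric] grid_def)
      finally show ?thesis .
    qed
    have "P = (c + c\<^sup>2 + K_stage) * (1 + B) * (\<Sum>j<N. (\<delta> j)\<^sup>2) + c * (real CARD('d))\<^sup>2 * ?q"
      unfolding P_def R_def sum.distrib sum_distrib_left
      by (intro arg_cong2[where f="(+)"] sum.cong refl) (simp only: mult_ac)
    also have "\<dots> \<le> ?k * (h * (T - t0) * (1 + B)) + ?k * ?q"
    proof (intro add_mono)
      have "(c + c\<^sup>2 + K_stage) * (1 + B) * (\<Sum>j<N. (\<delta> j)\<^sup>2) \<le> (c + c\<^sup>2 + K_stage) * (1 + B) * (h * (T - t0))"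
        using d2 c_pos K_stage_nonneg B0 by (intro mult_left_mono) auto
      also have "\<dots> \<le> ?k * (1 + B) * (h * (T - t0))"
        using c_pos B0 h0 t0_T by (intro mult_right_mono) auto
      finally show "(c + c\<^sup>2 + K_stage) * (1 + B) * (\<Sum>j<N. (\<delta> j)\<^sup>2) \<le> ?k * (h * (T - t0) * (1 + B))"
        by (simp only: mult_ac)
      show "c * (real CARD('d))\<^sup>2 * ?q \<le> ?k * ?q"
        using q0 c_pos K_stage_nonneg by (intro mult_right_mono) auto
    qed
    finally have "m + P \<le> ?k * m + (?k * (h * (T - t0) * (1 + B)) + ?k * ?q)"
    proof (intro add_mono)
      have "0 \<le> c + c\<^sup>2 + K_stage + c * (real CARD('d))\<^sup>2" using c_pos K_stage_nonneg by simp
      then have "1 * m \<le> ?k * m" using m0 by (intro mult_right_mono) auto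
      then show "m \<le> ?k * m" by simp
    qed
    also have "\<dots> = ?k * (m + h * (T - t0) * (1 + B) + ?q)" by (simp only: distrib_left add.assoc)
    finally have "exp ((c + K_stage) * (T - t0)) * (m + P)
        \<le> exp ((c + K_stage) * (T - t0)) * (?k * (m + h * (T - t0) * (1 + B) + ?q))"
      by (intro mult_left_mono) auto
    then show ?thesis unfolding K_path_def q[symmetric] by (simp only: mult_ac)
  qed
  finally show ?thesis unfolding e_def .
qed

end

section \<open>The solution of the equation\<close>

text \<open>Every term is bounded by the largest one, which in turn is one of the summands on the
  right. This works for each positive \<open>q\<close>, without convexity.\<close>

lemma sum_powr_le:
  fixes x :: "'i \<Rightarrow> real"
  assumes "finite I" "\<And>i. i \<in> I \<Longrightarrow> 0 \<le> x i" "0 < q"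
  shows "(\<Sum>i\<in>I. x i) powr q \<le> real (card I) powr q * (\<Sum>i\<in>I. x i powr q)"
proof (cases "I = {}")
  case False
  define m where "m = Max (x ` I)"
  have "m \<in> x ` I" unfolding m_def using assms(1) False by (intro Max_in) auto
  then obtain k where k: "k \<in> I" "m = x k" by auto
  have "(\<Sum>i\<in>I. x i) \<le> (\<Sum>i\<in>I. m)" unfolding m_def using assms(1) by (intro sum_mono Max_ge) auto
  then have "(\<Sum>i\<in>I. x i) powr q \<le> (real (card I) * m) powr q"
    using assms by (intro powr_mono2) (auto intro: sum_nonneg)
  also have "\<dots> = real (card I) powr q * x k powr q"
    using assms(2)[OF k(1)] unfolding k(2) by (simp add: powr_mult)
  also have "\<dots> \<le> real (card I) powr q * (\<Sum>i\<in>I. x i powr q)"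
    using assms(1) k(1) by (intro mult_left_mono member_le_sum) auto
  finally show ?thesis .
qed simp

text \<open>Exponential bounds are stable under finite sums and almost sure limits, so the time
  integral of a random path is reached through Riemann sums.\<close>

lemma riemann_sum_limit:
  fixes f :: "real \<Rightarrow> real"
  assumes uv: "u \<le> v" and cont: "continuous_on {u..v} f"
  shows "(\<lambda>n. \<Sum>i<Suc n. (v - u) / real (Suc n) * f (ugrid u v (Suc n) (Suc i))) \<longlonglongrightarrow> integral {u..v} f"
proof (rule LIMSEQ_I)
  fix \<epsilon> :: real assume \<epsilon>: "0 < \<epsilon>"
  \<comment> \<open>The summand 1 covers the degenerate interval \<open>u = v\<close>.\<close>
  define \<eta> where "\<eta> = \<epsilon> / (2 * (v - u + 1))"
  have \<eta>: "0 < \<eta>" "\<eta> * (v - u) < \<epsilon>"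
  proof -
    show "0 < \<eta>" using \<epsilon> uv by (simp add: \<eta>_def)
    have "\<epsilon> * (v - u) < \<epsilon> * (2 * (v - u + 1))" using \<epsilon> uv by (intro mult_strict_left_mono) auto
    then show "\<eta> * (v - u) < \<epsilon>" using uv by (simp add: \<eta>_def field_simps)
  qed
  obtain \<delta> where \<delta>: "0 < \<delta>" "\<And>x y. x \<in> {u..v} \<Longrightarrow> y \<in> {u..v} \<Longrightarrow> dist y x < \<delta> \<Longrightarrow> dist (f y) (f x) < \<eta>"
    using compact_uniformly_continuous[OF cont compact_Icc, unfolded uniformly_continuous_on_def,
        rule_format, OF \<eta>(1)] by blast
  obtain n0 :: nat where n0: "(v - u) / \<delta> < real n0" using reals_Archimedean2 by blast
  have "norm ((\<Sum>i<Suc n. (v - u) / real (Suc n) * f (ugrid u v (Suc n) (Suc i))) - integral {u..v} f) < \<epsilon>"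
    if n: "n0 \<le> n" for n
  proof -
    let ?g = "ugrid u v (Suc n)" and ?h = "(v - u) / real (Suc n)"
    have h0: "0 \<le> ?h" using uv by simp
    have "(v - u) / \<delta> < real (Suc n)" using n0 n by linarith
    then have h: "?h < \<delta>" using \<delta>(1) by (simp add: divide_simps mult.commute del: of_nat_Suc split: if_splits)
    have gb: "u \<le> ?g i" "?g i \<le> v" if "i \<le> Suc n" for i using ugrid_bounds[OF uv that] by auto
    have gs: "?g (Suc i) - ?g i = ?h" for i by (rule ugrid_step)
    have gm: "?g i \<le> ?g (Suc i)" for i using gs[of i] h0 by linarith
    have split: "integral {u..?g k} f = (\<Sum>i<k. integral {?g i..?g (Suc i)} f)" if "k \<le> Suc n" for k
      using that
    proof (induction k)
      case (Suc k)
      have "f integrable_on {u..?g (Suc k)}"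
        by (intro integrable_continuous_interval continuous_on_subset[OF cont]) (use gb[of "Suc k"] Suc.prems in auto)
      then have "integral {u..?g k} f + integral {?g k..?g (Suc k)} f = integral {u..?g (Suc k)} f"
        using gb(1)[of k] gm[of k] Suc.prems by (intro Henstock_Kurzweil_Integration.integral_combine) auto
      then show ?case using Suc by simp
    qed simp
    have piece: "\<bar>?h * f (?g (Suc i)) - integral {?g i..?g (Suc i)} f\<bar> \<le> \<eta> * ?h" if i: "i < Suc n" for i
    proof -
      have cf: "continuous_on {?g i..?g (Suc i)} f"
        by (rule continuous_on_subset[OF cont]) (use gb(1)[of i] gb(2)[of "Suc i"] i in auto)
      have "norm (integral {?g i..?g (Suc i)} (\<lambda>s. f (?g (Suc i)) - f s)) \<le> \<eta> * (?g (Suc i) - ?g i)"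
      proof (rule integral_bound[OF gm])
        show "continuous_on {?g i..?g (Suc i)} (\<lambda>s. f (?g (Suc i)) - f s)" by (intro continuous_intros cf)
        fix s assume s: "s \<in> {?g i..?g (Suc i)}"
        have "dist (?g (Suc i)) s < \<delta>" using s gs[of i] h unfolding dist_real_def by auto
        then have "dist (f (?g (Suc i))) (f s) < \<eta>"
          using s gb(1)[of i] gb(2)[of "Suc i"] gm[of i] i by (intro \<delta>(2)) auto
        then show "norm (f (?g (Suc i)) - f s) \<le> \<eta>" unfolding dist_norm by (rule less_imp_le)
      qed
      moreover have "integral {?g i..?g (Suc i)} (\<lambda>s. f (?g (Suc i)) - f s)
          = ?h * f (?g (Suc i)) - integral {?g i..?g (Suc i)} f"
        using gs[of i] gm[of i] cf
        by (subst Henstock_Kurzweil_Integration.integral_diff) (auto intro: integrable_continuous_interval)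
      ultimately show ?thesis unfolding gs real_norm_def by simp
    qed
    have "(\<Sum>i<Suc n. ?h * f (?g (Suc i))) - integral {u..v} f
        = (\<Sum>i<Suc n. ?h * f (?g (Suc i)) - integral {?g i..?g (Suc i)} f)"
      using split[of "Suc n"] by (simp only: ugrid_n zero_less_Suc order_refl sum_subtractf)
    also have "norm \<dots> \<le> (\<Sum>i<Suc n. \<eta> * ?h)"
      using piece by (intro sum_norm_le) auto
    also have "\<dots> = real (Suc n) * (\<eta> * ?h)" by (simp only: sum_constant card_lessThan)
    also have "\<dots> = \<eta> * (v - u)" by (simp del: of_nat_Suc)
    finally show ?thesis using \<eta>(2) by linarith
  qed
  then show "\<exists>no. \<forall>n\<ge>no. norm ((\<Sum>i<Suc n. (v - u) / real (Suc n) * f (ugrid u v (Suc n) (Suc i))) - integral {u..v} f) < \<epsilon>"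
    by blast
qed

lemma vec_nth_measurable [measurable (raw)]:
  fixes f :: "'a \<Rightarrow> real^'d"
  assumes "f \<in> borel_measurable N"
  shows "(\<lambda>\<omega>. f \<omega> $ r) \<in> borel_measurable N"
  by (rule borel_measurable_continuous_on[OF _ assms]) (intro continuous_intros)

section \<open>Exponential bounds for increments of the solution without drift\<close>

locale additive_sde = filtered_space M F + additive_drift a t0 T c
  for M :: "'a measure" and F and a :: "real \<Rightarrow> real^'d \<Rightarrow> real^'d" and t0 T c :: real +
  fixes W :: "'m::finite \<Rightarrow> real \<Rightarrow> 'a \<Rightarrow> real" and b :: "'m \<Rightarrow> real \<Rightarrow> real^'d"
    and X0 :: "'a \<Rightarrow> real^'d" and X :: "real \<Rightarrow> 'a \<Rightarrow> real^'d"
  assumes t0_nonneg: "0 \<le> t0" and W: "\<And>k. wiener_process M F (W k)"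
    and b_diff: "\<And>k. b k differentiable_on {t0..T}"
    and b_bound: "\<And>t k. t \<in> {t0..T} \<Longrightarrow> norm (b k t) \<le> c"
    and b_deriv: "\<And>t k. t \<in> {t0..T} \<Longrightarrow> norm (time_deriv {t0..T} (b k) t) \<le> c"
    and solution: "sde_additive_solution M F W t0 T a b X0 X"
begin

lemma filtered_wiener: "filtered_wiener M F (W k)"
  using W[of k] filtered_space_axioms by (simp add: filtered_wiener_def filtered_wiener_axioms_def)

lemma b_lipschitz: "s \<in> {t0..T} \<Longrightarrow> t \<in> {t0..T} \<Longrightarrow> norm (b k s - b k t) \<le> c * \<bar>s - t\<bar>"
  using time_deriv_lipschitz[OF b_diff t0_T b_deriv] .

lemma b_continuous: "continuous_on {t0..T} (b k)"
  using b_diff by (rule differentiable_imp_continuous_on)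

lemma X_adapted: "t \<in> {t0..T} \<Longrightarrow> X t \<in> borel_measurable (F t)"
  using solution[unfolded sde_additive_solution_def, THEN conjunct1] by blast

lemma X_measurable: "t \<in> {t0..T} \<Longrightarrow> X t \<in> borel_measurable M"
  using X_adapted measurable_F_M t0_nonneg by (metis atLeastAtMost_iff order_trans)

lemma X_continuous: "AE \<omega> in M. continuous_on {t0..T} (\<lambda>t. X t \<omega>)"
  using solution[unfolded sde_additive_solution_def, THEN conjunct2, THEN conjunct1] .

definition Z :: "real \<Rightarrow> 'a \<Rightarrow> real^'d" where "Z t \<omega> = driftless (\<lambda>s. X s \<omega>) t"

lemma Z_continuous: "AE \<omega> in M. continuous_on {t0..T} (\<lambda>t. Z t \<omega>)"
  using X_continuous by eventually_elim (simp add: Z_def driftless_continuous)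

text \<open>Paths are continuous almost surely, so the Lebesgue integral in the equation agrees with
  the gauge integral in \<open>driftless\<close>, and the drift cancels.\<close>

lemma Z_ito:
  assumes t: "t \<in> {t0..T}"
  obtains J :: "'m \<Rightarrow> 'a \<Rightarrow> real^'d" where
    "\<And>k. has_ito_integral M F (W k) (\<lambda>s \<omega>. b k s) t0 t (J k)"
    "AE \<omega> in M. Z t \<omega> = X0 \<omega> + (\<Sum>k\<in>UNIV. J k \<omega>)"
proof -
  obtain J :: "'m \<Rightarrow> 'a \<Rightarrow> real^'d" where J: "\<forall>k. has_ito_integral M F (W k) (\<lambda>s \<omega>. b k s) t0 t (J k)"
    and eq: "AE \<omega> in M. X t \<omega> = X0 \<omega> + (LBINT s:{t0..t}. a s (X s \<omega>)) + (\<Sum>k\<in>UNIV. J k \<omega>)"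
    using solution[unfolded sde_additive_solution_def, THEN conjunct2, THEN conjunct2, rule_format, OF t]
    by (elim exE conjE)
  have "AE \<omega> in M. Z t \<omega> = X0 \<omega> + (\<Sum>k\<in>UNIV. J k \<omega>)"
    using eq X_continuous
  proof eventually_elim
    case (elim \<omega>)
    have sub: "{t0..t} \<subseteq> {t0..T}" using t by auto
    have "continuous_on {t0..t} (\<lambda>s. a s (X s \<omega>))"
      by (rule drift_continuous[OF continuous_on_subset[OF elim(2) sub] sub])
    then have "set_integrable lborel {t0..t} (\<lambda>s. a s (X s \<omega>))" by (rule borel_integrable_atLeastAtMost')
    then have "(LBINT s:{t0..t}. a s (X s \<omega>)) = integral {t0..t} (\<lambda>s. a s (X s \<omega>))"
      by (rule set_borel_integral_eq_integral(2))
    then show ?case using elim(1) unfolding Z_def driftless_def by simp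
  qed
  then show ?thesis using J that by blast
qed

text \<open>At \<open>t0\<close> the equation still contains stochastic integrals over a one-point
  interval. They vanish almost surely: \<open>ito_step_distance\<close> with an empty step function
  bounds their mean squares by a multiple of the length 0.\<close>

lemma Z_start: "AE \<omega> in M. X t0 \<omega> = X0 \<omega>"
proof -
  have t0: "t0 \<in> {t0..T}" using t0_T by simp
  obtain J :: "'m \<Rightarrow> 'a \<Rightarrow> real^'d" where J: "\<And>k. has_ito_integral M F (W k) (\<lambda>s \<omega>. b k s) t0 t0 (J k)"
    and eq: "AE \<omega> in M. Z t0 \<omega> = X0 \<omega> + (\<Sum>k\<in>UNIV. J k \<omega>)"
    using Z_ito[OF t0] by blast
  have J0: "AE \<omega> in M. \<forall>r\<in>UNIV. J k \<omega> $ r = 0" for k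
  proof (intro AE_ball_countable' countable_finite finite)
    fix r :: 'd
    interpret filtered_wiener M F "W k" by (rule filtered_wiener)
    have "(\<integral>\<^sup>+\<omega>. ennreal ((J k \<omega> \<bullet> axis r 1 - (\<Sum>i\<in>({}::nat set). 0 * (W k 0 \<omega> - W k 0 \<omega>)))\<^sup>2) \<partial>M)
        \<le> ennreal (4 * 0\<^sup>2 * (t0 - t0))"
      by (rule ito_step_distance[OF J t0_nonneg order_refl]) auto
    then have "(\<integral>\<^sup>+\<omega>. ennreal ((J k \<omega> $ r)\<^sup>2) \<partial>M) = 0" by (simp add: inner_axis)
    moreover have "J k \<in> borel_measurable M"
      using J[of k, unfolded has_ito_integral_def, THEN conjunct2, THEN conjunct2, THEN conjunct2, THEN conjunct1] .
    ultimately have "AE \<omega> in M. ennreal ((J k \<omega> $ r)\<^sup>2) = 0" by (subst (asm) nn_integral_0_iff_AE) measurable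
    then show "AE \<omega> in M. J k \<omega> $ r = 0" by eventually_elim simp
  qed
  have "AE \<omega> in M. \<forall>k\<in>UNIV. \<forall>r\<in>UNIV. J k \<omega> $ r = 0"
    by (rule AE_ball_countable'[OF J0 countable_finite[OF finite]])
  with eq show ?thesis
  proof eventually_elim
    case (elim \<omega>)
    have "J k \<omega> = 0" for k using elim(2) by (simp add: vec_eq_iff)
    then show ?case using elim(1) by (simp add: Z_def driftless_def)
  qed
qed

definition m_dim :: real where "m_dim = real CARD('m)"

lemma m_dim_pos: "0 < m_dim" by (simp add: m_dim_def)

text \<open>Each noise contributes one integral, and adding the deviations over \<open>k\<close>
  gives the factor \<open>m_dim\<close>. The numbers \<kappa> stay free: zero yields the size of an
  increment, a quadrature of \<open>b\<close> yields the noise error of the scheme.\<close>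

lemma Z_increment_subg:
  assumes uv: "t0 \<le> u" "u < v" "v \<le> T" and L: "0 < L" "\<And>k s. s \<in> {u..v} \<Longrightarrow> \<bar>b k s $ r - \<kappa> k\<bar> \<le> L"
  shows "subg u v (m_dim * (L * sqrt (v - u)))
    (\<lambda>\<omega>. (Z v \<omega> - Z u \<omega>) $ r - (\<Sum>k\<in>UNIV. \<kappa> k * (W k v \<omega> - W k u \<omega>)))"
proof -
  have I: "u \<in> {t0..T}" "v \<in> {t0..T}" using uv by auto
  obtain Ju where Ju: "\<And>k. has_ito_integral M F (W k) (\<lambda>s \<omega>. b k s) t0 u (Ju k)"
    and Zu: "AE \<omega> in M. Z u \<omega> = X0 \<omega> + (\<Sum>k\<in>UNIV. Ju k \<omega>)" using Z_ito[OF I(1)] by blast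
  obtain Jv where Jv: "\<And>k. has_ito_integral M F (W k) (\<lambda>s \<omega>. b k s) t0 v (Jv k)"
    and Zv: "AE \<omega> in M. Z v \<omega> = X0 \<omega> + (\<Sum>k\<in>UNIV. Jv k \<omega>)" using Z_ito[OF I(2)] by blast
  have "subg u v (\<Sum>k\<in>(UNIV::'m set). L * sqrt (v - u))
     (\<lambda>\<omega>. \<Sum>k\<in>UNIV. Jv k \<omega> \<bullet> axis r 1 - Ju k \<omega> \<bullet> axis r 1 - \<kappa> k * (W k v \<omega> - W k u \<omega>))"
  proof (intro subg_sum)
    fix k
    interpret filtered_wiener M F "W k" by (rule filtered_wiener)
    have cb: "continuous_on {t0..v} (b k)" using b_continuous by (rule continuous_on_subset) (use uv in auto)
    show "subg u v (L * sqrt (v - u))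
        (\<lambda>\<omega>. Jv k \<omega> \<bullet> axis r 1 - Ju k \<omega> \<bullet> axis r 1 - \<kappa> k * (W k v \<omega> - W k u \<omega>))"
      by (rule ito_increment_subg[OF Ju Jv t0_nonneg uv(1,2) cb _ L(1)])
        (use L(2) in \<open>auto simp: inner_axis\<close>)
  qed auto
  then have s: "subg u v (m_dim * (L * sqrt (v - u)))
     (\<lambda>\<omega>. \<Sum>k\<in>UNIV. Jv k \<omega> $ r - Ju k \<omega> $ r - \<kappa> k * (W k v \<omega> - W k u \<omega>))"
    by (simp add: inner_axis m_dim_def)
  have "AE \<omega> in M. (\<Sum>k\<in>UNIV. Jv k \<omega> $ r - Ju k \<omega> $ r - \<kappa> k * (W k v \<omega> - W k u \<omega>))
      = (Z v \<omega> - Z u \<omega>) $ r - (\<Sum>k\<in>UNIV. \<kappa> k * (W k v \<omega> - W k u \<omega>))"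
    using Zu Zv by eventually_elim (simp add: sum_subtractf)
  \<comment> \<open>The equality holds almost surely only, so the property is carried over as the
    limit of a constant sequence.\<close>
  then have "AE \<omega> in M. (\<lambda>n::nat. \<Sum>k\<in>UNIV. Jv k \<omega> $ r - Ju k \<omega> $ r - \<kappa> k * (W k v \<omega> - W k u \<omega>))
      \<longlonglongrightarrow> (Z v \<omega> - Z u \<omega>) $ r - (\<Sum>k\<in>UNIV. \<kappa> k * (W k v \<omega> - W k u \<omega>))"
    by eventually_elim simp
  then show ?thesis by (rule subg_limit[OF s _ tendsto_const subgD(4)[OF s]])
qed

lemma Z_subg:
  assumes uv: "t0 \<le> u" "u < v" "v \<le> T"
  shows "subg u v (m_dim * c * sqrt (v - u)) (\<lambda>\<omega>. (Z v \<omega> - Z u \<omega>) $ r)"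
proof -
  have "\<bar>b k s $ r - 0\<bar> \<le> c" if "s \<in> {u..v}" for k s
    using order_trans[OF component_le_norm_cart b_bound, of s k r] that uv by auto
  from Z_increment_subg[OF uv c_pos this] show ?thesis by (simp add: mult.assoc)
qed

text \<open>In the Riemann sums every increment starts at \<open>u\<close>, so each one satisfies a
  bound given \<open>F u\<close>, and the weights add up to \<open>v - u\<close>. Right end points
  give each increment an interval of positive length, as positive deviations demand.\<close>

lemma Z_integral_subg:
  assumes uv: "t0 \<le> u" "u < v" "v \<le> T"
  shows "subg u v ((v - u) * (m_dim * c * sqrt (v - u))) (\<lambda>\<omega>. integral {u..v} (\<lambda>s. (Z s \<omega> - Z u \<omega>) $ q))"
proof -
  let ?g = "\<lambda>n. ugrid u v (Suc n)" and ?h = "\<lambda>n. (v - u) / real (Suc n)"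
  let ?\<sigma> = "(v - u) * (m_dim * c * sqrt (v - u))"
  have s: "subg u v ?\<sigma> (\<lambda>\<omega>. \<Sum>i<Suc n. ?h n * (Z (?g n (Suc i)) \<omega> - Z u \<omega>) $ q)" for n
  proof -
    have h: "0 < ?h n" using uv by simp
    have "subg u v (\<Sum>i<Suc n. ?h n * (m_dim * c * sqrt (v - u)))
        (\<lambda>\<omega>. \<Sum>i<Suc n. ?h n * (Z (?g n (Suc i)) \<omega> - Z u \<omega>) $ q)"
    proof (intro subg_sum)
      fix i assume "i \<in> {..<Suc n}"
      then have le: "?g n (Suc i) \<le> v" using uv by (intro ugrid_bounds(2)) auto
      have "0 \<le> (v - u) * real i / real (Suc n)" using uv by simp
      then have less: "u < ?g n (Suc i)"
        using ugrid_step[of u v "Suc n" i] h unfolding ugrid_def by linarith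
      have "subg u (?g n (Suc i)) (m_dim * c * sqrt (?g n (Suc i) - u)) (\<lambda>\<omega>. (Z (?g n (Suc i)) \<omega> - Z u \<omega>) $ q)"
        by (rule Z_subg) (use uv le less in auto)
      then have "subg u v (m_dim * c * sqrt (v - u)) (\<lambda>\<omega>. (Z (?g n (Suc i)) \<omega> - Z u \<omega>) $ q)"
        by (rule subg_mono) (use le m_dim_pos c_pos in \<open>auto intro!: mult_left_mono\<close>)
      from subg_scale[OF this less_imp_neq[OF h, symmetric]]
      show "subg u v (?h n * (m_dim * c * sqrt (v - u))) (\<lambda>\<omega>. ?h n * (Z (?g n (Suc i)) \<omega> - Z u \<omega>) $ q)"
        unfolding abs_of_pos[OF h] .
    qed auto
    moreover have "(\<Sum>i<Suc n. ?h n * (m_dim * c * sqrt (v - u))) = ?\<sigma>"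
      by (simp only: sum_constant card_lessThan) (simp del: of_nat_Suc)
    ultimately show ?thesis by simp
  qed
  have "AE \<omega> in M. (\<lambda>n. \<Sum>i<Suc n. ?h n * (Z (?g n (Suc i)) \<omega> - Z u \<omega>) $ q)
      \<longlonglongrightarrow> integral {u..v} (\<lambda>s. (Z s \<omega> - Z u \<omega>) $ q)"
    using Z_continuous
  proof eventually_elim
    case (elim \<omega>)
    have "continuous_on {u..v} (\<lambda>s. (Z s \<omega> - Z u \<omega>) $ q)"
      by (intro continuous_intros continuous_on_subset[OF elim]) (use uv in auto)
    from riemann_sum_limit[OF less_imp_le[OF uv(2)] this] show ?case .
  qed
  then show ?thesis by (rule subg_limit[OF s _ tendsto_const subgD(4)[OF s]])
qed

section \<open>Suprema of paths over an interval\<close>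

text \<open>On every dyadic grid the squared deviations of the increments have the same total, so
  the moment bound for the maximum does not depend on the level. The grids are nested: monotone
  convergence reaches all dyadic points, and path continuity all of \<open>{u..v}\<close>. A
  measurable majorant \<open>Q\<close> replaces the supremum itself, whose measurability would be a
  separate issue.\<close>

lemma Z_sup_component:
  assumes uv: "t0 \<le> u" "u < v" "v \<le> T" and q: "0 < q"
  shows "\<exists>Q. Q \<in> borel_measurable M \<and> (\<forall>\<omega>. 0 \<le> Q \<omega>) \<and>
    (AE \<omega> in M. \<forall>s\<in>{u..v}. \<bar>(Z s \<omega> - Z u \<omega>) $ r\<bar> \<le> Q \<omega>) \<and>
    (\<integral>\<^sup>+\<omega>. ennreal (Q \<omega> powr q) \<partial>M) \<le> ennreal (4 * exp (1 / 4) * (2 * q) powr q * (m_dim * c * sqrt (v - u)) powr q)"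
proof -
  let ?C = "4 * exp (1 / 4) * (2 * q) powr q * (m_dim * c * sqrt (v - u)) powr q"
  let ?g = "\<lambda>k. ugrid u v (2 ^ k)"
  define f where "f t \<omega> = \<bar>(Z t \<omega> - Z u \<omega>) $ r\<bar>" for t \<omega>
  define m where "m k \<omega> = Max ((\<lambda>i. f (?g k i) \<omega>) ` {..2 ^ k})" for k \<omega>
  define S where "S \<omega> = (SUP k. ennreal (m k \<omega> powr q))" for \<omega>
  have uv': "u \<le> v" using uv by simp
  have gb: "u \<le> ?g k i" "?g k i \<le> v" if "i \<le> 2 ^ k" for k i using ugrid_bounds[OF uv' that] by auto
  have gs: "?g k (Suc i) - ?g k i = (v - u) / 2 ^ k" for k i using ugrid_step[of u v "2 ^ k" i] by simp
  have gl: "?g k i < ?g k (Suc i)" for k i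
  proof -
    have "0 < (v - u) / 2 ^ k" using uv by simp
    then show ?thesis using gs[of k i] by linarith
  qed
  have inc: "subg (?g k i) (?g k (Suc i)) (m_dim * c * sqrt ((v - u) / 2 ^ k))
      (\<lambda>\<omega>. (Z (?g k (Suc i)) \<omega> - Z (?g k i) \<omega>) $ r)" if "i < 2 ^ k" for k i
    using Z_subg[of "?g k i" "?g k (Suc i)" r] gb(1)[of i k] gb(2)[of "Suc i" k] gl[of k i] uv that
    unfolding gs by simp
  have tele: "f (?g k i) \<omega> = \<bar>\<Sum>j<i. (Z (?g k (Suc j)) \<omega> - Z (?g k j) \<omega>) $ r\<bar>" for k i \<omega>
  proof -
    have "(\<Sum>j<i. Z (?g k (Suc j)) \<omega> - Z (?g k j) \<omega>) = Z (?g k i) \<omega> - Z u \<omega>"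
      using sum_lessThan_telescope[of "\<lambda>j. Z (?g k j) \<omega>" i] by simp
    then show ?thesis unfolding f_def sum_component[symmetric] by simp
  qed
  have mm: "m k \<in> borel_measurable M" for k
  proof -
    have "(\<lambda>\<omega>. f (?g k i) \<omega>) \<in> borel_measurable M" if "i \<le> 2 ^ k" for i
      unfolding tele using subgD(6)[OF inc] that by (intro borel_measurable_abs borel_measurable_sum) auto
    then show ?thesis unfolding m_def[abs_def] by (intro borel_measurable_Max) auto
  qed
  have bound: "(\<integral>\<^sup>+\<omega>. ennreal (m k \<omega> powr q) \<partial>M) \<le> ennreal ?C" for k
    unfolding m_def tele
  proof (rule subg_max_moment[where t="?g k" and \<sigma>="\<lambda>_. m_dim * c * sqrt ((v - u) / 2 ^ k)"])
    show "0 \<le> ?g k n" if "n \<le> 2 ^ k" for n using gb(1)[OF that] uv(1) t0_nonneg by linarith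
    have "(\<Sum>j<(2::nat) ^ k. (m_dim * c * sqrt ((v - u) / 2 ^ k))\<^sup>2) = (m_dim * c * sqrt (v - u))\<^sup>2"
      using uv by (simp add: power_mult_distrib)
    then show "(\<Sum>j<(2::nat) ^ k. (m_dim * c * sqrt ((v - u) / 2 ^ k))\<^sup>2) \<le> (m_dim * c * sqrt (v - u))\<^sup>2" by simp
  qed (use inc q m_dim_pos c_pos uv in auto)
  \<comment> \<open>Halving the mesh keeps the old grid points, at twice the index; therefore the
    maxima increase with \<open>k\<close>.\<close>
  have g2: "?g k i = ?g (Suc k) (2 * i)" for k i by (simp add: ugrid_def)
  have m0: "0 \<le> m k \<omega>" for k \<omega>
  proof -
    have "f (?g k 0) \<omega> \<le> m k \<omega>" unfolding m_def by (intro Max_ge imageI) simp_all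
    then show ?thesis unfolding f_def by linarith
  qed
  have minc: "m k \<omega> \<le> m (Suc k) \<omega>" for k \<omega>
    unfolding m_def
  proof (intro Max_mono)
    show "(\<lambda>i. f (?g k i) \<omega>) ` {..2 ^ k} \<subseteq> (\<lambda>i. f (?g (Suc k) i) \<omega>) ` {..2 ^ Suc k}"
    proof (rule image_subsetI)
      fix i :: nat assume "i \<in> {..2 ^ k}"
      then have "2 * i \<in> {..2 ^ Suc k}" by simp
      then show "f (?g k i) \<omega> \<in> (\<lambda>i. f (?g (Suc k) i) \<omega>) ` {..2 ^ Suc k}"
        unfolding g2[of k i] by (rule imageI)
    qed
  qed auto
  have Sm: "S \<in> borel_measurable M" unfolding S_def[abs_def] using mm by measurable
  have "(\<integral>\<^sup>+\<omega>. S \<omega> \<partial>M) = (SUP k. \<integral>\<^sup>+\<omega>. ennreal (m k \<omega> powr q) \<partial>M)"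
    unfolding S_def
  proof (rule nn_integral_monotone_convergence_SUP)
    show "incseq (\<lambda>k \<omega>. ennreal (m k \<omega> powr q))"
      by (intro incseq_SucI le_funI ennreal_leI powr_mono2) (use q m0 minc in auto)
  qed (use mm in measurable)
  also have "\<dots> \<le> ennreal ?C" by (intro SUP_least bound)
  finally have SC: "(\<integral>\<^sup>+\<omega>. S \<omega> \<partial>M) \<le> ennreal ?C" .
  then have "(\<integral>\<^sup>+\<omega>. S \<omega> \<partial>M) \<noteq> \<infinity>" by (auto simp: top_unique)
  from nn_integral_PInf_AE[OF Sm this] have fin: "AE \<omega> in M. S \<omega> \<noteq> \<infinity>" .
  \<comment> \<open>\<open>S\<close> is finite almost surely by its moment bound. On the exceptional
    null set \<open>enn2real\<close> sends it to 0, so that \<open>Q \<omega> powr q\<close> stays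
    below \<open>S \<omega>\<close> everywhere.\<close>
  define Q where "Q \<omega> = enn2real (S \<omega>) powr (1 / q)" for \<omega>
  show ?thesis
  proof (intro exI[of _ Q] conjI allI)
    show "Q \<in> borel_measurable M" unfolding Q_def[abs_def] using Sm by measurable
    show "0 \<le> Q \<omega>" for \<omega> by (simp add: Q_def)
    have "Q \<omega> powr q = enn2real (S \<omega>)" for \<omega> unfolding Q_def using q by (simp add: powr_powr)
    then have "(\<integral>\<^sup>+\<omega>. ennreal (Q \<omega> powr q) \<partial>M) \<le> (\<integral>\<^sup>+\<omega>. S \<omega> \<partial>M)"
      by (intro nn_integral_mono) (simp add: ennreal_enn2real_if)
    then show "(\<integral>\<^sup>+\<omega>. ennreal (Q \<omega> powr q) \<partial>M) \<le> ennreal ?C" using SC by (rule order_trans)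
    show "AE \<omega> in M. \<forall>s\<in>{u..v}. \<bar>(Z s \<omega> - Z u \<omega>) $ r\<bar> \<le> Q \<omega>"
      using fin Z_continuous
    proof eventually_elim
      case (elim \<omega>)
      have mQ: "m k \<omega> \<le> Q \<omega>" for k
      proof -
        have "ennreal (m k \<omega> powr q) \<le> S \<omega>" unfolding S_def by (intro SUP_upper) auto
        then have "m k \<omega> powr q \<le> enn2real (S \<omega>)"
          using elim(1) by (metis enn2real_mono enn2real_ennreal powr_ge_zero infinity_ennreal_def less_top)
        then have "(m k \<omega> powr q) powr (1 / q) \<le> Q \<omega>" unfolding Q_def using q by (intro powr_mono2) auto
        then show ?thesis using q m0[of k \<omega>] by (simp add: powr_powr)
      qed
      have fQ: "f (?g k i) \<omega> \<le> Q \<omega>" if "i \<le> 2 ^ k" for k i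
        by (rule order_trans[OF _ mQ[of k]]) (use that in \<open>auto simp: m_def\<close>)
      have cf: "continuous_on {u..v} (\<lambda>s. f s \<omega>)"
        unfolding f_def by (intro continuous_intros continuous_on_subset[OF elim(2)]) (use uv in auto)
      show ?case
      proof
        fix s assume s: "s \<in> {u..v}"
        \<comment> \<open>The index of the dyadic point of level \<open>k\<close> just below
          \<open>s\<close>, at most one mesh width away.\<close>
        define i where "i k = nat \<lfloor>(s - u) * 2 ^ k / (v - u)\<rfloor>" for k
        have x: "0 \<le> (s - u) * 2 ^ k / (v - u)" "(s - u) * 2 ^ k / (v - u) \<le> 2 ^ k" for k :: nat
          using s uv by (auto simp: divide_simps)
        have il: "real (i k) \<le> (s - u) * 2 ^ k / (v - u)" "(s - u) * 2 ^ k / (v - u) \<le> real (i k) + 1" for k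
          unfolding i_def using x(1)[of k] by linarith+
        have i2: "i k \<le> 2 ^ k" for k
        proof -
          have "real (i k) \<le> 2 ^ k" using il(1)[of k] x(2)[of k] by (rule order_trans)
          then have "real (i k) \<le> real (2 ^ k)" by simp
          then show ?thesis by (simp only: of_nat_le_iff)
        qed
        have close: "\<bar>?g k (i k) - s\<bar> \<le> (v - u) * (1 / 2) ^ k" for k
        proof -
          have "(v - u) / 2 ^ k * real (i k) \<le> s - u"
            using mult_left_mono[OF il(1)[of k], of "(v - u) / 2 ^ k"] uv by simp
          moreover have "s - u \<le> (v - u) / 2 ^ k * (real (i k) + 1)"
            using mult_left_mono[OF il(2)[of k], of "(v - u) / 2 ^ k"] uv by simp
          moreover have "?g k (i k) = u + (v - u) / 2 ^ k * real (i k)" by (simp add: ugrid_def)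
          moreover have "(v - u) / 2 ^ k * (real (i k) + 1) = (v - u) / 2 ^ k * real (i k) + (v - u) / 2 ^ k"
            by (simp only: distrib_left mult_1_right)
          ultimately have "\<bar>?g k (i k) - s\<bar> \<le> (v - u) / 2 ^ k" by linarith
          then show ?thesis by (simp only: power_one_over times_divide_eq_right mult_1_right)
        qed
        have "(\<lambda>k. (v - u) * (1 / 2) ^ k) \<longlonglongrightarrow> (v - u) * 0"
          by (rule tendsto_mult[OF tendsto_const LIMSEQ_power_zero]) simp
        then have "(\<lambda>k. ?g k (i k) - s) \<longlonglongrightarrow> 0"
          unfolding mult_zero_right
          by (rule Lim_null_comparison[rotated]) (use close in \<open>simp add: always_eventually\<close>)
        then have lim: "(\<lambda>k. ?g k (i k)) \<longlonglongrightarrow> s" by (simp add: LIM_zero_iff)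
        have "(\<lambda>k. f (?g k (i k)) \<omega>) \<longlonglongrightarrow> f s \<omega>"
          using continuous_on_tendsto_compose[OF cf lim s] gb[OF i2] by auto
        then have "f s \<omega> \<le> Q \<omega>" by (rule LIMSEQ_le_const2) (use fQ[OF i2] in auto)
        then show "\<bar>(Z s \<omega> - Z u \<omega>) $ r\<bar> \<le> Q \<omega>" unfolding f_def .
      qed
    qed
  qed
qed

text \<open>The bound for one component without its factor \<open>sqrt (v - u) powr q\<close>; one
  dimension factor comes from \<open>sum_powr_le\<close>, the other from the number of
  components.\<close>

definition K_sup :: "real \<Rightarrow> real" where
  "K_sup q = real CARD('d) powr q * (real CARD('d) * (4 * exp (1 / 4) * (2 * q) powr q * (m_dim * c) powr q))"

lemma K_sup_nonneg: "0 \<le> K_sup q"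
  unfolding K_sup_def by simp

lemma Z_sup:
  assumes uv: "t0 \<le> u" "u < v" "v \<le> T" and q: "0 < q"
  shows "\<exists>Q. Q \<in> borel_measurable M \<and> (\<forall>\<omega>. 0 \<le> Q \<omega>) \<and>
    (AE \<omega> in M. \<forall>s\<in>{u..v}. norm (Z s \<omega> - Z u \<omega>) \<le> Q \<omega>) \<and>
    (\<integral>\<^sup>+\<omega>. ennreal (Q \<omega> powr q) \<partial>M) \<le> ennreal (K_sup q * sqrt (v - u) powr q)"
proof -
  let ?C = "4 * exp (1 / 4) * (2 * q) powr q * (m_dim * c * sqrt (v - u)) powr q"
  let ?P = "\<lambda>r Q. Q \<in> borel_measurable M \<and> (\<forall>\<omega>. 0 \<le> Q \<omega>) \<and>
    (AE \<omega> in M. \<forall>s\<in>{u..v}. \<bar>(Z s \<omega> - Z u \<omega>) $ r\<bar> \<le> Q \<omega>) \<and>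
    (\<integral>\<^sup>+\<omega>. ennreal (Q \<omega> powr q) \<partial>M) \<le> ennreal ?C"
  have "\<forall>r. \<exists>Q. ?P r Q" by (intro allI Z_sup_component[OF uv q])
  from choice[OF this] obtain Q where Q': "\<forall>r. ?P r (Q r)" by (elim exE)
  have Qm[measurable]: "Q r \<in> borel_measurable M" and Q0: "0 \<le> Q r \<omega>"
    and QZ: "AE \<omega> in M. \<forall>s\<in>{u..v}. \<bar>(Z s \<omega> - Z u \<omega>) $ r\<bar> \<le> Q r \<omega>"
    and QC: "(\<integral>\<^sup>+\<omega>. ennreal (Q r \<omega> powr q) \<partial>M) \<le> ennreal ?C" for r \<omega>
    using Q' by auto
  let ?R = "\<lambda>\<omega>. \<Sum>r\<in>UNIV. Q r \<omega>"
  show ?thesis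
  proof (intro exI[of _ ?R] conjI allI)
    show "?R \<in> borel_measurable M" by measurable
    show "0 \<le> ?R \<omega>" for \<omega> using Q0 by (intro sum_nonneg) auto
    have "AE \<omega> in M. \<forall>r\<in>UNIV. \<forall>s\<in>{u..v}. \<bar>(Z s \<omega> - Z u \<omega>) $ r\<bar> \<le> Q r \<omega>"
      by (rule AE_ball_countable'[OF QZ countable_finite[OF finite]])
    then show "AE \<omega> in M. \<forall>s\<in>{u..v}. norm (Z s \<omega> - Z u \<omega>) \<le> ?R \<omega>"
    proof eventually_elim
      case (elim \<omega>)
      show ?case
      proof
        fix s assume "s \<in> {u..v}"
        then have "(\<Sum>r\<in>UNIV. \<bar>(Z s \<omega> - Z u \<omega>) $ r\<bar>) \<le> ?R \<omega>" using elim by (intro sum_mono) auto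
        then show "norm (Z s \<omega> - Z u \<omega>) \<le> ?R \<omega>"
          using norm_le_l1_cart[of "Z s \<omega> - Z u \<omega>"] by (rule order_trans[rotated])
      qed
    qed
    have "(\<integral>\<^sup>+\<omega>. ennreal (?R \<omega> powr q) \<partial>M)
        \<le> (\<integral>\<^sup>+\<omega>. ennreal (real CARD('d) powr q) * (\<Sum>r\<in>UNIV. ennreal (Q r \<omega> powr q)) \<partial>M)"
    proof (rule nn_integral_mono)
      fix \<omega>
      have "?R \<omega> powr q \<le> real CARD('d) powr q * (\<Sum>r\<in>UNIV. Q r \<omega> powr q)"
        using Q0 q by (intro sum_powr_le) auto
      then have "ennreal (?R \<omega> powr q) \<le> ennreal (real CARD('d) powr q * (\<Sum>r\<in>UNIV. Q r \<omega> powr q))"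
        by (rule ennreal_leI)
      then show "ennreal (?R \<omega> powr q) \<le> ennreal (real CARD('d) powr q) * (\<Sum>r\<in>UNIV. ennreal (Q r \<omega> powr q))"
        by (simp add: ennreal_mult sum_nonneg)
    qed
    also have "\<dots> = ennreal (real CARD('d) powr q) * (\<Sum>r\<in>UNIV. \<integral>\<^sup>+\<omega>. ennreal (Q r \<omega> powr q) \<partial>M)"
      by (subst nn_integral_cmult, measurable, subst nn_integral_sum, measurable)
    also have "\<dots> \<le> ennreal (real CARD('d) powr q) * (\<Sum>r\<in>(UNIV::'d set). ennreal ?C)"
      by (intro mult_left_mono sum_mono QC) auto
    also have "\<dots> = ennreal (real CARD('d) powr q * (\<Sum>r\<in>(UNIV::'d set). ?C))"
    proof -
      have "(\<Sum>r\<in>(UNIV::'d set). ennreal ?C) = ennreal (\<Sum>r\<in>(UNIV::'d set). ?C)"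
        by (rule sum_ennreal) simp
      then show ?thesis by (simp only:) (rule ennreal_mult[symmetric], simp, intro sum_nonneg, simp)
    qed
    also have "real CARD('d) powr q * (\<Sum>r\<in>(UNIV::'d set). ?C) = K_sup q * sqrt (v - u) powr q"
    proof -
      have "(m_dim * c * sqrt (v - u)) powr q = (m_dim * c) powr q * sqrt (v - u) powr q"
        by (rule powr_mult)
      then show ?thesis unfolding K_sup_def by simp
    qed
    finally show "(\<integral>\<^sup>+\<omega>. ennreal (?R \<omega> powr q) \<partial>M) \<le> ennreal (K_sup q * sqrt (v - u) powr q)" .
  qed
qed

end

section \<open>Convergence of the scheme\<close>

lemma powr_add3_le:
  fixes x y z q :: real
  assumes "0 \<le> x" "0 \<le> y" "0 \<le> z" "0 < q"
  shows "(x + y + z) powr q \<le> 3 powr q * (x powr q + y powr q + z powr q)"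
proof -
  define f where "f i = (if i = 0 then x else if i = 1 then y else z)" for i :: nat
  have "(\<Sum>i<3. f i) powr q \<le> real (card {..<3::nat}) powr q * (\<Sum>i<3. f i powr q)"
    using assms by (intro sum_powr_le) (auto simp: f_def)
  then show ?thesis by (simp add: f_def eval_nat_numeral)
qed

text \<open>Jensen's inequality for \<open>x powr p\<close> with the normalised weights
  \<open>w i / S\<close>; multiplying by \<open>S powr p\<close> leaves
  \<open>S powr (p - 1)\<close>.\<close>

lemma weighted_sum_powr_le_pos:
  fixes w x :: "'i \<Rightarrow> real"
  assumes I: "finite I" and w: "\<And>i. i \<in> I \<Longrightarrow> 0 \<le> w i" and x: "\<And>i. i \<in> I \<Longrightarrow> 0 < x i"
    and S: "(\<Sum>i\<in>I. w i) = S" "0 < S" and p: "1 \<le> p"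
  shows "(\<Sum>i\<in>I. w i * x i) powr p \<le> S powr (p - 1) * (\<Sum>i\<in>I. w i * x i powr p)"
proof -
  have ne: "I \<noteq> {}" using S by auto
  have "(\<Sum>i\<in>I. (w i / S) *\<^sub>R x i) powr p \<le> (\<Sum>i\<in>I. (w i / S) * x i powr p)"
  proof (rule convex_on_sum[OF I ne powr_convex[OF p]])
    show "(\<Sum>i\<in>I. w i / S) = 1" using S by (simp add: sum_divide_distrib[symmetric])
  qed (use w x S in auto)
  moreover have "(\<Sum>i\<in>I. (w i / S) *\<^sub>R x i) = (\<Sum>i\<in>I. w i * x i) / S"
    by (simp add: sum_divide_distrib)
  moreover have "(\<Sum>i\<in>I. (w i / S) * x i powr p) = (\<Sum>i\<in>I. w i * x i powr p) / S"
    by (simp add: sum_divide_distrib)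
  ultimately have "((\<Sum>i\<in>I. w i * x i) / S) powr p \<le> (\<Sum>i\<in>I. w i * x i powr p) / S" by metis
  then have "S powr p * ((\<Sum>i\<in>I. w i * x i) / S) powr p \<le> S powr p * ((\<Sum>i\<in>I. w i * x i powr p) / S)"
    by (rule mult_left_mono) simp
  moreover have "S powr p * ((\<Sum>i\<in>I. w i * x i) / S) powr p = (\<Sum>i\<in>I. w i * x i) powr p"
    using S(2) by (simp add: powr_mult[symmetric])
  moreover have "S powr p * ((\<Sum>i\<in>I. w i * x i powr p) / S) = S powr (p - 1) * (\<Sum>i\<in>I. w i * x i powr p)"
    using S(2) by (simp add: powr_diff)
  ultimately show ?thesis by simp
qed

text \<open>Terms with \<open>x i = 0\<close> vanish on both sides and are dropped, which leaves
  strictly positive points; remaining weights of total 0 are treated apart, as they cannot be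
  normalised.\<close>

lemma weighted_sum_powr_le:
  fixes w x :: "'i \<Rightarrow> real"
  assumes I: "finite I" and w: "\<And>i. i \<in> I \<Longrightarrow> 0 \<le> w i" and x: "\<And>i. i \<in> I \<Longrightarrow> 0 \<le> x i"
    and p: "1 \<le> p"
  shows "(\<Sum>i\<in>I. w i * x i) powr p \<le> (\<Sum>i\<in>I. w i) powr (p - 1) * (\<Sum>i\<in>I. w i * x i powr p)"
proof -
  define J where "J = {i \<in> I. 0 < x i}"
  have J: "finite J" "J \<subseteq> I" using I by (auto simp: J_def)
  have x0: "x i = 0" if "i \<in> I - J" for i using that x[of i] by (auto simp: J_def)
  have e1: "(\<Sum>i\<in>I. w i * x i) = (\<Sum>i\<in>J. w i * x i)"
    using I J(2) x0 by (intro sum.mono_neutral_right) auto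
  have e2: "(\<Sum>i\<in>I. w i * x i powr p) = (\<Sum>i\<in>J. w i * x i powr p)"
    using I J(2) x0 by (intro sum.mono_neutral_right) auto
  have wJ: "0 \<le> (\<Sum>i\<in>J. w i)" using w J(2) by (intro sum_nonneg) auto
  show ?thesis
  proof (cases "(\<Sum>i\<in>J. w i) = 0")
    case True
    then have "\<forall>i\<in>J. w i = 0" using w J by (subst (asm) sum_nonneg_eq_0_iff) auto
    then show ?thesis unfolding e1 e2 by simp
  next
    case False
    then have "(\<Sum>i\<in>J. w i * x i) powr p \<le> (\<Sum>i\<in>J. w i) powr (p - 1) * (\<Sum>i\<in>J. w i * x i powr p)"
      using w wJ J p by (intro weighted_sum_powr_le_pos) (auto simp: J_def)
    also have "\<dots> \<le> (\<Sum>i\<in>I. w i) powr (p - 1) * (\<Sum>i\<in>J. w i * x i powr p)"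
      using w wJ J p I by (intro mult_right_mono powr_mono2 sum_mono2 sum_nonneg) auto
    finally show ?thesis unfolding e1 e2 .
  qed
qed

section \<open>The centred part of the one-step error\<close>

locale srk_approximation = additive_sde M F a t0 T c W b X0 X + additive_srk a t0 T c \<alpha> c0 A0
  for M :: "'a measure" and F and a :: "real \<Rightarrow> real^'d \<Rightarrow> real^'d" and t0 T c :: real
    and W :: "'m::finite \<Rightarrow> real \<Rightarrow> 'a \<Rightarrow> real" and b :: "'m \<Rightarrow> real \<Rightarrow> real^'d"
    and X0 :: "'a \<Rightarrow> real^'d" and X :: "real \<Rightarrow> 'a \<Rightarrow> real^'d"
    and \<alpha> c0 :: "real^'s" and A0 :: "real^'s^'s" +
  fixes \<beta> c1 :: "real^'s"
  assumes c1_range: "\<And>i. c1 $ i \<in> {0..1}" and \<beta>_sum: "\<beta> \<bullet> 1 = 1"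
begin

definition noise :: "real \<Rightarrow> real \<Rightarrow> 'a \<Rightarrow> real^'d" where
  "noise u v \<omega> = (\<Sum>i\<in>UNIV. \<Sum>k\<in>UNIV. (\<beta> $ i * (W k v \<omega> - W k u \<omega>)) *\<^sub>R b k (u + c1 $ i * (v - u)))"

definition \<beta>_norm :: real where "\<beta>_norm = (\<Sum>i\<in>UNIV. \<bar>\<beta> $ i\<bar>)"

text \<open>The first summand belongs to the gradient term: \<open>CARD('d)\<close> directions,
  derivatives bounded by \<open>c\<close>, and time integrals with deviation factor
  \<open>m_dim * c\<close>. The second belongs to the noise error.\<close>

definition K_mart :: real where
  "K_mart = real CARD('d) * (c * (m_dim * c)) + m_dim * ((\<beta>_norm + 1) * c)"

lemma K_mart_pos: "0 < K_mart"
proof -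
  have "0 \<le> \<beta>_norm" unfolding \<beta>_norm_def by (intro sum_nonneg) auto
  then have "0 < m_dim * ((\<beta>_norm + 1) * c)" using m_dim_pos c_pos by simp
  moreover have "0 \<le> real CARD('d) * (c * (m_dim * c))" using m_dim_pos c_pos by simp
  ultimately show ?thesis unfolding K_mart_def by linarith
qed

text \<open>The coefficients \<kappa> are the quadratures of \<open>b\<close> that the scheme uses.
  As \<beta> sums to 1, \<open>b k s $ r - \<kappa> k\<close> is a weighted sum of differences of
  \<open>b\<close> within one step, of order \<open>v - u\<close> by the bound on the derivative.
  This factor raises the deviation from \<open>sqrt (v - u)\<close> to the power 3/2.\<close>

lemma noise_residual_subg:
  assumes uv: "t0 \<le> u" "u < v" "v \<le> T"
  shows "subg u v (m_dim * ((\<beta>_norm + 1) * c * (v - u) * sqrt (v - u)))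
    (\<lambda>\<omega>. (Z v \<omega> - Z u \<omega> - noise u v \<omega>) $ r)"
proof -
  define \<kappa> where "\<kappa> k = (\<Sum>i\<in>UNIV. \<beta> $ i * b k (u + c1 $ i * (v - u)) $ r)" for k
  have \<beta>1: "(\<Sum>i\<in>UNIV. \<beta> $ i) = 1" using \<beta>_sum by (simp add: inner_vec_def)
  have \<beta>0: "0 \<le> \<beta>_norm" unfolding \<beta>_norm_def by (intro sum_nonneg) auto
  have "\<bar>b k s $ r - \<kappa> k\<bar> \<le> (\<beta>_norm + 1) * c * (v - u)" if s: "s \<in> {u..v}" for k s
  proof -
    have "b k s $ r = (\<Sum>i\<in>UNIV. \<beta> $ i * b k s $ r)"
      unfolding sum_distrib_right[symmetric] \<beta>1 by simp
    then have "b k s $ r - \<kappa> k = (\<Sum>i\<in>UNIV. \<beta> $ i * (b k s - b k (u + c1 $ i * (v - u))) $ r)"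
      unfolding \<kappa>_def by (simp add: sum_subtractf right_diff_distrib)
    also have "norm \<dots> \<le> (\<Sum>i\<in>UNIV. \<bar>\<beta> $ i\<bar> * (c * (v - u)))"
    proof (intro sum_norm_le)
      fix i
      have c: "0 \<le> c1 $ i * (v - u)" "c1 $ i * (v - u) \<le> v - u"
        using mult_right_mono[of "c1 $ i" 1 "v - u"] c1_range[of i] uv by auto
      have t: "u + c1 $ i * (v - u) \<in> {t0..T}"
        unfolding atLeastAtMost_iff using c uv by (intro conjI; linarith)
      have t': "\<bar>s - (u + c1 $ i * (v - u))\<bar> \<le> v - u"
        using c s[unfolded atLeastAtMost_iff] by linarith
      have "\<bar>(b k s - b k (u + c1 $ i * (v - u))) $ r\<bar> \<le> norm (b k s - b k (u + c1 $ i * (v - u)))"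
        by (rule component_le_norm_cart)
      also have "\<dots> \<le> c * \<bar>s - (u + c1 $ i * (v - u))\<bar>"
        using s uv by (intro b_lipschitz t) auto
      also have "\<dots> \<le> c * (v - u)" using c_pos t' by (intro mult_left_mono) auto
      finally show "norm (\<beta> $ i * (b k s - b k (u + c1 $ i * (v - u))) $ r) \<le> \<bar>\<beta> $ i\<bar> * (c * (v - u))"
        unfolding real_norm_def abs_mult by (rule mult_left_mono) simp
    qed
    also have "\<dots> = \<beta>_norm * (c * (v - u))" unfolding \<beta>_norm_def by (simp only: sum_distrib_right)
    \<comment> \<open>The added 1 makes the bound strictly positive, as deviations have to be,
      without a lower estimate of \<open>\<beta>_norm\<close>.\<close>
    also have "\<dots> \<le> (\<beta>_norm + 1) * (c * (v - u))" using c_pos uv by (intro mult_right_mono) auto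
    finally show ?thesis by (simp add: mult.assoc)
  qed
  moreover have "0 < (\<beta>_norm + 1) * c * (v - u)" using \<beta>0 c_pos uv by simp
  ultimately have "subg u v (m_dim * ((\<beta>_norm + 1) * c * (v - u) * sqrt (v - u)))
    (\<lambda>\<omega>. (Z v \<omega> - Z u \<omega>) $ r - (\<Sum>k\<in>UNIV. \<kappa> k * (W k v \<omega> - W k u \<omega>)))"
    using uv by (intro Z_increment_subg) auto
  moreover have "(\<Sum>k\<in>UNIV. \<kappa> k * (W k v \<omega> - W k u \<omega>)) = noise u v \<omega> $ r" for \<omega>
  proof -
    have "noise u v \<omega> $ r = (\<Sum>i\<in>UNIV. \<Sum>k\<in>UNIV. \<beta> $ i * (W k v \<omega> - W k u \<omega>) * b k (u + c1 $ i * (v - u)) $ r)"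
      unfolding noise_def by simp
    also have "\<dots> = (\<Sum>k\<in>UNIV. \<Sum>i\<in>UNIV. \<beta> $ i * (W k v \<omega> - W k u \<omega>) * b k (u + c1 $ i * (v - u)) $ r)"
      by (rule sum.swap)
    finally show ?thesis unfolding \<kappa>_def sum_distrib_right by (simp add: mult_ac)
  qed
  ultimately show ?thesis by simp
qed

text \<open>The derivatives at \<open>X u\<close> are bounded and \<open>F u\<close>-measurable, so
  they may multiply the time integrals of the increments of \<open>Z\<close>. These products and the
  noise error have the same order \<open>(v - u) * sqrt (v - u)\<close>.\<close>

lemma martingale_subg:
  assumes uv: "t0 \<le> u" "u < v" "v \<le> T"
  shows "subg u v (K_mart * ((v - u) * sqrt (v - u)))
    (\<lambda>\<omega>. one_step_martingale (\<lambda>s. X s \<omega>) (noise u v \<omega>) u v $ r)"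
proof -
  have u: "u \<in> {t0..T}" using uv by auto
  have "subg u v (\<Sum>q\<in>(UNIV::'d set). c * ((v - u) * (m_dim * c * sqrt (v - u))))
    (\<lambda>\<omega>. \<Sum>q\<in>UNIV. (space_deriv q a u (X u \<omega>) $ r) * integral {u..v} (\<lambda>s. (Z s \<omega> - Z u \<omega>) $ q))"
  proof (intro subg_sum)
    fix q
    have "continuous_on ({t0..T} \<times> UNIV) (\<lambda>(t, x). space_deriv q a t x)"
      using C12 unfolding C12_on_def by blast
    then have "continuous_on UNIV (\<lambda>x. (\<lambda>(t, x). space_deriv q a t x) (u, x))"
      by (rule continuous_on_compose2) (use u in \<open>auto intro!: continuous_intros\<close>)
    then have "continuous_on UNIV (\<lambda>x. space_deriv q a u x)" by simp
    then have "(\<lambda>\<omega>. space_deriv q a u (X u \<omega>)) \<in> borel_measurable (F u)"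
      by (rule borel_measurable_continuous_on[OF _ X_adapted[OF u]])
    then have A: "(\<lambda>\<omega>. space_deriv q a u (X u \<omega>) $ r) \<in> borel_measurable (F u)"
      by (rule vec_nth_measurable)
    have "\<bar>space_deriv q a u (X u \<omega>) $ r\<bar> \<le> c" for \<omega>
      using order_trans[OF component_le_norm_cart space1[OF u]] .
    from subg_mult_bounded[OF Z_integral_subg[OF uv] A this c_pos]
    show "subg u v (c * ((v - u) * (m_dim * c * sqrt (v - u))))
      (\<lambda>\<omega>. (space_deriv q a u (X u \<omega>) $ r) * integral {u..v} (\<lambda>s. (Z s \<omega> - Z u \<omega>) $ q))" .
  qed auto
  from subg_add[OF this noise_residual_subg[OF uv, of r]]
  have "subg u v (K_mart * ((v - u) * sqrt (v - u)))
    (\<lambda>\<omega>. (\<Sum>q\<in>UNIV. (space_deriv q a u (X u \<omega>) $ r) * integral {u..v} (\<lambda>s. (Z s \<omega> - Z u \<omega>) $ q))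
       + (Z v \<omega> - Z u \<omega> - noise u v \<omega>) $ r)"
    unfolding K_mart_def by (simp add: algebra_simps)
  moreover have "one_step_martingale (\<lambda>s. X s \<omega>) (noise u v \<omega>) u v $ r
    = (\<Sum>q\<in>UNIV. (space_deriv q a u (X u \<omega>) $ r) * integral {u..v} (\<lambda>s. (Z s \<omega> - Z u \<omega>) $ q))
       + (Z v \<omega> - Z u \<omega> - noise u v \<omega>) $ r" for \<omega>
    unfolding one_step_martingale_def Z_def by (simp add: mult.commute)
  ultimately show ?thesis by simp
qed

abbreviation Y :: "(nat \<Rightarrow> real) \<Rightarrow> nat \<Rightarrow> 'a \<Rightarrow> real^'d" where
  "Y \<equiv> srk_additive a b \<alpha> \<beta> A0 c0 c1 W X0"

lemma Y_Suc:
  "Y \<tau> (Suc n) \<omega> = Y \<tau> n \<omega> + srk_drift (\<tau> n) (\<tau> (Suc n) - \<tau> n) (Y \<tau> n \<omega>) + noise (\<tau> n) (\<tau> (Suc n)) \<omega>"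
  by (simp add: srk_step_def srk_drift_def noise_def)

section \<open>Measurability of the approximations\<close>

text \<open>With implicit stages there is no formula from which measurability could be read off; it
  comes from continuity, which follows from the Lipschitz dependence of the stages on the starting
  value.\<close>

lemma srk_drift_continuous:
  assumes t: "t0 \<le> t" "0 \<le> h" "t + h \<le> T" and h: "c * A0_norm * h \<le> 1 / 2"
  shows "continuous_on UNIV (srk_drift t h)"
proof -
  have "continuous_on UNIV (srk_stages a A0 c0 t h)"
  proof (rule continuous_on_iff[THEN iffD2], intro ballI allI impI)
    fix y :: "real^'d" and e :: real assume e: "0 < e"
    let ?d = "e / (2 * real CARD('s) + 1)"
    have "dist (srk_stages a A0 c0 t h y') (srk_stages a A0 c0 t h y) < e" if "dist y' y < ?d" for y'
    proof -
      have "dist (srk_stages a A0 c0 t h y') (srk_stages a A0 c0 t h y) \<le> 2 * real CARD('s) * dist y' y"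
        using stages(2)[OF t h] by (simp add: dist_norm)
      also have "\<dots> \<le> (2 * real CARD('s) + 1) * dist y' y" by (intro mult_right_mono) auto
      also have "\<dots> < e" using that by (simp add: pos_less_divide_eq mult.commute)
      finally show ?thesis .
    qed
    then show "\<exists>d>0. \<forall>y'\<in>UNIV. dist y' y < d \<longrightarrow> dist (srk_stages a A0 c0 t h y') (srk_stages a A0 c0 t h y) < e"
      using e by (intro exI[of _ ?d]) (auto intro!: divide_pos_pos add_nonneg_pos)
  qed
  then have s: "continuous_on UNIV (\<lambda>y. srk_stages a A0 c0 t h y $ i)" for i by (intro continuous_intros)
  have "continuous_on UNIV (\<lambda>y. a (t + c0 $ i * h) (srk_stages a A0 c0 t h y $ i))" for i
  proof -
    have "continuous_on ({t0..T} \<times> UNIV) (\<lambda>(t, x). a t x)" using C12 unfolding C12_on_def by blast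
    then have "continuous_on UNIV (\<lambda>y. (\<lambda>(t, x). a t x) (t + c0 $ i * h, srk_stages a A0 c0 t h y $ i))"
      by (rule continuous_on_compose2[OF _ continuous_on_Pair[OF continuous_on_const s]])
        (use stage_time[OF t] in auto)
    then show ?thesis by simp
  qed
  then show ?thesis unfolding srk_drift_def[abs_def] by (intro continuous_intros)
qed

lemma Y_measurable:
  assumes X0: "X0 \<in> borel_measurable M" and g: "grid t0 T N \<tau>"
    and h: "\<And>n. n < N \<Longrightarrow> \<tau> (Suc n) - \<tau> n \<le> h" "c * A0_norm * h \<le> 1 / 2" and n: "n \<le> N"
  shows "Y \<tau> n \<in> borel_measurable M"
  using n
proof (induction n)
  case 0
  have "Y \<tau> 0 = X0" by (simp add: fun_eq_iff)
  then show ?case using X0 by simp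
next
  case (Suc n)
  then have n: "n < N" by simp
  have b: "t0 \<le> \<tau> n" "\<tau> n < \<tau> (Suc n)" "\<tau> (Suc n) \<le> T"
    using grid_bounds[OF g, of n] grid_bounds[OF g, of "Suc n"] g n unfolding grid_def by auto
  have hn: "c * A0_norm * (\<tau> (Suc n) - \<tau> n) \<le> 1 / 2"
    using order_trans[OF mult_left_mono[OF h(1)[OF n], of "c * A0_norm"] h(2)] c_pos A0_norm_nonneg by simp
  have IH: "Y \<tau> n \<in> borel_measurable M" using Suc by simp
  have "(\<lambda>\<omega>. srk_drift (\<tau> n) (\<tau> (Suc n) - \<tau> n) (Y \<tau> n \<omega>)) \<in> borel_measurable M"
    by (rule borel_measurable_continuous_on[OF srk_drift_continuous[OF _ _ _ hn] IH]) (use b in auto)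
  moreover have "noise (\<tau> n) (\<tau> (Suc n)) \<in> borel_measurable M"
  proof -
    have "W k s \<in> borel_measurable M" if "0 \<le> s" for k s
      using filtered_wiener.wiener_measurable[OF filtered_wiener that] .
    then show ?thesis unfolding noise_def[abs_def] using b t0_nonneg
      by (intro borel_measurable_sum borel_measurable_scaleR borel_measurable_times borel_measurable_diff
          borel_measurable_const) auto
  qed
  ultimately show ?case unfolding Y_Suc[abs_def] using IH by (intro borel_measurable_add)
qed

end

section \<open>Moments of the terms in the pathwise error bound\<close>

context srk_approximation
begin

text \<open>The squared deviation of a step is \<open>K_mart^2\<close> times the third power of its
  length; two of the three factors are bounded by \<open>h\<close>, and the last one sums to
  \<open>T - t0\<close>.\<close>

lemma martingale_max_moment:
  assumes g: "grid t0 T N \<tau>" and h: "\<forall>n<N. \<tau> (Suc n) - \<tau> n \<le> h" "0 < h" and p: "0 < p"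
  shows "(\<integral>\<^sup>+\<omega>. ennreal (Max ((\<lambda>n. \<bar>\<Sum>j<n. one_step_martingale (\<lambda>s. X s \<omega>)
      (noise (\<tau> j) (\<tau> (Suc j)) \<omega>) (\<tau> j) (\<tau> (Suc j)) $ r\<bar>) ` {..N}) powr p) \<partial>M)
    \<le> ennreal (4 * exp (1 / 4) * (2 * p) powr p * (K_mart * h * sqrt (T - t0)) powr p)"
proof (rule subg_max_moment[where t=\<tau> and \<sigma>="\<lambda>j. K_mart * ((\<tau> (Suc j) - \<tau> j) * sqrt (\<tau> (Suc j) - \<tau> j))"])
  note b = grid_bounds[OF g]
  have lt: "\<tau> j < \<tau> (Suc j)" if "j < N" for j using g that unfolding grid_def by blast
  show "subg (\<tau> n) (\<tau> (Suc n)) (K_mart * ((\<tau> (Suc n) - \<tau> n) * sqrt (\<tau> (Suc n) - \<tau> n)))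
      (\<lambda>\<omega>. one_step_martingale (\<lambda>s. X s \<omega>) (noise (\<tau> n) (\<tau> (Suc n)) \<omega>) (\<tau> n) (\<tau> (Suc n)) $ r)"
    if "n < N" for n
    using b(1)[of n] b(2)[of "Suc n"] lt[OF that] that by (intro martingale_subg) auto
  show "0 \<le> \<tau> n" if "n \<le> N" for n using b(1)[OF that] t0_nonneg by linarith
  have "(\<Sum>j<N. (K_mart * ((\<tau> (Suc j) - \<tau> j) * sqrt (\<tau> (Suc j) - \<tau> j)))\<^sup>2)
      \<le> (\<Sum>j<N. (K_mart * h)\<^sup>2 * (\<tau> (Suc j) - \<tau> j))"
  proof (intro sum_mono)
    fix j assume "j \<in> {..<N}"
    then have j: "j < N" by simp
    let ?d = "\<tau> (Suc j) - \<tau> j"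
    have d: "0 < ?d" "?d \<le> h" using lt[OF j] h(1)[rule_format, OF j] by auto
    have "(K_mart * (?d * sqrt ?d))\<^sup>2 = (K_mart * ?d)\<^sup>2 * ?d"
      using d(1) by (simp add: power_mult_distrib)
    also have "\<dots> \<le> (K_mart * h)\<^sup>2 * ?d"
      using d K_mart_pos by (intro mult_right_mono power_mono mult_left_mono) auto
    finally show "(K_mart * (?d * sqrt ?d))\<^sup>2 \<le> (K_mart * h)\<^sup>2 * ?d" .
  qed
  also have "\<dots> = (K_mart * h)\<^sup>2 * (T - t0)"
    using g by (simp only: sum_distrib_left[symmetric] sum_lessThan_telescope grid_def)
  also have "\<dots> = (K_mart * h * sqrt (T - t0))\<^sup>2" using t0_T by (simp add: power_mult_distrib)
  finally show "(\<Sum>j<N. (K_mart * ((\<tau> (Suc j) - \<tau> j) * sqrt (\<tau> (Suc j) - \<tau> j)))\<^sup>2)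
      \<le> (K_mart * h * sqrt (T - t0))\<^sup>2" .
  show "0 < K_mart * h * sqrt (T - t0)" using K_mart_pos h(2) t0_T by simp
qed (rule p)

lemma martingale_norm_moment:
  assumes g: "grid t0 T N \<tau>" and h: "\<forall>n<N. \<tau> (Suc n) - \<tau> n \<le> h" "0 < h" and p: "0 < p"
  shows "\<exists>m. m \<in> borel_measurable M \<and> (\<forall>\<omega>. 0 \<le> m \<omega>) \<and>
    (\<forall>\<omega>. \<forall>n\<le>N. norm (\<Sum>j<n. one_step_martingale (\<lambda>s. X s \<omega>) (noise (\<tau> j) (\<tau> (Suc j)) \<omega>) (\<tau> j) (\<tau> (Suc j))) \<le> m \<omega>) \<and>
    (\<integral>\<^sup>+\<omega>. ennreal (m \<omega> powr p) \<partial>M)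
      \<le> ennreal (real CARD('d) powr p * (real CARD('d) * (4 * exp (1 / 4) * (2 * p) powr p * (K_mart * sqrt (T - t0)) powr p)) * h powr p)"
proof -
  let ?D = "\<lambda>j \<omega>. one_step_martingale (\<lambda>s. X s \<omega>) (noise (\<tau> j) (\<tau> (Suc j)) \<omega>) (\<tau> j) (\<tau> (Suc j))"
  let ?C = "4 * exp (1 / 4) * (2 * p) powr p * (K_mart * h * sqrt (T - t0)) powr p"
  define m where "m r \<omega> = Max ((\<lambda>n. \<bar>\<Sum>j<n. ?D j \<omega> $ r\<bar>) ` {..N})" for r \<omega>
  have D_meas: "(\<lambda>\<omega>. ?D j \<omega> $ r) \<in> borel_measurable M" if "j < N" for j r
  proof -
    have "\<tau> j < \<tau> (Suc j)" using g that unfolding grid_def by blast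
    then show ?thesis
      using grid_bounds(1)[OF g, of j] grid_bounds(2)[OF g, of "Suc j"] that
      by (intro subgD(6)[OF martingale_subg]) auto
  qed
  have mM[measurable]: "m r \<in> borel_measurable M" for r
    unfolding m_def[abs_def] by (intro borel_measurable_Max borel_measurable_abs borel_measurable_sum D_meas) auto
  have mge: "\<bar>\<Sum>j<n. ?D j \<omega> $ r\<bar> \<le> m r \<omega>" if "n \<le> N" for n r \<omega>
    unfolding m_def using that by (intro Max_ge) auto
  have m0: "0 \<le> m r \<omega>" for r \<omega> using mge[of 0 \<omega> r] by simp
  let ?m = "\<lambda>\<omega>. \<Sum>r\<in>UNIV. m r \<omega>"
  have "norm (\<Sum>j<n. ?D j \<omega>) \<le> ?m \<omega>" if "n \<le> N" for n \<omega>
  proof (rule order_trans[OF norm_le_l1_cart sum_mono])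
    show "\<bar>(\<Sum>j<n. ?D j \<omega>) $ r\<bar> \<le> m r \<omega>" for r unfolding sum_component by (rule mge[OF that])
  qed
  moreover have "(\<integral>\<^sup>+\<omega>. ennreal (?m \<omega> powr p) \<partial>M)
      \<le> ennreal (real CARD('d) powr p * (real CARD('d) * (4 * exp (1 / 4) * (2 * p) powr p * (K_mart * sqrt (T - t0)) powr p)) * h powr p)"
  proof -
    have "(\<integral>\<^sup>+\<omega>. ennreal (?m \<omega> powr p) \<partial>M)
        \<le> (\<integral>\<^sup>+\<omega>. ennreal (real CARD('d) powr p) * (\<Sum>r\<in>UNIV. ennreal (m r \<omega> powr p)) \<partial>M)"
    proof (rule nn_integral_mono)
      fix \<omega>
      have "?m \<omega> powr p \<le> real CARD('d) powr p * (\<Sum>r\<in>UNIV. m r \<omega> powr p)"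
        using m0 p by (intro sum_powr_le) auto
      then have "ennreal (?m \<omega> powr p) \<le> ennreal (real CARD('d) powr p * (\<Sum>r\<in>UNIV. m r \<omega> powr p))"
        by (rule ennreal_leI)
      then show "ennreal (?m \<omega> powr p) \<le> ennreal (real CARD('d) powr p) * (\<Sum>r\<in>UNIV. ennreal (m r \<omega> powr p))"
        by (simp add: ennreal_mult sum_nonneg)
    qed
    also have "\<dots> = ennreal (real CARD('d) powr p) * (\<Sum>r\<in>UNIV. \<integral>\<^sup>+\<omega>. ennreal (m r \<omega> powr p) \<partial>M)"
      by (subst nn_integral_cmult, measurable, subst nn_integral_sum, measurable)
    also have "\<dots> \<le> ennreal (real CARD('d) powr p) * (\<Sum>r\<in>(UNIV::'d set). ennreal ?C)"
      unfolding m_def by (intro mult_left_mono sum_mono martingale_max_moment[OF g h p]) auto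
    also have "\<dots> = ennreal (real CARD('d) powr p * (\<Sum>r\<in>(UNIV::'d set). ?C))"
    proof -
      have "(\<Sum>r\<in>(UNIV::'d set). ennreal ?C) = ennreal (\<Sum>r\<in>(UNIV::'d set). ?C)"
        by (rule sum_ennreal) simp
      then show ?thesis by (simp only:) (rule ennreal_mult[symmetric], simp, intro sum_nonneg, simp)
    qed
    also have "(K_mart * h * sqrt (T - t0)) powr p = (K_mart * sqrt (T - t0)) powr p * h powr p"
      unfolding powr_mult[symmetric] by (simp add: mult_ac)
    finally show ?thesis by (simp add: mult_ac)
  qed
  moreover have "?m \<in> borel_measurable M" by measurable
  moreover have "0 \<le> ?m \<omega>" for \<omega> using m0 by (intro sum_nonneg) auto
  ultimately show ?thesis by (intro exI[of _ ?m] conjI allI impI)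
qed

text \<open>Jensen with the step sizes as weights, which sum to \<open>T - t0\<close>. A moment of
  order \<open>2 * p\<close> of the supremum over one step is of order \<open>h powr p\<close>, so
  the weighted sum of squares has the full order.\<close>

lemma step_sup_moment:
  assumes g: "grid t0 T N \<tau>" and h: "\<forall>n<N. \<tau> (Suc n) - \<tau> n \<le> h" and p: "1 \<le> p"
  shows "\<exists>Q. (\<forall>j<N. AE \<omega> in M. \<forall>s\<in>{\<tau> j..\<tau> (Suc j)}. norm (Z s \<omega> - Z (\<tau> j) \<omega>) \<le> Q j \<omega>) \<and>
    (\<lambda>\<omega>. \<Sum>j<N. (\<tau> (Suc j) - \<tau> j) * (Q j \<omega>)\<^sup>2) \<in> borel_measurable M \<and>
    (\<integral>\<^sup>+\<omega>. ennreal ((\<Sum>j<N. (\<tau> (Suc j) - \<tau> j) * (Q j \<omega>)\<^sup>2) powr p) \<partial>M)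
      \<le> ennreal ((T - t0) powr p * K_sup (2 * p) * h powr p)"
proof -
  let ?d = "\<lambda>j. \<tau> (Suc j) - \<tau> j"
  have d0: "0 < ?d j" if "j < N" for j using g that unfolding grid_def by simp
  let ?P = "\<lambda>j Q. Q \<in> borel_measurable M \<and> (\<forall>\<omega>. 0 \<le> Q \<omega>) \<and>
    (AE \<omega> in M. \<forall>s\<in>{\<tau> j..\<tau> (Suc j)}. norm (Z s \<omega> - Z (\<tau> j) \<omega>) \<le> Q \<omega>) \<and>
    (\<integral>\<^sup>+\<omega>. ennreal (Q \<omega> powr (2 * p)) \<partial>M) \<le> ennreal (K_sup (2 * p) * sqrt (?d j) powr (2 * p))"
  \<comment> \<open>Majorants exist for actual steps only; the implication lets the choice range
    over all indices at once.\<close>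
  have "\<forall>j. \<exists>Q. j < N \<longrightarrow> ?P j Q"
  proof
    fix j
    show "\<exists>Q. j < N \<longrightarrow> ?P j Q"
    proof (cases "j < N")
      case True
      have "\<exists>Q. ?P j Q"
        by (rule Z_sup) (use d0[OF True] grid_bounds(1)[OF g, of j] grid_bounds(2)[OF g, of "Suc j"] True p in auto)
      then show ?thesis by blast
    qed simp
  qed
  from choice[OF this] obtain Q where Q: "\<forall>j. j < N \<longrightarrow> ?P j (Q j)" by (elim exE)
  have QM: "Q j \<in> borel_measurable M" and Q0: "0 \<le> Q j \<omega>"
    and QZ: "AE \<omega> in M. \<forall>s\<in>{\<tau> j..\<tau> (Suc j)}. norm (Z s \<omega> - Z (\<tau> j) \<omega>) \<le> Q j \<omega>"
    and QC: "(\<integral>\<^sup>+\<omega>. ennreal (Q j \<omega> powr (2 * p)) \<partial>M) \<le> ennreal (K_sup (2 * p) * sqrt (?d j) powr (2 * p))"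
    if "j < N" for j \<omega> using Q[rule_format, OF that] by blast+
  let ?S = "\<lambda>\<omega>. \<Sum>j<N. ?d j * (Q j \<omega>)\<^sup>2"
  have S: "?S \<in> borel_measurable M"
    by (intro borel_measurable_sum borel_measurable_times borel_measurable_power borel_measurable_const QM) auto
  have sumd: "(\<Sum>j<N. ?d j) = T - t0" using g by (simp add: sum_lessThan_telescope grid_def)
  have sq: "sqrt (?d j) powr (2 * p) \<le> h powr p" if "j < N" for j
  proof -
    have "sqrt (?d j) powr (2 * p) = ?d j powr p"
      using d0[OF that] by (simp add: powr_half_sqrt[symmetric] powr_powr)
    also have "\<dots> \<le> h powr p" using d0[OF that] h[rule_format, OF that] p by (intro powr_mono2) auto
    finally show ?thesis .
  qed
  have "(\<integral>\<^sup>+\<omega>. ennreal (?S \<omega> powr p) \<partial>M)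
      \<le> (\<integral>\<^sup>+\<omega>. ennreal ((T - t0) powr (p - 1)) * (\<Sum>j<N. ennreal (?d j) * ennreal (Q j \<omega> powr (2 * p))) \<partial>M)"
  proof (rule nn_integral_mono)
    fix \<omega>
    have "?S \<omega> powr p \<le> (\<Sum>j<N. ?d j) powr (p - 1) * (\<Sum>j<N. ?d j * (Q j \<omega>)\<^sup>2 powr p)"
      using d0 p by (intro weighted_sum_powr_le) (auto simp: less_imp_le)
    also have "(\<Sum>j<N. ?d j * (Q j \<omega>)\<^sup>2 powr p) = (\<Sum>j<N. ?d j * Q j \<omega> powr (2 * p))"
    proof (intro sum.cong refl)
      fix j assume "j \<in> {..<N}"
      then have "0 \<le> Q j \<omega>" using Q0 by simp
      then have "(Q j \<omega>)\<^sup>2 powr p = Q j \<omega> powr (2 * p)"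
        by (cases "Q j \<omega> = 0") (simp_all add: powr_powr powr_numeral[symmetric] del: powr_numeral)
      then show "?d j * (Q j \<omega>)\<^sup>2 powr p = ?d j * Q j \<omega> powr (2 * p)" by simp
    qed
    finally have "ennreal (?S \<omega> powr p) \<le> ennreal ((T - t0) powr (p - 1) * (\<Sum>j<N. ?d j * Q j \<omega> powr (2 * p)))"
      unfolding sumd by (rule ennreal_leI)
    also have "\<dots> = ennreal ((T - t0) powr (p - 1)) * (\<Sum>j<N. ennreal (?d j) * ennreal (Q j \<omega> powr (2 * p)))"
    proof -
      have "(\<Sum>j<N. ennreal (?d j) * ennreal (Q j \<omega> powr (2 * p))) = (\<Sum>j<N. ennreal (?d j * Q j \<omega> powr (2 * p)))"
        using d0 by (intro sum.cong refl ennreal_mult[symmetric]) (auto simp: less_imp_le)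
      also have "\<dots> = ennreal (\<Sum>j<N. ?d j * Q j \<omega> powr (2 * p))"
        using d0 by (intro sum_ennreal) (auto simp: less_imp_le)
      finally show ?thesis using d0 by (simp only:) (rule ennreal_mult, auto intro!: sum_nonneg simp: less_imp_le)
    qed
    finally show "ennreal (?S \<omega> powr p)
      \<le> ennreal ((T - t0) powr (p - 1)) * (\<Sum>j<N. ennreal (?d j) * ennreal (Q j \<omega> powr (2 * p)))" .
  qed
  also have "\<dots> = ennreal ((T - t0) powr (p - 1)) * (\<Sum>j<N. ennreal (?d j) * (\<integral>\<^sup>+\<omega>. ennreal (Q j \<omega> powr (2 * p)) \<partial>M))"
  proof -
    have m: "(\<lambda>\<omega>. ennreal (?d j) * ennreal (Q j \<omega> powr (2 * p))) \<in> borel_measurable M"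
      "(\<lambda>\<omega>. ennreal (Q j \<omega> powr (2 * p))) \<in> borel_measurable M" if "j < N" for j
      using QM[OF that] by measurable
    have "(\<integral>\<^sup>+\<omega>. ennreal ((T - t0) powr (p - 1)) * (\<Sum>j<N. ennreal (?d j) * ennreal (Q j \<omega> powr (2 * p))) \<partial>M)
       = ennreal ((T - t0) powr (p - 1)) * (\<integral>\<^sup>+\<omega>. (\<Sum>j<N. ennreal (?d j) * ennreal (Q j \<omega> powr (2 * p))) \<partial>M)"
      by (rule nn_integral_cmult) (intro borel_measurable_sum m, auto)
    also have "(\<integral>\<^sup>+\<omega>. (\<Sum>j<N. ennreal (?d j) * ennreal (Q j \<omega> powr (2 * p))) \<partial>M)
       = (\<Sum>j<N. \<integral>\<^sup>+\<omega>. ennreal (?d j) * ennreal (Q j \<omega> powr (2 * p)) \<partial>M)"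
      by (rule nn_integral_sum) (use m in auto)
    also have "\<dots> = (\<Sum>j<N. ennreal (?d j) * (\<integral>\<^sup>+\<omega>. ennreal (Q j \<omega> powr (2 * p)) \<partial>M))"
      by (intro sum.cong refl nn_integral_cmult m) auto
    finally show ?thesis .
  qed
  also have "\<dots> \<le> ennreal ((T - t0) powr (p - 1)) * (\<Sum>j<N. ennreal (?d j) * ennreal (K_sup (2 * p) * h powr p))"
  proof (intro mult_left_mono sum_mono)
    fix j assume "j \<in> {..<N}"
    then have j: "j < N" by simp
    have "ennreal (K_sup (2 * p) * sqrt (?d j) powr (2 * p)) \<le> ennreal (K_sup (2 * p) * h powr p)"
      by (intro ennreal_leI mult_left_mono sq[OF j] K_sup_nonneg)
    then show "(\<integral>\<^sup>+\<omega>. ennreal (Q j \<omega> powr (2 * p)) \<partial>M) \<le> ennreal (K_sup (2 * p) * h powr p)"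
      using QC[OF j] by (rule order_trans[rotated])
  qed auto
  also have "\<dots> = ennreal ((T - t0) powr (p - 1) * ((T - t0) * (K_sup (2 * p) * h powr p)))"
  proof -
    have "(\<Sum>j<N. ennreal (?d j) * ennreal (K_sup (2 * p) * h powr p)) = (\<Sum>j<N. ennreal (?d j)) * ennreal (K_sup (2 * p) * h powr p)"
      by (simp only: sum_distrib_right)
    also have "(\<Sum>j<N. ennreal (?d j)) = ennreal (T - t0)"
      unfolding sumd[symmetric] using d0 by (intro sum_ennreal) (auto simp: less_imp_le)
    also have "ennreal (T - t0) * ennreal (K_sup (2 * p) * h powr p) = ennreal ((T - t0) * (K_sup (2 * p) * h powr p))"
      using t0_T K_sup_nonneg by (intro ennreal_mult[symmetric]) auto
    finally show ?thesis
      using t0_T K_sup_nonneg by (simp only:) (rule ennreal_mult[symmetric], auto)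
  qed
  also have "(T - t0) powr (p - 1) * ((T - t0) * (K_sup (2 * p) * h powr p)) = (T - t0) powr p * K_sup (2 * p) * h powr p"
    using t0_T by (simp add: powr_diff)
  finally have "(\<integral>\<^sup>+\<omega>. ennreal (?S \<omega> powr p) \<partial>M) \<le> ennreal ((T - t0) powr p * K_sup (2 * p) * h powr p)" .
  then show ?thesis using QZ S by (intro exI[of _ Q] conjI allI impI)
qed

text \<open>\<open>path_bound\<close> on almost every path, with the majorant of the increments of
  \<open>Z\<close> over the whole interval in the place of \<open>Q\<close>. The moment of
  \<open>1 + B\<close> is recorded because linear growth enters the error bound in this
  form.\<close>

lemma path_moment:
  assumes X0m: "X0 \<in> borel_measurable M" and X0: "integrable M (\<lambda>\<omega>. norm (X0 \<omega>) powr p)" and p: "1 \<le> p"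
  shows "\<exists>B C. B \<in> borel_measurable M \<and> (\<forall>\<omega>. 0 \<le> B \<omega>) \<and>
    (AE \<omega> in M. \<forall>s\<in>{t0..T}. norm (X s \<omega>) \<le> B \<omega>) \<and> 0 \<le> C \<and>
    (\<integral>\<^sup>+\<omega>. ennreal ((1 + B \<omega>) powr p) \<partial>M) \<le> ennreal C"
proof -
  obtain Q where Qm[measurable]: "Q \<in> borel_measurable M" and Q0: "\<forall>\<omega>. 0 \<le> Q \<omega>"
    and QZ: "AE \<omega> in M. \<forall>s\<in>{t0..T}. norm (Z s \<omega> - Z t0 \<omega>) \<le> Q \<omega>"
    and QC: "(\<integral>\<^sup>+\<omega>. ennreal (Q \<omega> powr p) \<partial>M) \<le> ennreal (K_sup p * sqrt (T - t0) powr p)"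
    using Z_sup[OF order_refl t0_T order_refl, of p] p by auto
  define E where "E = 2 * exp (2 * c * (T - t0))"
  define k where "k = 1 + E * c * (T - t0)"
  define B where "B \<omega> = 2 * (norm (X0 \<omega>) + Q \<omega> + c * (T - t0)) * exp (2 * c * (T - t0))" for \<omega>
  have E0: "0 < E" by (simp add: E_def)
  have k0: "0 < k" unfolding k_def using E0 c_pos t0_T by (simp add: add_pos_nonneg)
  have B1: "1 + B \<omega> = k + E * norm (X0 \<omega>) + E * Q \<omega>" for \<omega>
    unfolding B_def k_def E_def by (simp add: algebra_simps)
  have B0: "0 \<le> B \<omega>" for \<omega> unfolding B_def using Q0 c_pos t0_T by simp
  have Bm: "B \<in> borel_measurable M" unfolding B_def[abs_def] using X0m by measurable
  have BX: "AE \<omega> in M. \<forall>s\<in>{t0..T}. norm (X s \<omega>) \<le> B \<omega>"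
    using QZ X_continuous Z_start
  proof eventually_elim
    case (elim \<omega>)
    show ?case
    proof
      fix s assume s: "s \<in> {t0..T}"
      have "norm (X s \<omega>) \<le> 2 * (norm (X t0 \<omega>) + Q \<omega> + c * (T - t0)) * exp (2 * c * (T - t0))"
        by (rule path_bound[OF elim(2) _ s]) (use elim(1) in \<open>simp add: Z_def\<close>)
      then show "norm (X s \<omega>) \<le> B \<omega>" unfolding B_def elim(3) .
    qed
  qed
  define x0 where "x0 = (\<integral>\<omega>. norm (X0 \<omega>) powr p \<partial>M)"
  define C where "C = 3 powr p * (k powr p + E powr p * x0 + E powr p * (K_sup p * sqrt (T - t0) powr p))"
  have x00: "0 \<le> x0" unfolding x0_def by (intro Bochner_Integration.integral_nonneg) simp
  have "(\<integral>\<^sup>+\<omega>. ennreal ((1 + B \<omega>) powr p) \<partial>M)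
      \<le> (\<integral>\<^sup>+\<omega>. ennreal (3 powr p) * (ennreal (k powr p) + ennreal (E powr p) * ennreal (norm (X0 \<omega>) powr p)
          + ennreal (E powr p) * ennreal (Q \<omega> powr p)) \<partial>M)"
  proof (rule nn_integral_mono)
    fix \<omega>
    have "(1 + B \<omega>) powr p \<le> 3 powr p * (k powr p + (E * norm (X0 \<omega>)) powr p + (E * Q \<omega>) powr p)"
      unfolding B1 using k0 E0 Q0 p by (intro powr_add3_le) auto
    also have "\<dots> = 3 powr p * (k powr p + E powr p * norm (X0 \<omega>) powr p + E powr p * Q \<omega> powr p)"
      by (simp only: powr_mult)
    finally have "ennreal ((1 + B \<omega>) powr p) \<le> ennreal (3 powr p * (k powr p + E powr p * norm (X0 \<omega>) powr p + E powr p * Q \<omega> powr p))"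
      by (rule ennreal_leI)
    then show "ennreal ((1 + B \<omega>) powr p) \<le> ennreal (3 powr p) * (ennreal (k powr p) + ennreal (E powr p) * ennreal (norm (X0 \<omega>) powr p)
          + ennreal (E powr p) * ennreal (Q \<omega> powr p))"
      by (simp add: ennreal_mult)
  qed
  also have "\<dots> = ennreal (3 powr p) * (ennreal (k powr p) + ennreal (E powr p) * (\<integral>\<^sup>+\<omega>. ennreal (norm (X0 \<omega>) powr p) \<partial>M)
          + ennreal (E powr p) * (\<integral>\<^sup>+\<omega>. ennreal (Q \<omega> powr p) \<partial>M))"
    using X0m by (simp add: nn_integral_cmult nn_integral_add emeasure_space_1)
  also have "(\<integral>\<^sup>+\<omega>. ennreal (norm (X0 \<omega>) powr p) \<partial>M) = ennreal x0"
    unfolding x0_def by (rule nn_integral_eq_integral[OF X0]) simp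
  also have "ennreal (3 powr p) * (ennreal (k powr p) + ennreal (E powr p) * ennreal x0
          + ennreal (E powr p) * (\<integral>\<^sup>+\<omega>. ennreal (Q \<omega> powr p) \<partial>M))
     \<le> ennreal (3 powr p) * (ennreal (k powr p) + ennreal (E powr p) * ennreal x0
          + ennreal (E powr p) * ennreal (K_sup p * sqrt (T - t0) powr p))"
    by (intro mult_left_mono add_left_mono QC) auto
  also have "\<dots> = ennreal C"
    unfolding C_def using x00 K_sup_nonneg by (simp add: ennreal_mult)
  finally have "(\<integral>\<^sup>+\<omega>. ennreal ((1 + B \<omega>) powr p) \<partial>M) \<le> ennreal C" .
  moreover have "0 \<le> C" unfolding C_def using x00 K_sup_nonneg by simp
  ultimately show ?thesis using Bm B0 BX by (intro exI[of _ B] exI[of _ C] conjI allI)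
qed

definition err :: "(nat \<Rightarrow> real) \<Rightarrow> nat \<Rightarrow> 'a \<Rightarrow> real" where
  "err \<tau> N \<omega> = (SUP n\<in>{0..N}. norm (X (\<tau> n) \<omega> - Y \<tau> n \<omega>))"

text \<open>The pathwise bound has three parts: the maximum \<open>m\<close> of the centred sums,
  the growth term with \<open>B\<close>, and the weighted squares \<open>S\<close>. Each has a
  moment of order \<open>p\<close> bounded by a multiple of \<open>h powr p\<close>. Here
  \<open>h\<close> is any upper bound of the steps.\<close>

lemma error_moment:
  assumes X0m: "X0 \<in> borel_measurable M" and X0: "integrable M (\<lambda>\<omega>. norm (X0 \<omega>) powr p)" and p: "1 \<le> p"
  shows "\<exists>C>0. \<forall>h N \<tau>. 0 < h \<longrightarrow> h \<le> 1 \<longrightarrow> c * A0_norm * h \<le> 1 / 2 \<longrightarrow> grid t0 T N \<tau> \<longrightarrow>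
    (\<forall>n<N. \<tau> (Suc n) - \<tau> n \<le> h) \<longrightarrow>
    (\<integral>\<^sup>+\<omega>. ennreal (err \<tau> N \<omega> powr p) \<partial>M) \<le> ennreal (C * h powr p)"
proof -
  obtain B CB where Bm[measurable]: "B \<in> borel_measurable M" and B0: "\<forall>\<omega>. 0 \<le> B \<omega>"
    and BX: "AE \<omega> in M. \<forall>s\<in>{t0..T}. norm (X s \<omega>) \<le> B \<omega>" and CB0: "0 \<le> CB"
    and BC: "(\<integral>\<^sup>+\<omega>. ennreal ((1 + B \<omega>) powr p) \<partial>M) \<le> ennreal CB"
    using path_moment[OF X0m X0 p] by (elim exE conjE)
  define CM where "CM = real CARD('d) powr p * (real CARD('d) * (4 * exp (1 / 4) * (2 * p) powr p * (K_mart * sqrt (T - t0)) powr p))"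
  define CQ where "CQ = (T - t0) powr p * K_sup (2 * p)"
  \<comment> \<open>The added 1 only ensures that \<open>C\<close> is positive.\<close>
  define C where "C = K_path powr p * (3 powr p * (CM + (T - t0) powr p * CB + CQ)) + 1"
  have CM0: "0 \<le> CM" "0 \<le> CQ" by (simp_all add: CM_def CQ_def K_sup_nonneg)
  have C0: "0 < C" unfolding C_def using CM0 CB0 by (intro add_nonneg_pos) auto
  have "(\<integral>\<^sup>+\<omega>. ennreal (err \<tau> N \<omega> powr p) \<partial>M) \<le> ennreal (C * h powr p)"
    if h: "0 < h" "h \<le> 1" "c * A0_norm * h \<le> 1 / 2" and g: "grid t0 T N \<tau>"
      and st: "\<forall>n<N. \<tau> (Suc n) - \<tau> n \<le> h" for h N \<tau>
  proof -
    have st': "\<tau> (Suc n) - \<tau> n \<le> h" if "n < N" for n using st that by blast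
    have p0: "0 < p" using p by simp
    obtain m where mm[measurable]: "m \<in> borel_measurable M" and m0: "\<forall>\<omega>. 0 \<le> m \<omega>"
      and mb: "\<forall>\<omega>. \<forall>n\<le>N. norm (\<Sum>j<n. one_step_martingale (\<lambda>s. X s \<omega>) (noise (\<tau> j) (\<tau> (Suc j)) \<omega>) (\<tau> j) (\<tau> (Suc j))) \<le> m \<omega>"
      and mC: "(\<integral>\<^sup>+\<omega>. ennreal (m \<omega> powr p) \<partial>M) \<le> ennreal (CM * h powr p)"
      using martingale_norm_moment[OF g st h(1) p0] unfolding CM_def by (elim exE conjE)
    obtain Q where QZ: "\<forall>j<N. AE \<omega> in M. \<forall>s\<in>{\<tau> j..\<tau> (Suc j)}. norm (Z s \<omega> - Z (\<tau> j) \<omega>) \<le> Q j \<omega>"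
      and Sm: "(\<lambda>\<omega>. \<Sum>j<N. (\<tau> (Suc j) - \<tau> j) * (Q j \<omega>)\<^sup>2) \<in> borel_measurable M"
      and SC: "(\<integral>\<^sup>+\<omega>. ennreal ((\<Sum>j<N. (\<tau> (Suc j) - \<tau> j) * (Q j \<omega>)\<^sup>2) powr p) \<partial>M) \<le> ennreal (CQ * h powr p)"
      using step_sup_moment[OF g st p] unfolding CQ_def by (elim exE conjE)
    define S where "S \<omega> = (\<Sum>j<N. (\<tau> (Suc j) - \<tau> j) * (Q j \<omega>)\<^sup>2)" for \<omega>
    have S0: "0 \<le> S \<omega>" for \<omega>
      unfolding S_def using g by (intro sum_nonneg mult_nonneg_nonneg) (auto simp: grid_def less_imp_le)
    have [measurable]: "S \<in> borel_measurable M" using Sm unfolding S_def[abs_def] .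
    have AEQ: "AE \<omega> in M. \<forall>j\<in>{..<N}. \<forall>s\<in>{\<tau> j..\<tau> (Suc j)}. norm (Z s \<omega> - Z (\<tau> j) \<omega>) \<le> Q j \<omega>"
      by (rule AE_ball_countable'[OF _ countable_finite[OF finite_lessThan]]) (use QZ in blast)
    have err: "AE \<omega> in M. err \<tau> N \<omega> \<le> K_path * (m \<omega> + h * (T - t0) * (1 + B \<omega>) + S \<omega>)"
      using AEQ BX X_continuous Z_start
    proof eventually_elim
      case (elim \<omega>)
      have "norm (X (\<tau> n) \<omega> - Y \<tau> n \<omega>) \<le> K_path * (m \<omega> + h * (T - t0) * (1 + B \<omega>) + S \<omega>)"
        if "n \<le> N" for n
        unfolding S_def
      proof (rule pathwise_error[where x="\<lambda>s. X s \<omega>" and y="\<lambda>n. Y \<tau> n \<omega>"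
            and w="\<lambda>j. noise (\<tau> j) (\<tau> (Suc j)) \<omega>" and h=h, OF elim(3) g st' h(2,3)])
        show "Y \<tau> 0 \<omega> = X t0 \<omega>" using elim(4) by simp
        show "Y \<tau> (Suc n) \<omega> = Y \<tau> n \<omega> + srk_drift (\<tau> n) (\<tau> (Suc n) - \<tau> n) (Y \<tau> n \<omega>) + noise (\<tau> n) (\<tau> (Suc n)) \<omega>" for n
          by (rule Y_Suc)
        show "norm (X s \<omega>) \<le> B \<omega>" if "s \<in> {t0..T}" for s using elim(2) that by blast
        show "norm (driftless (\<lambda>s. X s \<omega>) s - driftless (\<lambda>s. X s \<omega>) (\<tau> n)) \<le> Q n \<omega>"
          if "n < N" "s \<in> {\<tau> n..\<tau> (Suc n)}" for n s
          using elim(1) that unfolding Z_def by blast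
        show "norm (\<Sum>j<n. one_step_martingale (\<lambda>s. X s \<omega>) (noise (\<tau> j) (\<tau> (Suc j)) \<omega>) (\<tau> j) (\<tau> (Suc j))) \<le> m \<omega>"
          if "n \<le> N" for n using mb that by blast
      qed (use that in auto)
      then show ?case unfolding err_def by (intro cSUP_least) auto
    qed
    have err0: "0 \<le> err \<tau> N \<omega>" for \<omega>
    proof -
      have "norm (X (\<tau> 0) \<omega> - Y \<tau> 0 \<omega>) \<le> err \<tau> N \<omega>" unfolding err_def by (intro cSUP_upper) auto
      then show ?thesis using norm_ge_zero order_trans by blast
    qed
    have "(\<integral>\<^sup>+\<omega>. ennreal (err \<tau> N \<omega> powr p) \<partial>M)
       \<le> (\<integral>\<^sup>+\<omega>. ennreal (K_path powr p * 3 powr p) * (ennreal (m \<omega> powr p)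
            + ennreal ((h * (T - t0)) powr p) * ennreal ((1 + B \<omega>) powr p) + ennreal (S \<omega> powr p)) \<partial>M)"
    proof (rule nn_integral_mono_AE)
      show "AE \<omega> in M. ennreal (err \<tau> N \<omega> powr p) \<le> ennreal (K_path powr p * 3 powr p) * (ennreal (m \<omega> powr p)
            + ennreal ((h * (T - t0)) powr p) * ennreal ((1 + B \<omega>) powr p) + ennreal (S \<omega> powr p))"
        using err
      proof eventually_elim
        case (elim \<omega>)
        have "err \<tau> N \<omega> powr p \<le> (K_path * (m \<omega> + h * (T - t0) * (1 + B \<omega>) + S \<omega>)) powr p"
          using elim err0 p0 by (intro powr_mono2) auto
        also have "\<dots> = K_path powr p * (m \<omega> + h * (T - t0) * (1 + B \<omega>) + S \<omega>) powr p"
          by (rule powr_mult)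
        also have "\<dots> \<le> K_path powr p * (3 powr p * (m \<omega> powr p + (h * (T - t0) * (1 + B \<omega>)) powr p + S \<omega> powr p))"
          using m0 S0 B0 h(1) t0_T p0 by (intro mult_left_mono powr_add3_le) auto
        also have "(h * (T - t0) * (1 + B \<omega>)) powr p = (h * (T - t0)) powr p * (1 + B \<omega>) powr p"
          by (rule powr_mult)
        finally have "ennreal (err \<tau> N \<omega> powr p) \<le> ennreal (K_path powr p * (3 powr p * (m \<omega> powr p
            + (h * (T - t0)) powr p * (1 + B \<omega>) powr p + S \<omega> powr p)))"
          by (rule ennreal_leI)
        then show ?case by (simp add: ennreal_mult mult.assoc)
      qed
    qed
    also have "\<dots> = ennreal (K_path powr p * 3 powr p) * ((\<integral>\<^sup>+\<omega>. ennreal (m \<omega> powr p) \<partial>M)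
            + ennreal ((h * (T - t0)) powr p) * (\<integral>\<^sup>+\<omega>. ennreal ((1 + B \<omega>) powr p) \<partial>M) + (\<integral>\<^sup>+\<omega>. ennreal (S \<omega> powr p) \<partial>M))"
      by (simp add: nn_integral_cmult nn_integral_add)
    also have "\<dots> \<le> ennreal (K_path powr p * 3 powr p) * (ennreal (CM * h powr p)
            + ennreal ((h * (T - t0)) powr p) * ennreal CB + ennreal (CQ * h powr p))"
      using SC unfolding S_def[symmetric] by (intro mult_left_mono add_mono mC BC) auto
    also have "\<dots> = ennreal (K_path powr p * 3 powr p * (CM * h powr p + (h * (T - t0)) powr p * CB + CQ * h powr p))"
      using CM0 CB0 by (simp add: ennreal_mult)
    also have "\<dots> \<le> ennreal (C * h powr p)"
    proof (rule ennreal_leI)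
      have "(h * (T - t0)) powr p = h powr p * (T - t0) powr p" by (rule powr_mult)
      then have "K_path powr p * 3 powr p * (CM * h powr p + (h * (T - t0)) powr p * CB + CQ * h powr p) = (C - 1) * h powr p"
        unfolding C_def by (simp add: algebra_simps)
      also have "\<dots> \<le> C * h powr p" by (intro mult_right_mono) auto
      finally show "K_path powr p * 3 powr p * (CM * h powr p + (h * (T - t0)) powr p * CB + CQ * h powr p) \<le> C * h powr p" .
    qed
    finally show ?thesis .
  qed
  then show ?thesis using C0 by blast
qed

lemma err_measurable:
  assumes X0: "X0 \<in> borel_measurable M" and g: "grid t0 T N \<tau>"
    and h: "\<And>n. n < N \<Longrightarrow> \<tau> (Suc n) - \<tau> n \<le> h" "c * A0_norm * h \<le> 1 / 2"
  shows "err \<tau> N \<in> borel_measurable M"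
proof -
  have eq: "err \<tau> N = (\<lambda>\<omega>. Max ((\<lambda>n. norm (X (\<tau> n) \<omega> - Y \<tau> n \<omega>)) ` {0..N}))"
    unfolding err_def by (intro ext cSup_eq_Max) auto
  have m: "(\<lambda>\<omega>. norm (X (\<tau> n) \<omega> - Y \<tau> n \<omega>)) \<in> borel_measurable M" if n: "n \<le> N" for n
  proof -
    have "X (\<tau> n) \<in> borel_measurable M" by (rule X_measurable) (use grid_bounds[OF g n] in simp)
    moreover have "Y \<tau> n \<in> borel_measurable M" by (rule Y_measurable[OF X0 g _ h(2) n]) (rule h(1))
    ultimately show ?thesis by measurable
  qed
  show ?thesis unfolding eq by (intro borel_measurable_Max m) auto
qed

end

section \<open>Convergence of order 1 in the mean of the maximal error over the grid\<close>

theorem theorem3p6: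
  fixes M :: "'a measure"
    and F :: "real \<Rightarrow> 'a measure"
    and W :: "'m::finite \<Rightarrow> real \<Rightarrow> 'a \<Rightarrow> real"
    and t0 T p c :: real
    and X0 :: "'a \<Rightarrow> real^'d"
    and X :: "real \<Rightarrow> 'a \<Rightarrow> real^'d"
    and a :: "real \<Rightarrow> real^'d \<Rightarrow> real^'d"
    and b :: "'m \<Rightarrow> real \<Rightarrow> real^'d"
    and \<alpha> \<beta> c0 c1 :: "real^'s"
    and A0 :: "real^'s^'s"
  assumes "prob_space M" and "complete_measure M" and "usual_filtration M F"
    and "0 \<le> t0" and "t0 < T"
    and "\<And>k. wiener_process M F (W k)" and "independent_processes M W"
    and "p \<ge> 2"
    and "X0 \<in> borel_measurable (F t0)"
    and "integrable M (\<lambda>\<omega>. norm (X0 \<omega>) powr (2 * p))"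
    and "C12_on {t0..T} a"
    and "\<And>k. C2_on {t0..T} (b k)"
    and "c > 0"
    and "\<And>t x. t \<in> {t0..T} \<Longrightarrow> norm (a t x) \<le> c * (1 + norm x)"
    and "\<And>t k. t \<in> {t0..T} \<Longrightarrow> norm (b k t) \<le> c"
    and "\<And>t x y. t \<in> {t0..T} \<Longrightarrow> norm (a t x - a t y) \<le> c * norm (x - y)"
    and "\<And>t x q. t \<in> {t0..T} \<Longrightarrow> norm (space_deriv q a t x) \<le> c"
    and "\<And>t x q r. t \<in> {t0..T} \<Longrightarrow> norm (space_deriv q (space_deriv r a) t x) \<le> c"
    and "\<And>t x. t \<in> {t0..T} \<Longrightarrow> norm (time_deriv {t0..T} (\<lambda>s. a s x) t) \<le> c * (1 + norm x)"
    and "\<And>t k. t \<in> {t0..T} \<Longrightarrow> norm (time_deriv {t0..T} (b k) t) \<le> c"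
    and "\<And>t k. t \<in> {t0..T} \<Longrightarrow>
           norm (time_deriv {t0..T} (time_deriv {t0..T} (b k)) t) \<le> c"
    and "sde_additive_solution M F W t0 T a b X0 X"
    and "\<And>i. c0 $ i \<in> {0..1}" and "\<And>i. c1 $ i \<in> {0..1}"
    and "\<alpha> \<bullet> 1 = 1" and "\<beta> \<bullet> 1 = 1"
  shows "\<exists>h0>0. \<exists>C>0. \<forall>h. 0 < h \<longrightarrow> h \<le> h0 \<longrightarrow>
           (\<forall>N \<tau>. grid t0 T N \<tau> \<longrightarrow> max_step N \<tau> = h \<longrightarrow>
              (let Y = srk_additive a b \<alpha> \<beta> A0 c0 c1 W X0 \<tau>;
                   err = (\<lambda>\<omega>. SUP n\<in>{0..N}. norm (X (\<tau> n) \<omega> - Y n \<omega>))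
               in integrable M (\<lambda>\<omega>. err \<omega> powr p) \<and>
                  (\<integral>\<omega>. err \<omega> powr p \<partial>M) powr (1 / p) \<le> C * h))"
proof -
  interpret prob_space M by fact
  interpret fs: filtered_space M F
    unfolding filtered_space_def filtered_space_axioms_def by (intro conjI assms(1-3))
  interpret S: srk_approximation M F a t0 T c W b X0 X \<alpha> c0 A0 \<beta> c1
  proof unfold_locales
    show "b k differentiable_on {t0..T}" for k using assms(12)[of k] unfolding C2_on_def by blast
  qed (use assms in auto)
  have X0m: "X0 \<in> borel_measurable M" using fs.measurable_F_M[OF assms(4,9)] .
  have intX: "integrable M (\<lambda>\<omega>. norm (X0 \<omega>) powr p)"
  proof (rule Bochner_Integration.integrable_bound)
    show "integrable M (\<lambda>\<omega>. 1 + norm (X0 \<omega>) powr (2 * p))" using assms(10) by simp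
    show "(\<lambda>\<omega>. norm (X0 \<omega>) powr p) \<in> borel_measurable M" using X0m by measurable
    \<comment> \<open>The power \<open>p\<close> is dominated by 1 for arguments up to 1 and by the
      power \<open>2 * p\<close> beyond, which reduces the moment of the initial value to the given
      one.\<close>
    have "x powr p \<le> 1 + x powr (2 * p)" if "0 \<le> x" for x :: real
    proof (cases "x \<le> 1")
      case True
      then have "x powr p \<le> 1" using that assms(8) by (intro powr_le1) auto
      then show ?thesis by (simp add: add_increasing2)
    next
      case False
      then have "x powr p \<le> x powr (2 * p)" using assms(8) by (intro powr_mono) auto
      then show ?thesis by simp
    qed
    then show "AE \<omega> in M. norm (norm (X0 \<omega>) powr p) \<le> norm (1 + norm (X0 \<omega>) powr (2 * p))" by simp
  qed
  have p1: "1 \<le> p" using assms(8) by simp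
  from S.error_moment[OF X0m intX p1] obtain C where C: "0 < C"
    and C': "\<forall>h N \<tau>. 0 < h \<longrightarrow> h \<le> 1 \<longrightarrow> c * S.A0_norm * h \<le> 1 / 2 \<longrightarrow> grid t0 T N \<tau> \<longrightarrow>
      (\<forall>n<N. \<tau> (Suc n) - \<tau> n \<le> h) \<longrightarrow>
      (\<integral>\<^sup>+\<omega>. ennreal (S.err \<tau> N \<omega> powr p) \<partial>M) \<le> ennreal (C * h powr p)"
    by (elim exE conjE)
  \<comment> \<open>Small enough for the stage map to be a contraction with factor
    \<open>1 / 2\<close>, and at most 1 as in the pathwise estimate; the added 1 also covers
    \<open>A0_norm = 0\<close>.\<close>
  define h0 where "h0 = 1 / (2 * (c * S.A0_norm + 1))"
  have cA: "0 \<le> c * S.A0_norm" using assms(13) S.A0_norm_nonneg by simp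
  then have h0: "0 < h0" "h0 \<le> 1" "c * S.A0_norm * h0 \<le> 1 / 2"
    unfolding h0_def by (simp_all add: divide_simps)
  have main: "integrable M (\<lambda>\<omega>. S.err \<tau> N \<omega> powr p) \<and>
      (\<integral>\<omega>. S.err \<tau> N \<omega> powr p \<partial>M) powr (1 / p) \<le> C powr (1 / p) * h"
    if h: "0 < h" "h \<le> h0" and g: "grid t0 T N \<tau>" and ms: "max_step N \<tau> = h" for h N \<tau>
  proof -
    have st: "\<tau> (Suc n) - \<tau> n \<le> h" if "n < N" for n
      unfolding ms[symmetric] max_step_def using that by (intro Max_ge) auto
    have hA: "c * S.A0_norm * h \<le> 1 / 2"
      using order_trans[OF mult_left_mono[OF h(2) cA] h0(3)] .
    have bound: "(\<integral>\<^sup>+\<omega>. ennreal (S.err \<tau> N \<omega> powr p) \<partial>M) \<le> ennreal (C * h powr p)"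
      by (rule C'[rule_format, OF h(1) order_trans[OF h(2) h0(2)] hA g]) (rule st)
    have "S.err \<tau> N \<in> borel_measurable M" by (rule S.err_measurable[OF X0m g _ hA]) (rule st)
    then have m: "(\<lambda>\<omega>. S.err \<tau> N \<omega> powr p) \<in> borel_measurable M" by measurable
    have int: "integrable M (\<lambda>\<omega>. S.err \<tau> N \<omega> powr p)"
    proof (rule integrableI_nonneg[OF m])
      show "(\<integral>\<^sup>+\<omega>. ennreal (S.err \<tau> N \<omega> powr p) \<partial>M) < \<infinity>"
        by (rule le_less_trans[OF bound]) simp
    qed simp
    have "ennreal (\<integral>\<omega>. S.err \<tau> N \<omega> powr p \<partial>M) \<le> ennreal (C * h powr p)"
      using bound nn_integral_eq_integral[OF int] by simp
    then have "(\<integral>\<omega>. S.err \<tau> N \<omega> powr p \<partial>M) \<le> C * h powr p"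
      using C by (subst (asm) ennreal_le_iff) auto
    then have "(\<integral>\<omega>. S.err \<tau> N \<omega> powr p \<partial>M) powr (1 / p) \<le> (C * h powr p) powr (1 / p)"
      using assms(8) by (intro powr_mono2 Bochner_Integration.integral_nonneg) auto
    also have "\<dots> = C powr (1 / p) * h"
      using C h(1) assms(8) by (simp add: powr_mult powr_powr)
    finally show ?thesis using int by blast
  qed
  show ?thesis
  proof (rule exI[of _ h0], rule conjI[OF h0(1)], rule exI[of _ "C powr (1 / p)"], intro conjI allI impI)
    show "0 < C powr (1 / p)" using C by simp
    fix h N \<tau> assume "0 < h" "h \<le> h0" "grid t0 T N \<tau>" "max_step N \<tau> = h"
    from main[OF this] show "let Y = srk_additive a b \<alpha> \<beta> A0 c0 c1 W X0 \<tau>;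
          err = (\<lambda>\<omega>. SUP n\<in>{0..N}. norm (X (\<tau> n) \<omega> - Y n \<omega>))
      in integrable M (\<lambda>\<omega>. err \<omega> powr p) \<and> (\<integral>\<omega>. err \<omega> powr p \<partial>M) powr (1 / p) \<le> C powr (1 / p) * h"
      unfolding Let_def S.err_def .
  qed
qed

end
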